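(* There exists an absolute constant $c_1>0$ such that for every convex body $K$ in $\mathbb{R}^n$ with barycenter at $0$ and every integer $1\leqslant k\leqslant n-1$, $$S(K)\leqslant \frac{d_n}{d_{n-k}}\,(c_1L_K)^{\frac{k(n-k-1)}{n-k}}\,t(K)\,|K|^{\frac{k}{n}}\max_{H\in G_{n,n-k}}S(K\cap H),$$ where $d_s=s\,\omega_s^{1/s}$.
   Context: A convex body in $\mathbb{R}^n$ is a compact convex set with non-empty interior; $|\cdot|$ is volume, $B_2^n$ the Euclidean unit ball, $\omega_s=|B_2^s|$. $G_{n,s}$ is the Grassmannian of $s$-dimensional linear subspaces of $\mathbb{R}^n$. $S(A)$ denotes the surface area of a convex body $A$ in its appropriate dimension: if $A$ lies in an $m$-dimensional Euclidean space $E$ with unit ball $B_E$, then $S(A)=\lim_{t\to0^+}\frac{|A+tB_E|-|A|}{t}$ (it equals $2$ for a segment when $m=1$); $S(K\cap H)$ is computed in $H$. The inradius $r(K)$ is the largest $r>0$ such that $x_0+rB_2^n\subseteq K$ for some $x_0\in K$, and $t(K)=\left(\frac{|K|}{|r(K)B_2^n|}\right)^{1/n}$. $L_K$ is the isotropic constant of $K$: a convex body $\tilde K$ is isotropic if it has volume $1$, barycenter at the origin, and $\int_{\tilde K}\langle x,\xi\rangle^2dx=L_{\tilde K}^2$ for all $\xi\in S^{n-1}$ and some constant $L_{\tilde K}>0$; for a general convex body $K$, $L_K:=L_{\tilde K}$ for any isotropic affine image $\tilde K$ of $K$. *)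

theory Defs
  imports "HOL-Analysis.Analysis"
begin

text \<open>
  A constant that is uniform in the dimension \<open>n\<close> cannot be stated with the dimension as a
  type. So the spaces \<open>\<real>\<^sup>n\<close> are realised as the subspaces \<open>euc n\<close> of a single inner product
  space, the space \<open>fseq\<close> of finitely supported real sequences with the \<open>\<ell>\<^sup>2\<close> inner product.
  On each \<open>euc n\<close> this induces the usual Euclidean structure and topology.
\<close>

typedef fseq = "{f :: nat \<Rightarrow> real. finite {i. f i \<noteq> 0}}"
  morphisms coord Abs_fseq
proof
  show "(\<lambda>_. 0) \<in> {f :: nat \<Rightarrow> real. finite {i. f i \<noteq> 0}}" by simp
qed

lemma finite_coord: "finite {i. coord x i \<noteq> 0}"
  using coord[of x] by simp

lemma coord_Abs: "finite {i. f i \<noteq> 0} \<Longrightarrow> coord (Abs_fseq f) = f"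
  by (simp add: Abs_fseq_inverse)

lemma fseq_eqI: "(\<And>i. coord x i = coord y i) \<Longrightarrow> x = y"
  by (metis coord_inject ext)

instantiation fseq :: real_vector
begin

definition zero_fseq :: fseq where "0 = Abs_fseq (\<lambda>_. 0)"
definition plus_fseq :: "fseq \<Rightarrow> fseq \<Rightarrow> fseq" where
  "x + y = Abs_fseq (\<lambda>i. coord x i + coord y i)"
definition minus_fseq :: "fseq \<Rightarrow> fseq \<Rightarrow> fseq" where
  "x - y = Abs_fseq (\<lambda>i. coord x i - coord y i)"
definition uminus_fseq :: "fseq \<Rightarrow> fseq" where
  "- x = Abs_fseq (\<lambda>i. - coord x i)"
definition scaleR_fseq :: "real \<Rightarrow> fseq \<Rightarrow> fseq" where
  "a *\<^sub>R x = Abs_fseq (\<lambda>i. a * coord x i)"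

lemma coord_zero [simp]: "coord 0 i = 0"
  by (simp add: zero_fseq_def coord_Abs)

lemma coord_add [simp]: "coord (x + y) i = coord x i + coord y i"
proof -
  have "{i. coord x i + coord y i \<noteq> 0} \<subseteq> {i. coord x i \<noteq> 0} \<union> {i. coord y i \<noteq> 0}"
    by auto
  then have "finite {i. coord x i + coord y i \<noteq> 0}"
    by (rule finite_subset) (simp add: finite_coord)
  then show ?thesis by (simp add: plus_fseq_def coord_Abs)
qed

lemma coord_diff [simp]: "coord (x - y) i = coord x i - coord y i"
proof -
  have "{i. coord x i - coord y i \<noteq> 0} \<subseteq> {i. coord x i \<noteq> 0} \<union> {i. coord y i \<noteq> 0}"
    by auto
  then have "finite {i. coord x i - coord y i \<noteq> 0}"
    by (rule finite_subset) (simp add: finite_coord)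
  then show ?thesis by (simp add: minus_fseq_def coord_Abs)
qed

lemma coord_uminus [simp]: "coord (- x) i = - coord x i"
  by (simp add: uminus_fseq_def coord_Abs finite_coord)

lemma coord_scaleR [simp]: "coord (a *\<^sub>R x) i = a * coord x i"
proof -
  have "{i. a * coord x i \<noteq> 0} \<subseteq> {i. coord x i \<noteq> 0}"
    by auto
  then have "finite {i. a * coord x i \<noteq> 0}"
    by (rule finite_subset) (rule finite_coord)
  then show ?thesis by (simp add: scaleR_fseq_def coord_Abs)
qed

instance
  by standard (auto intro!: fseq_eqI simp: algebra_simps)

end

instantiation fseq :: real_inner
begin

definition inner_fseq :: "fseq \<Rightarrow> fseq \<Rightarrow> real" where
  "x \<bullet> y = (\<Sum>i | coord x i \<noteq> 0. coord x i * coord y i)"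
definition norm_fseq :: "fseq \<Rightarrow> real" where
  "norm_fseq x = sqrt (x \<bullet> x)"
definition dist_fseq :: "fseq \<Rightarrow> fseq \<Rightarrow> real" where
  "dist_fseq x y = norm (x - y)"
definition sgn_fseq :: "fseq \<Rightarrow> fseq" where
  "sgn_fseq x = x /\<^sub>R norm x"
definition uniformity_fseq :: "(fseq \<times> fseq) filter" where
  "uniformity_fseq = (INF e\<in>{0<..}. principal {(x, y). dist x y < e})"
definition open_fseq :: "fseq set \<Rightarrow> bool" where
  "open_fseq U \<longleftrightarrow> (\<forall>x\<in>U. \<forall>\<^sub>F (x', y) in uniformity. x' = x \<longrightarrow> y \<in> U)"

lemma inner_fseq_superset:
  assumes "finite A" and "\<And>i. i \<notin> A \<Longrightarrow> coord x i = 0 \<or> coord y i = 0"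
  shows "x \<bullet> y = (\<Sum>i\<in>A. coord x i * coord y i)"
proof -
  have "x \<bullet> y = (\<Sum>i\<in>A \<union> {i. coord x i \<noteq> 0}. coord x i * coord y i)"
    unfolding inner_fseq_def
    by (rule sum.mono_neutral_left) (auto simp: assms(1) finite_coord)
  also have "\<dots> = (\<Sum>i\<in>A. coord x i * coord y i)"
    by (rule sum.mono_neutral_right) (use assms in \<open>auto simp: finite_coord\<close>)
  finally show ?thesis .
qed

instance
proof
  fix x y z :: fseq and r :: real
  show "x \<bullet> y = y \<bullet> x"
    using inner_fseq_superset[of "{i. coord x i \<noteq> 0}" y x]
    by (auto simp: finite_coord inner_fseq_def[of x y] mult.commute)
  have inner: "v \<bullet> w = (\<Sum>i | coord w i \<noteq> 0. coord v i * coord w i)" for v w :: fseq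
    by (rule inner_fseq_superset) (auto simp: finite_coord)
  show "(x + y) \<bullet> z = x \<bullet> z + y \<bullet> z"
    by (simp add: inner[of _ z] distrib_right sum.distrib)
  show "(r *\<^sub>R x) \<bullet> y = r * (x \<bullet> y)"
    by (simp add: inner[of _ y] sum_distrib_left mult.assoc)
  show "0 \<le> x \<bullet> x"
    by (simp add: inner_fseq_def sum_nonneg)
  show "x \<bullet> x = 0 \<longleftrightarrow> x = 0"
  proof
    assume "x \<bullet> x = 0"
    then have "\<forall>i\<in>{i. coord x i \<noteq> 0}. coord x i * coord x i = 0"
      unfolding inner_fseq_def
      by (subst (asm) sum_nonneg_eq_0_iff) (auto simp: finite_coord)
    then show "x = 0" by (auto intro: fseq_eqI)
  qed (simp add: inner_fseq_def)
qed (simp_all add: norm_fseq_def dist_fseq_def sgn_fseq_def uniformity_fseq_def open_fseq_def)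

end

definition euc :: "nat \<Rightarrow> fseq set" where
  "euc n = {x. \<forall>i\<ge>n. coord x i = 0}"

definition unit_vec :: "nat \<Rightarrow> fseq" where
  "unit_vec i = Abs_fseq (\<lambda>j. if j = i then 1 else 0)"

definition grassmannian :: "nat \<Rightarrow> nat \<Rightarrow> fseq set set" where
  "grassmannian n s = {H. subspace H \<and> H \<subseteq> euc n \<and> dim H = s}"

definition orthonormal_basis_of :: "fseq set \<Rightarrow> (nat \<Rightarrow> fseq) \<Rightarrow> bool" where
  "orthonormal_basis_of E u \<longleftrightarrow>
     (\<forall>i<dim E. \<forall>j<dim E. u i \<bullet> u j = (if i = j then 1 else 0)) \<and> span (u ` {..<dim E}) = E"

text \<open>
  Lebesgue measure on a finite-dimensional subspace \<open>E\<close>: the image of Lebesgue measure on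
  coordinate tuples under the isometry given by an orthonormal basis. By rotation invariance it
  does not depend on the chosen basis. It is restricted to Borel sets, which suffices since all
  sets measured below are compact.
\<close>

definition lebesgue_sub :: "fseq set \<Rightarrow> fseq measure" where
  "lebesgue_sub E =
     (let u = (SOME u. orthonormal_basis_of E u)
      in distr (\<Pi>\<^sub>M i\<in>{..<dim E}. lborel) (restrict_space borel E)
           (\<lambda>c. \<Sum>i<dim E. c i *\<^sub>R u i))"

definition vol :: "fseq set \<Rightarrow> fseq set \<Rightarrow> real" where
  "vol E A = measure (lebesgue_sub E) A"

definition unit_ball :: "fseq set \<Rightarrow> fseq set" where
  "unit_ball E = cball 0 1 \<inter> E"

definition convex_body :: "nat \<Rightarrow> fseq set \<Rightarrow> bool" where
  "convex_body n K \<longleftrightarrow>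
     K \<subseteq> euc n \<and> compact K \<and> convex K \<and> (top_of_set (euc n)) interior_of K \<noteq> {}"

definition surface_area :: "fseq set \<Rightarrow> fseq set \<Rightarrow> real" where
  "surface_area E A =
     Lim (at_right 0)
       (\<lambda>t. (vol E {a + t *\<^sub>R b | a b. a \<in> A \<and> b \<in> unit_ball E} - vol E A) / t)"

definition omega :: "nat \<Rightarrow> real" where
  "omega s = vol (euc s) (unit_ball (euc s))"

definition d_const :: "nat \<Rightarrow> real" where
  "d_const s = real s * omega s powr (1 / real s)"

definition inradius :: "nat \<Rightarrow> fseq set \<Rightarrow> real" where
  "inradius n K =
     (GREATEST r. 0 < r \<and> (\<exists>x\<^sub>0\<in>K. {x\<^sub>0 + r *\<^sub>R b | b. b \<in> unit_ball (euc n)} \<subseteq> K))"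

definition t_ratio :: "nat \<Rightarrow> fseq set \<Rightarrow> real" where
  "t_ratio n K =
     (vol (euc n) K / vol (euc n) ((*\<^sub>R) (inradius n K) ` unit_ball (euc n))) powr (1 / real n)"

text \<open>Written in coordinates because \<open>fseq\<close> is not complete, so the vector-valued Bochner
  integral is not available for it.\<close>

definition barycenter :: "nat \<Rightarrow> fseq set \<Rightarrow> fseq" where
  "barycenter n K =
     (\<Sum>i<n. ((LINT x:K|lebesgue_sub (euc n). coord x i) / vol (euc n) K) *\<^sub>R unit_vec i)"

definition isotropic :: "nat \<Rightarrow> fseq set \<Rightarrow> real \<Rightarrow> bool" where
  "isotropic n K L \<longleftrightarrow>
     convex_body n K \<and> vol (euc n) K = 1 \<and> barycenter n K = 0 \<and> L > 0 \<and>
     (\<forall>\<xi>\<in>euc n. norm \<xi> = 1 \<longrightarrow> (LINT x:K|lebesgue_sub (euc n). (x \<bullet> \<xi>)\<^sup>2) = L\<^sup>2)"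

text \<open>The value does not depend on the isotropic affine image that is chosen.\<close>

definition isotropic_constant :: "nat \<Rightarrow> fseq set \<Rightarrow> real" where
  "isotropic_constant n K =
     (SOME L. \<exists>T b. linear T \<and> bij_betw T (euc n) (euc n) \<and> b \<in> euc n \<and>
                isotropic n ((\<lambda>x. T x + b) ` K) L)"

end

theory Submission
  imports Defs "HOL-Probability.Distributions"
begin

text \<open>
  Write \<open>m = n - k\<close> and \<open>V\<close> for the volume of \<open>K\<close>. Three inequalities multiply to the theorem.

  \<^item> A body that contains a ball of radius \<open>r\<close> about \<open>x\<close> satisfies
    \<open>K + tB \<subseteq> (1 + t/r) K - (t/r) x\<close>, so its surface area is at most \<open>n V / r\<close>. For the inradius
    this reads \<open>S(K) \<le> d\<^sub>n t(K) V\<close> to the power \<open>(n - 1)/n\<close> (\<open>surface_area_le_t_ratio\<close>).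

  \<^item> Some central section \<open>K \<inter> H\<close> of dimension \<open>m\<close> is large: \<open>V\<close> to the power \<open>m/n\<close> is at most
    \<open>(c L\<^sub>K)\<^sup>k |K \<inter> H|\<close> with \<open>c = sqrt (2 \<pi> e)\<close> (\<open>large_central_section\<close>).

  \<^item> The isoperimetric inequality in \<open>H\<close> bounds \<open>S(K \<inter> H)\<close> below by \<open>d\<^sub>m\<close> times \<open>|K \<inter> H|\<close> to the
    power \<open>(m - 1)/m\<close> (\<open>surface_area_bounds\<close>).

  The second inequality is the heart. If \<open>K\<close> is isotropic, let \<open>g(y)\<close> be the volume of its section
  by the translate \<open>F + y\<close> of an \<open>m\<close>-dimensional subspace. By Brunn-Minkowski \<open>g\<close> is log-concave, so
  a tangent at the origin gives \<open>g(y) \<le> g(0) exp (v \<bullet> y)\<close>. Comparing \<open>g\<close> with the Gaussian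
  density of the same covariance \<open>L\<^sup>2\<close>, that is, using that the Gaussian maximises entropy, yields
  \<open>g(0) \<ge> (c L)\<close> to the power \<open>-k\<close> for every \<open>F\<close> (\<open>isotropic_central_section\<close>). For general \<open>K\<close>,
  take the singular value decomposition of a map \<open>T\<close> onto an isotropic position and let \<open>H\<close> be
  spanned by the \<open>m\<close> directions that \<open>T\<close> stretches least: the volume factor of \<open>T\<close> on \<open>H\<close> is then at
  most the power \<open>m/n\<close> of its determinant.

  Brunn-Minkowski also shows that the limit defining the surface area exists. Since the dimension is
  a number and not a type, Lebesgue measure on the span of \<open>u\<^sub>0, \<dots>, u\<^sub>m\<^sub>-\<^sub>1\<close> is treated as the measure
  \<open>leb m u\<close> on the whole space, and most facts about it are inductions on \<open>m\<close> by Fubini. That for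
  orthonormal \<open>u\<close> it depends only on the span is \<open>leb_basis_independent\<close>.
\<close>

section \<open>Orthonormal systems\<close>

definition orthonormal :: "nat \<Rightarrow> (nat \<Rightarrow> 'a::real_inner) \<Rightarrow> bool" where
  "orthonormal m u \<longleftrightarrow> (\<forall>i<m. \<forall>j<m. u i \<bullet> u j = (if i = j then 1 else 0))"

lemma orthonormal_inner:
  "orthonormal m u \<Longrightarrow> i < m \<Longrightarrow> j < m \<Longrightarrow> u i \<bullet> u j = (if i = j then 1 else 0)"
  by (simp add: orthonormal_def)

lemma orthonormal_mono: "orthonormal m u \<Longrightarrow> k \<le> m \<Longrightarrow> orthonormal k u"
  by (simp add: orthonormal_def)

lemma orthonormal_norm:
  assumes "orthonormal m u" "i < m" shows "norm (u i) = 1"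
  using assms by (simp add: orthonormal_def norm_eq_sqrt_inner)

lemma comb_inner:
  assumes "orthonormal m u" "j < m"
  shows "(\<Sum>i<m. c i *\<^sub>R u i) \<bullet> u j = c j"
proof -
  have "(\<Sum>i<m. c i *\<^sub>R u i) \<bullet> u j = (\<Sum>i<m. if i = j then c i else 0)"
    unfolding inner_sum_left using assms by (intro sum.cong) (auto simp: orthonormal_def)
  then show ?thesis using assms by (simp add: sum.delta)
qed

lemma comb_inner_comb:
  assumes "orthonormal m u"
  shows "(\<Sum>i<m. c i *\<^sub>R u i) \<bullet> (\<Sum>i<m. d i *\<^sub>R u i) = (\<Sum>i<m. c i * d i)"
  unfolding inner_sum_right using comb_inner[OF assms, of _ c]
  by (intro sum.cong) (auto simp: mult.commute)

lemma comb_norm: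
  assumes "orthonormal m u"
  shows "(norm (\<Sum>i<m. c i *\<^sub>R u i))\<^sup>2 = (\<Sum>i<m. (c i)\<^sup>2)"
  unfolding power2_norm_eq_inner comb_inner_comb[OF assms] by (simp add: power2_eq_square)

lemma comb_in_span: "(\<Sum>i<m. c i *\<^sub>R u i) \<in> span (u ` {..<m})"
  by (intro span_sum span_scale span_base) auto

lemma span_expand:
  assumes "orthonormal m u" "x \<in> span (u ` {..<m})"
  shows "(\<Sum>i<m. (x \<bullet> u i) *\<^sub>R u i) = x"
  using assms(2)
proof (induction rule: span_induct_alt)
  case base
  then show ?case by simp
next
  case (step c x y)
  then obtain j where j: "j < m" "x = u j" by auto
  have "(\<Sum>i<m. (u j \<bullet> u i) *\<^sub>R u i) = (\<Sum>i<m. if i = j then u j else 0)"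
    using assms j by (intro sum.cong) (auto simp: orthonormal_def)
  also have "\<dots> = u j" using j by (simp add: sum.delta)
  finally have "(\<Sum>i<m. (u j \<bullet> u i) *\<^sub>R u i) = u j" .
  moreover have "(\<Sum>i<m. ((c *\<^sub>R x + y) \<bullet> u i) *\<^sub>R u i)
     = c *\<^sub>R (\<Sum>i<m. (u j \<bullet> u i) *\<^sub>R u i) + (\<Sum>i<m. (y \<bullet> u i) *\<^sub>R u i)"
    by (simp add: j inner_add_left scaleR_add_left sum.distrib scaleR_sum_right)
  ultimately show ?case using step j by simp
qed

lemma span_eq_expand:
  assumes "orthonormal m u"
  shows "span (u ` {..<m}) = {x. (\<Sum>i<m. (x \<bullet> u i) *\<^sub>R u i) = x}"
  using span_expand[OF assms] comb_in_span[of "\<lambda>i. _ \<bullet> u i" u m] by (auto, metis)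

lemma closed_span_orthonormal:
  assumes "orthonormal m u" shows "closed (span (u ` {..<m}))"
  unfolding span_eq_expand[OF assms] by (intro closed_Collect_eq continuous_intros)

lemma orthonormal_independent:
  assumes "orthonormal m u"
  shows "independent (u ` {..<m})" "inj_on u {..<m}" "card (u ` {..<m}) = m"
proof -
  have inj: "inj_on u {..<m}"
  proof (rule inj_onI)
    fix i j assume "i \<in> {..<m}" "j \<in> {..<m}" "u i = u j"
    then show "i = j" using assms by (metis lessThan_iff orthonormal_inner zero_neq_one)
  qed
  then show "inj_on u {..<m}" "card (u ` {..<m}) = m" by (auto simp: card_image)
  show "independent (u ` {..<m})"
  proof (rule pairwise_orthogonal_independent)
    show "pairwise orthogonal (u ` {..<m})"
      using assms by (auto simp: pairwise_def orthogonal_def orthonormal_def)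
    show "0 \<notin> u ` {..<m}"
      using orthonormal_norm[OF assms] by force
  qed
qed

lemma dim_span_orthonormal:
  assumes "orthonormal m u" shows "dim (span (u ` {..<m})) = m"
  using dim_span_eq_card_independent[OF orthonormal_independent(1)[OF assms]]
    orthonormal_independent(3)[OF assms] by simp

text \<open>The Gram-Schmidt step.\<close>

lemma orthonormal_extend:
  assumes on: "orthonormal i u" and sub: "span (u ` {..<i}) \<noteq> E" "u ` {..<i} \<subseteq> E" and E: "subspace E"
  obtains z where "z \<in> E" "norm z = 1" "\<And>b. b < i \<Longrightarrow> z \<bullet> u b = 0"
proof -
  have "span (u ` {..<i}) \<subseteq> E" using sub E by (simp add: span_minimal)
  then obtain x where x: "x \<in> E" "x \<notin> span (u ` {..<i})" using sub by auto
  define p where "p = (\<Sum>b<i. (x \<bullet> u b) *\<^sub>R u b)"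
  have p: "p \<in> span (u ` {..<i})" unfolding p_def by (rule comb_in_span)
  have pE: "p \<in> E" using p \<open>span (u ` {..<i}) \<subseteq> E\<close> by auto
  have ne: "x - p \<noteq> 0" using x p by auto
  show ?thesis
  proof
    show "(x - p) /\<^sub>R norm (x - p) \<in> E" using x pE E by (simp add: subspace_diff subspace_scale)
    show "norm ((x - p) /\<^sub>R norm (x - p)) = 1" using ne by simp
    show "((x - p) /\<^sub>R norm (x - p)) \<bullet> u b = 0" if "b < i" for b
      using comb_inner[OF on that, of "\<lambda>b. x \<bullet> u b"] by (simp add: p_def inner_diff_left)
  qed
qed

lemma orthonormal_upd:
  assumes "orthonormal i u" "norm z = 1" "\<And>b. b < i \<Longrightarrow> z \<bullet> u b = 0"
  shows "orthonormal (Suc i) (u(i := z))"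
  using assms by (auto simp: orthonormal_def less_Suc_eq norm_eq_1 inner_commute)

lemma orthonormal_span_bound:
  assumes "orthonormal i u" "orthonormal m e" "u ` {..<i} \<subseteq> span (e ` {..<m})"
  shows "i \<le> m"
  using independent_span_bound[of "e ` {..<m}" "u ` {..<i}"] orthonormal_independent[OF assms(1)]
    orthonormal_independent[OF assms(2)] assms(3) by simp

lemma orthonormal_span_eq:
  assumes "orthonormal m u" "orthonormal m e" "u ` {..<m} \<subseteq> span (e ` {..<m})"
  shows "span (u ` {..<m}) = span (e ` {..<m})"
proof (rule ccontr)
  assume "\<not> ?thesis"
  from orthonormal_extend[OF assms(1) this assms(3)] obtain z where z: "z \<in> span (e ` {..<m})"
    "norm z = 1" "\<And>b. b < m \<Longrightarrow> z \<bullet> u b = 0" by auto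
  have "Suc m \<le> m"
    by (rule orthonormal_span_bound[OF orthonormal_upd[OF assms(1) z(2,3)] assms(2)])
      (use z assms(3) in \<open>auto simp: less_Suc_eq\<close>)
  then show False by simp
qed

lemma compact_comb_box:
  fixes u :: "nat \<Rightarrow> 'a::real_inner"
  shows "compact {\<Sum>i<m. c i *\<^sub>R u i | c. \<forall>i<m. \<bar>c i\<bar> \<le> r}"
proof (induction m)
  case 0
  then show ?case by simp
next
  case (Suc m)
  let ?B = "{\<Sum>i<m. c i *\<^sub>R u i | c. \<forall>i<m. \<bar>c i\<bar> \<le> r}"
  have "{\<Sum>i<Suc m. c i *\<^sub>R u i | c. \<forall>i<Suc m. \<bar>c i\<bar> \<le> r}
     = (\<lambda>(x, t). x + t *\<^sub>R u m) ` (?B \<times> {-r..r})" (is "?L = ?R")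
  proof
    show "?L \<subseteq> ?R"
    proof
      fix x assume "x \<in> ?L"
      then obtain c where c: "x = (\<Sum>i<Suc m. c i *\<^sub>R u i)" "\<forall>i<Suc m. \<bar>c i\<bar> \<le> r" by auto
      have "((\<Sum>i<m. c i *\<^sub>R u i), c m) \<in> ?B \<times> {-r..r}"
        using c(2) by (auto simp: abs_le_iff less_Suc_eq minus_le_iff)
      then show "x \<in> ?R" by (rule rev_image_eqI) (simp add: c)
    qed
    show "?R \<subseteq> ?L"
    proof clarify
      fix c t assume c: "\<forall>i<m. \<bar>c i\<bar> \<le> r" "t \<in> {-r..r}"
      show "\<exists>d. (\<Sum>i<m. c i *\<^sub>R u i) + t *\<^sub>R u m = (\<Sum>i<Suc m. d i *\<^sub>R u i) \<and> (\<forall>i<Suc m. \<bar>d i\<bar> \<le> r)"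
        using c by (intro exI[of _ "c(m := t)"]) (auto simp: less_Suc_eq abs_le_iff)
    qed
  qed
  moreover have "compact ((\<lambda>(x, t). x + t *\<^sub>R u m) ` (?B \<times> {-r..r}))"
    using Suc by (intro compact_continuous_image compact_Times)
      (auto simp: case_prod_unfold intro!: continuous_intros)
  ultimately show ?case by simp
qed

text \<open>An infinite-dimensional ambient space is not locally compact, so compactness is obtained
  from the coordinates.\<close>

lemma compact_in_span:
  assumes u: "orthonormal m u" and A: "closed A" "bounded A" "A \<subseteq> span (u ` {..<m})"
  shows "compact A"
proof -
  obtain r where r: "\<And>x. x \<in> A \<Longrightarrow> norm x \<le> r" using A(2) by (auto simp: bounded_iff)
  let ?B = "{\<Sum>i<m. c i *\<^sub>R u i | c. \<forall>i<m. \<bar>c i\<bar> \<le> r}"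
  have "A \<subseteq> ?B"
  proof
    fix x assume x: "x \<in> A"
    have "\<bar>x \<bullet> u i\<bar> \<le> r" if "i < m" for i
      using Cauchy_Schwarz_ineq2[of x "u i"] orthonormal_norm[OF u that] r[OF x] by simp
    then show "x \<in> ?B" using span_expand[OF u, of x] x A(3) by (auto intro!: exI[of _ "\<lambda>i. x \<bullet> u i"])
  qed
  then have "A = ?B \<inter> A" by auto
  then show ?thesis using compact_Int_closed[OF compact_comb_box[where m=m and u=u and r=r] A(1)] by metis
qed

lemma quadratic_form_expand:
  fixes q :: "'a::real_inner \<Rightarrow> 'a \<Rightarrow> real"
  assumes "bilinear q" "orthonormal m e" "x \<in> span (e ` {..<m})"
  shows "q x x = (\<Sum>(i, j)\<in>{..<m} \<times> {..<m}. (x \<bullet> e i) * (x \<bullet> e j) * q (e i) (e j))"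
proof -
  have "q x x = q (\<Sum>i<m. (x \<bullet> e i) *\<^sub>R e i) (\<Sum>i<m. (x \<bullet> e i) *\<^sub>R e i)"
    using span_expand[OF assms(2,3)] by simp
  then show ?thesis
    by (simp add: bilinear_sum[OF assms(1)] bilinear_lmul[OF assms(1)] bilinear_rmul[OF assms(1)] mult_ac)
qed

lemma quadratic_vanish:
  assumes "\<And>t::real. 2 * t * b \<le> t\<^sup>2 * C" shows "b = 0"
proof (rule ccontr)
  assume b: "b \<noteq> 0"
  \<comment> \<open>The choice \<open>t = b / D\<close> with any positive \<open>D > C\<close> already violates the hypothesis.\<close>
  define D where "D = \<bar>C\<bar> + 1"
  have D: "D > 0" "C < D" by (auto simp: D_def)
  have "2 * (b / D) * b \<le> (b / D)\<^sup>2 * C" by (rule assms)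
  then have "2 * b\<^sup>2 * D \<le> b\<^sup>2 * C" using D by (simp add: field_simps power2_eq_square)
  then have "2 * D \<le> C" using b by (simp add: mult.commute mult.left_commute)
  then show False using D by linarith
qed

text \<open>The spectral theorem, by choosing the axes one after the other: a maximiser of the quadratic
  form over the unit sphere of the orthogonal complement of the earlier axes is conjugate to
  everything orthogonal to it.\<close>

lemma orthonormal_diagonalization:
  fixes q :: "'a::real_inner \<Rightarrow> 'a \<Rightarrow> real"
  assumes q: "bilinear q" "\<And>x y. q x y = q y x" and e: "orthonormal m e"
  obtains u where "orthonormal m u" "span (u ` {..<m}) = span (e ` {..<m})"
    "\<And>i j. i < m \<Longrightarrow> j < m \<Longrightarrow> i \<noteq> j \<Longrightarrow> q (u i) (u j) = 0"
    "\<And>i j. i \<le> j \<Longrightarrow> j < m \<Longrightarrow> q (u j) (u j) \<le> q (u i) (u i)"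
proof -
  define E where "E = span (e ` {..<m})"
  have subE: "subspace E" by (simp add: E_def)
  define P where "P i u \<longleftrightarrow> orthonormal i u \<and> u ` {..<i} \<subseteq> E \<and>
    (\<forall>a<i. \<forall>x\<in>E. norm x = 1 \<longrightarrow> (\<forall>b<a. x \<bullet> u b = 0) \<longrightarrow> q x x \<le> q (u a) (u a))" for i u
  have ex: "\<exists>u. P i u" if "i \<le> m" for i
    using that
  proof (induction i)
    case 0
    then show ?case by (auto simp: P_def orthonormal_def)
  next
    case (Suc i)
    then obtain u where u: "P i u" by auto
    then have on: "orthonormal i u" and uE: "u ` {..<i} \<subseteq> E" by (auto simp: P_def)
    have "span (u ` {..<i}) \<noteq> E"
      using dim_span_orthonormal[OF on] dim_span_orthonormal[OF e] Suc.prems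
      by (metis E_def Suc_n_not_le_n)
    from orthonormal_extend[OF on this uE subE] obtain z0 where z0: "z0 \<in> E" "norm z0 = 1"
      "\<And>b. b < i \<Longrightarrow> z0 \<bullet> u b = 0" by blast
    let ?S = "E \<inter> {x. norm x = 1} \<inter> {x. \<forall>b\<in>{..<i}. x \<bullet> u b = 0}"
    have "closed ?S"
      using closed_span_orthonormal[OF e] unfolding E_def Ball_def
      by (intro closed_Int closed_Collect_eq closed_Collect_all closed_Collect_imp continuous_intros) auto
    then have cS: "compact ?S"
      by (intro compact_in_span[OF e]) (auto simp: E_def bounded_iff intro: exI[of _ 1])
    have "continuous_on ?S (\<lambda>x. \<Sum>(i, j)\<in>{..<m} \<times> {..<m}. (x \<bullet> e i) * (x \<bullet> e j) * q (e i) (e j))"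
      unfolding case_prod_unfold by (intro continuous_intros)
    then have "continuous_on ?S (\<lambda>x. q x x)"
      by (rule continuous_on_eq) (auto simp: E_def quadratic_form_expand[OF q(1) e])
    then obtain z where z: "z \<in> ?S" "\<And>x. x \<in> ?S \<Longrightarrow> q x x \<le> q z z"
      using continuous_attains_sup[OF cS, of "\<lambda>x. q x x"] z0 by blast
    have "P (Suc i) (u(i := z))"
      unfolding P_def
    proof (intro conjI allI impI ballI)
      show "orthonormal (Suc i) (u(i := z))" by (rule orthonormal_upd[OF on]) (use z in auto)
      show "u(i := z) ` {..<Suc i} \<subseteq> E" using uE z by (auto simp: less_Suc_eq)
      fix a x assume "a < Suc i" "x \<in> E" "norm x = 1" "\<forall>b<a. x \<bullet> (u(i := z)) b = 0"
      then show "q x x \<le> q ((u(i := z)) a) ((u(i := z)) a)"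
        using u z(2)[of x] by (cases "a = i") (auto simp: P_def)
    qed
    then show ?case by blast
  qed
  then obtain u where u: "P m u" by blast
  then have on: "orthonormal m u" and uE: "u ` {..<m} \<subseteq> E" 
    and mx: "\<And>a x. a < m \<Longrightarrow> x \<in> E \<Longrightarrow> norm x = 1 \<Longrightarrow> (\<forall>b<a. x \<bullet> u b = 0) \<Longrightarrow> q x x \<le> q (u a) (u a)"
    by (auto simp: P_def)
  have mx': "q x x \<le> q (u a) (u a) * (norm x)\<^sup>2" if "a < m" "x \<in> E" "\<forall>b<a. x \<bullet> u b = 0" for a x
  proof (cases "x = 0")
    case False
    have "q (x /\<^sub>R norm x) (x /\<^sub>R norm x) \<le> q (u a) (u a)"
      using that False by (intro mx) (auto simp: subE subspace_scale)
    then show ?thesis using False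
      by (simp add: bilinear_lmul[OF q(1)] bilinear_rmul[OF q(1)] field_simps power2_eq_square)
  qed (simp add: bilinear_lzero[OF q(1)])
  \<comment> \<open>Varying the maximiser \<open>u a\<close> in the admissible direction \<open>u c\<close> kills the mixed term.\<close>
  have orth: "q (u a) (u c) = 0" if "a < c" "c < m" for a c
  proof (rule quadratic_vanish)
    fix t :: real
    let ?y = "u a + t *\<^sub>R u c"
    have n: "(norm ?y)\<^sup>2 = 1 + t\<^sup>2"
      unfolding power2_norm_eq_inner
      using that on by (simp add: inner_add_left inner_add_right orthonormal_inner power2_eq_square)
    have "q ?y ?y \<le> q (u a) (u a) * (norm ?y)\<^sup>2"
      using that uE by (intro mx')
        (auto simp: inner_add_left orthonormal_inner[OF on] intro!: subspace_add subspace_scale subE)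
    moreover have "q ?y ?y = q (u a) (u a) + 2 * t * q (u a) (u c) + t\<^sup>2 * q (u c) (u c)"
      using q(2)[of "u c" "u a"]
      by (simp add: bilinear_lmul[OF q(1)] bilinear_rmul[OF q(1)] bilinear_ladd[OF q(1)]
          bilinear_radd[OF q(1)] power2_eq_square algebra_simps)
    ultimately show "2 * t * q (u a) (u c) \<le> t\<^sup>2 * (q (u a) (u a) - q (u c) (u c))"
      by (simp add: n algebra_simps)
  qed
  show ?thesis
  proof
    show "orthonormal m u" by fact
    show "span (u ` {..<m}) = span (e ` {..<m})"
      using orthonormal_span_eq[OF on e] uE by (simp add: E_def)
    show "q (u i) (u j) = 0" if "i < m" "j < m" "i \<noteq> j" for i j
      using orth[of i j] orth[of j i] q(2)[of "u i" "u j"] that by (cases "i < j") auto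
    show "q (u j) (u j) \<le> q (u i) (u i)" if "i \<le> j" "j < m" for i j
    proof (cases "i = j")
      case False
      then show ?thesis
        using that uE by (intro mx) (auto simp: orthonormal_norm[OF on] orthonormal_inner[OF on])
    qed simp
  qed
qed

section \<open>Separation\<close>

text \<open>Each finite subset of \<open>C\<close> has a compact convex hull, and its point nearest to the origin is a
  separating direction; compactness of the unit sphere provides a direction that serves all of them.\<close>

lemma separate_from_origin:
  fixes C :: "'a::real_inner set"
  assumes e: "orthonormal m e" and C: "C \<subseteq> span (e ` {..<m})" "convex C" "0 \<notin> C" "C \<noteq> {}"
  obtains v where "v \<in> span (e ` {..<m})" "norm v = 1" "\<And>x. x \<in> C \<Longrightarrow> 0 \<le> v \<bullet> x"
proof -
  let ?E = "span (e ` {..<m})"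
  let ?S = "?E \<inter> {v. norm v = 1}"
  obtain x0 where x0: "x0 \<in> C" using C by auto
  have "closed ?S"
    using closed_span_orthonormal[OF e] by (intro closed_Int closed_Collect_eq continuous_intros) auto
  then have cS: "compact ?S"
    by (intro compact_in_span[OF e]) (auto simp: bounded_iff intro: exI[of _ 1])
  have "?S \<inter> \<Inter>((\<lambda>x. {v. 0 \<le> v \<bullet> x}) ` C) \<noteq> {}"
  proof (rule compact_imp_fip[OF cS])
    show "closed T" if "T \<in> (\<lambda>x. {v. 0 \<le> v \<bullet> x}) ` C" for T
      using that by (auto intro!: closed_Collect_le continuous_intros)
    fix F' assume F: "finite F'" "F' \<subseteq> (\<lambda>x. {v. 0 \<le> v \<bullet> x}) ` C"
    then obtain c0 where c0: "c0 \<subseteq> C" "finite c0" "F' = (\<lambda>x. {v. 0 \<le> v \<bullet> x}) ` c0"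
      by (meson finite_subset_image)
    define c where "c = insert x0 c0"
    have c: "c \<subseteq> C" "finite c" "c \<noteq> {}" using c0 x0 by (auto simp: c_def)
    let ?H = "convex hull c"
    have cH: "compact ?H" using c by (intro finite_imp_compact_convex_hull)
    have HC: "?H \<subseteq> C" using c C by (simp add: subset_hull)
    obtain y where y: "y \<in> ?H" "\<And>z. z \<in> ?H \<Longrightarrow> dist 0 y \<le> dist 0 z"
      using continuous_attains_inf[OF cH, of "dist 0"] c by (force intro: continuous_intros)
    have ny: "y \<noteq> 0" using y HC C by auto
    have "y \<bullet> x \<ge> 0" if "x \<in> ?H" for x
    proof -
      have "inner (0 - y) (x - y) \<le> 0"
        using y that cH by (intro any_closest_point_dot[of ?H]) (auto simp: compact_imp_closed)
      then have "y \<bullet> x \<ge> y \<bullet> y" by (simp add: inner_diff_right)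
      then show ?thesis using inner_ge_zero[of y] by linarith
    qed
    then have "(y /\<^sub>R norm y) \<in> ?S \<inter> \<Inter>F'"
      using ny y HC C c0 hull_subset[of c convex]
      by (auto simp: c_def intro!: span_scale divide_nonneg_nonneg)
    then show "?S \<inter> \<Inter>F' \<noteq> {}" by blast
  qed
  then show ?thesis using that by auto
qed

section \<open>Lebesgue measure on finite-dimensional subspaces\<close>

lemma unit_vec_coord [simp]: "coord (unit_vec i) j = (if j = i then 1 else 0)"
  unfolding unit_vec_def by (subst coord_Abs) (auto simp: if_distrib cong: if_cong)

lemma coord_comb_unit_vec: "coord (\<Sum>i<M. c i *\<^sub>R unit_vec i) j = (if j < M then c j else 0)"
  by (induction M) (auto simp: less_Suc_eq)

text \<open>Second countability makes addition Borel measurable on product measures, which Fubini arguments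
  with translates need. Sequences with rational entries form a countable dense set.\<close>

instance fseq :: second_countable_topology
proof
  define D where "D = range (\<lambda>q :: rat list. \<Sum>i<length q. real_of_rat (q ! i) *\<^sub>R unit_vec i)"
  have cD: "countable D" unfolding D_def by simp
  have dense: "\<exists>d\<in>D. dist d x < e" if e: "e > 0" for x :: fseq and e :: real
  proof -
    obtain N where N: "\<And>i. coord x i \<noteq> 0 \<Longrightarrow> i < N"
      using finite_coord[of x] by (auto simp: finite_nat_set_iff_bounded)
    define del where "del = e / (real N + 1)"
    have del: "del > 0" using e by (simp add: del_def)
    have "\<exists>q. \<bar>real_of_rat q - coord x i\<bar> < del" for i
      using of_rat_dense[of "coord x i - del" "coord x i + del"] del
      by (auto simp: abs_less_iff) (metis add.commute diff_less_eq less_diff_eq minus_diff_eq)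
    then obtain q where q: "\<And>i. \<bar>real_of_rat (q i) - coord x i\<bar> < del" by metis
    let ?d = "\<Sum>i<N. real_of_rat (q i) *\<^sub>R unit_vec i"
    have x: "x = (\<Sum>i<N. coord x i *\<^sub>R unit_vec i)"
      by (rule fseq_eqI) (use N in \<open>auto simp: coord_comb_unit_vec\<close>)
    have "dist ?d x = dist ?d (\<Sum>i<N. coord x i *\<^sub>R unit_vec i)"
      by (rule arg_cong[OF x])
    also have "\<dots> = norm (\<Sum>i<N. (real_of_rat (q i) - coord x i) *\<^sub>R unit_vec i)"
      by (simp add: dist_norm sum_subtractf scaleR_diff_left)
    also have "\<dots> \<le> (\<Sum>i<N. del)"
    proof (rule sum_norm_le)
      fix i
      have "norm (unit_vec i) = 1"
        using inner_fseq_superset[of "{i}" "unit_vec i" "unit_vec i"] by (simp add: norm_eq_sqrt_inner)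
      then show "norm ((real_of_rat (q i) - coord x i) *\<^sub>R unit_vec i) \<le> del"
        using q[of i] by simp
    qed
    also have "\<dots> < e" using e by (simp add: del_def field_simps)
    finally have "dist ?d x < e" .
    moreover have "?d = (\<Sum>i<length (map q [0..<N]). real_of_rat (map q [0..<N] ! i) *\<^sub>R unit_vec i)"
      by simp
    then have "?d \<in> D" unfolding D_def by blast
    ultimately show ?thesis by blast
  qed
  define B where "B = (\<lambda>(d, r). ball d (real_of_rat r)) ` (D \<times> (UNIV :: rat set))"
  have "topological_basis B"
  proof (rule topological_basisI)
    show "open U" if "U \<in> B" for U using that by (auto simp: B_def)
    fix U and x :: fseq assume U: "open U" "x \<in> U"
    then obtain e where e: "e > 0" "ball x e \<subseteq> U" by (auto simp: open_contains_ball)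
    obtain r where r: "e / 3 < real_of_rat r" "real_of_rat r < e / 2"
      using of_rat_dense[of "e / 3" "e / 2"] e by auto
    obtain d where d: "d \<in> D" "dist d x < e / 3" using dense[of "e / 3" x] e by auto
    have "ball d (real_of_rat r) \<subseteq> ball x e"
    proof
      fix y assume "y \<in> ball d (real_of_rat r)"
      then show "y \<in> ball x e" using dist_triangle[of x y d] d r e by (auto simp: dist_commute)
    qed
    moreover have "x \<in> ball d (real_of_rat r)" using d r by auto
    ultimately show "\<exists>V\<in>B. x \<in> V \<and> V \<subseteq> U" using d e by (auto simp: B_def)
  qed
  moreover have "countable B" unfolding B_def using cD by simp
  ultimately show "\<exists>B::fseq set set. countable B \<and> open = generate_topology B"
    using topological_basis_imp_subbasis by blast
qed

interpretation lborels: product_sigma_finite "\<lambda>_::nat. lborel :: real measure"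
  by standard

text \<open>The vectors \<open>u\<^sub>i\<close> need not be orthonormal: for the images of an orthonormal system under a
  linear map this is the corresponding image measure, which is how determinants enter.\<close>

definition leb :: "nat \<Rightarrow> (nat \<Rightarrow> 'a) \<Rightarrow> 'a::{real_inner, second_countable_topology} measure" where
  "leb m u = distr (\<Pi>\<^sub>M i\<in>{..<m}. lborel) borel (\<lambda>c. \<Sum>i<m. c i *\<^sub>R u i)"

lemma comb_measurable [measurable]:
  fixes u :: "nat \<Rightarrow> 'a::{real_inner, second_countable_topology}"
  shows "(\<lambda>c. \<Sum>i<m. c i *\<^sub>R u i) \<in> borel_measurable (\<Pi>\<^sub>M i\<in>{..<m}. (lborel :: real measure))"
  by (intro borel_measurable_sum borel_measurable_scaleR) 
    (auto intro!: measurable_component_singleton[where M = "\<lambda>_. lborel", simplified])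

lemma sets_leb [simp, measurable_cong]: "sets (leb m u) = sets borel"
  by (simp add: leb_def)

lemma space_leb [simp]: "space (leb m u) = UNIV"
  by (simp add: leb_def)

lemma nn_integral_leb:
  assumes [measurable]: "f \<in> borel_measurable borel"
  shows "(\<integral>\<^sup>+x. f x \<partial>leb m u) = (\<integral>\<^sup>+c. f (\<Sum>i<m. c i *\<^sub>R u i) \<partial>(\<Pi>\<^sub>M i\<in>{..<m}. lborel))"
  unfolding leb_def by (subst nn_integral_distr) auto

lemma nn_integral_leb_cong:
  assumes "f \<in> borel_measurable borel" "g \<in> borel_measurable borel"
    and "\<And>x. x \<in> span (u ` {..<m}) \<Longrightarrow> f x = g x"
  shows "(\<integral>\<^sup>+x. f x \<partial>leb m u) = (\<integral>\<^sup>+x. g x \<partial>leb m u)"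
  using assms comb_in_span[of _ u m] by (simp add: nn_integral_leb)

lemma nn_integral_leb_mono:
  assumes "f \<in> borel_measurable borel" "g \<in> borel_measurable borel"
    and "\<And>x. x \<in> span (u ` {..<m}) \<Longrightarrow> f x \<le> g x"
  shows "(\<integral>\<^sup>+x. f x \<partial>leb m u) \<le> (\<integral>\<^sup>+x. g x \<partial>leb m u)"
  using assms comb_in_span[of _ u m] by (auto simp: nn_integral_leb intro!: nn_integral_mono)

lemma emeasure_leb_mono:
  assumes "A \<in> sets borel" "B \<in> sets borel" "A \<inter> span (u ` {..<m}) \<subseteq> B"
  shows "emeasure (leb m u) A \<le> emeasure (leb m u) B"
proof -
  have "(\<integral>\<^sup>+x. indicator A x \<partial>leb m u) \<le> (\<integral>\<^sup>+x. indicator B x \<partial>leb m u)"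
    using assms by (intro nn_integral_leb_mono) (auto simp: indicator_def)
  then show ?thesis using assms by simp
qed

lemma measurable_nn_integral_leb:
  assumes [measurable]: "case_prod h \<in> borel_measurable (M \<Otimes>\<^sub>M borel)"
  shows "(\<lambda>t. \<integral>\<^sup>+x. h t x \<partial>leb m u) \<in> borel_measurable M"
proof -
  interpret finite_product_sigma_finite "\<lambda>_::nat. lborel :: real measure" "{..<m}"
    by standard simp
  have "(\<integral>\<^sup>+x. h t x \<partial>leb m u) = (\<integral>\<^sup>+c. h t (\<Sum>i<m. c i *\<^sub>R u i) \<partial>(\<Pi>\<^sub>M i\<in>{..<m}. lborel))"
    if "t \<in> space M" for t
    using measurable_Pair2[OF assms that] by (simp add: nn_integral_leb)
  moreover have "(\<lambda>t. \<integral>\<^sup>+c. h t (\<Sum>i<m. c i *\<^sub>R u i) \<partial>(\<Pi>\<^sub>M i\<in>{..<m}. lborel)) \<in> borel_measurable M"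
    by measurable
  ultimately show ?thesis by (simp cong: measurable_cong)
qed

lemma measurable_leb_section [measurable]:
  assumes [measurable]: "f \<in> borel_measurable borel"
  shows "(\<lambda>y. \<integral>\<^sup>+x. f (x + y) \<partial>leb m u) \<in> borel_measurable borel"
  by (rule measurable_nn_integral_leb) measurable

lemma nn_integral_leb_0:
  assumes "f \<in> borel_measurable borel"
  shows "(\<integral>\<^sup>+x. f x \<partial>leb 0 u) = f 0"
  using assms by (simp add: nn_integral_leb PiM_empty nn_integral_count_space_finite)

lemma nn_integral_leb_Suc:
  assumes [measurable]: "f \<in> borel_measurable borel"
  shows "(\<integral>\<^sup>+x. f x \<partial>leb (Suc m) u) = (\<integral>\<^sup>+t. \<integral>\<^sup>+x. f (x + t *\<^sub>R u m) \<partial>leb m u \<partial>lborel)"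
proof -
  have "(\<integral>\<^sup>+x. f x \<partial>leb (Suc m) u)
     = (\<integral>\<^sup>+c. f (\<Sum>i<Suc m. c i *\<^sub>R u i) \<partial>(\<Pi>\<^sub>M i\<in>insert m {..<m}. lborel))"
    by (simp add: nn_integral_leb lessThan_Suc)
  also have "\<dots> = (\<integral>\<^sup>+t. (\<integral>\<^sup>+c. f (\<Sum>i<Suc m. (c(m := t)) i *\<^sub>R u i) \<partial>(\<Pi>\<^sub>M i\<in>{..<m}. lborel)) \<partial>lborel)"
    using comb_measurable[where m = "Suc m" and u = u]
    by (intro lborels.product_nn_integral_insert_rev) (auto simp: lessThan_Suc)
  also have "\<dots> = (\<integral>\<^sup>+t. (\<integral>\<^sup>+c. f ((\<Sum>i<m. c i *\<^sub>R u i) + t *\<^sub>R u m) \<partial>(\<Pi>\<^sub>M i\<in>{..<m}. lborel)) \<partial>lborel)"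
    by simp
  finally show ?thesis by (simp add: nn_integral_leb)
qed

text \<open>Fubini for the slices parallel to the span of the first \<open>m\<close> vectors.\<close>

lemma nn_integral_leb_add:
  assumes [measurable]: "f \<in> borel_measurable borel"
  shows "(\<integral>\<^sup>+x. f x \<partial>leb (m + k) u) = (\<integral>\<^sup>+y. \<integral>\<^sup>+x. f (x + y) \<partial>leb m u \<partial>leb k (\<lambda>i. u (m + i)))"
  using assms
proof (induction k arbitrary: f)
  case 0
  then show ?case by (simp add: nn_integral_leb_0)
next
  case (Suc k)
  note [measurable] = Suc.prems
  show ?case by (simp add: nn_integral_leb_Suc Suc.IH add.assoc)
qed

lemma nn_integral_leb_translate:
  assumes "f \<in> borel_measurable borel" "a \<in> span (u ` {..<m})"
  shows "(\<integral>\<^sup>+x. f (x + a) \<partial>leb m u) = (\<integral>\<^sup>+x. f x \<partial>leb m u)"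
  using assms
proof (induction m arbitrary: f a)
  case 0
  then show ?case by simp
next
  case (Suc m)
  note [measurable] = Suc.prems(1)
  have "a \<in> span (insert (u m) (u ` {..<m}))" using Suc.prems(2) by (simp add: lessThan_Suc)
  then obtain d where d: "a - d *\<^sub>R u m \<in> span (u ` {..<m})" by (auto simp: span_insert)
  define b where "b = a - d *\<^sub>R u m"
  have "(\<integral>\<^sup>+x. f (x + a) \<partial>leb (Suc m) u) = (\<integral>\<^sup>+t. \<integral>\<^sup>+x. f (x + t *\<^sub>R u m + a) \<partial>leb m u \<partial>lborel)"
    by (simp add: nn_integral_leb_Suc)
  also have "\<dots> = (\<integral>\<^sup>+t. \<integral>\<^sup>+x. f ((x + b) + (d + 1 * t) *\<^sub>R u m) \<partial>leb m u \<partial>lborel)"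
    by (simp add: b_def algebra_simps)
  also have "\<dots> = (\<integral>\<^sup>+t. \<integral>\<^sup>+x. f (x + (d + 1 * t) *\<^sub>R u m) \<partial>leb m u \<partial>lborel)"
    using d by (intro nn_integral_cong Suc.IH[where f = "\<lambda>x. f (x + _ *\<^sub>R u m)"]) (auto simp: b_def)
  also have "\<dots> = (\<integral>\<^sup>+t. \<integral>\<^sup>+x. f (x + t *\<^sub>R u m) \<partial>leb m u \<partial>lborel)"
    by (subst nn_integral_real_affine[where c = 1 and t = d]) auto
  finally show ?case by (simp add: nn_integral_leb_Suc)
qed

lemma nn_integral_leb_scale:
  assumes "f \<in> borel_measurable borel" "\<And>i. i < m \<Longrightarrow> s i \<noteq> 0"
  shows "(\<integral>\<^sup>+x. f x \<partial>leb m u)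
    = ennreal (\<Prod>i<m. \<bar>s i\<bar>) * (\<integral>\<^sup>+x. f x \<partial>leb m (\<lambda>i. s i *\<^sub>R u i))"
  using assms
proof (induction m arbitrary: f)
  case 0
  then show ?case by (simp add: nn_integral_leb_0)
next
  case (Suc m)
  note [measurable] = Suc.prems(1)
  have "(\<integral>\<^sup>+x. f x \<partial>leb (Suc m) u) = (\<integral>\<^sup>+t. \<integral>\<^sup>+x. f (x + t *\<^sub>R u m) \<partial>leb m u \<partial>lborel)"
    by (simp add: nn_integral_leb_Suc)
  also have "\<dots> = ennreal \<bar>s m\<bar> * (\<integral>\<^sup>+t. \<integral>\<^sup>+x. f (x + (0 + s m * t) *\<^sub>R u m) \<partial>leb m u \<partial>lborel)"
    by (subst nn_integral_real_affine[where c = "s m" and t = 0]) (use Suc.prems in auto)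
  also have "(\<integral>\<^sup>+t. \<integral>\<^sup>+x. f (x + (0 + s m * t) *\<^sub>R u m) \<partial>leb m u \<partial>lborel)
    = (\<integral>\<^sup>+t. ennreal (\<Prod>i<m. \<bar>s i\<bar>) * (\<integral>\<^sup>+x. f (x + (0 + s m * t) *\<^sub>R u m) \<partial>leb m (\<lambda>i. s i *\<^sub>R u i)) \<partial>lborel)"
    by (intro nn_integral_cong Suc.IH[where f = "\<lambda>x. f (x + _ *\<^sub>R u m)"]) (use Suc.prems in auto)
  also have "\<dots> = ennreal (\<Prod>i<m. \<bar>s i\<bar>) *
     (\<integral>\<^sup>+t. \<integral>\<^sup>+x. f (x + t *\<^sub>R (s m *\<^sub>R u m)) \<partial>leb m (\<lambda>i. s i *\<^sub>R u i) \<partial>lborel)"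
    by (subst nn_integral_cmult[symmetric]) (auto simp: mult.commute)
  finally show ?case
    by (simp add: nn_integral_leb_Suc ennreal_mult' prod_nonneg mult_ac)
qed

lemma nn_integral_leb_linear:
  assumes T: "bounded_linear T" and [measurable]: "f \<in> borel_measurable borel"
  shows "(\<integral>\<^sup>+x. f x \<partial>leb m (\<lambda>i. T (u i))) = (\<integral>\<^sup>+x. f (T x) \<partial>leb m u)"
proof -
  have [measurable]: "T \<in> borel_measurable borel"
    using T by (intro borel_measurable_continuous_onI linear_continuous_on)
  show ?thesis
    by (simp add: nn_integral_leb linear_sum[OF bounded_linear.linear[OF T]]
        linear_scale[OF bounded_linear.linear[OF T]])
qed

lemma emeasure_leb_bounded:
  assumes u: "orthonormal m u" and A: "A \<in> sets borel" "bounded A"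
  shows "emeasure (leb m u) A < \<infinity>"
proof -
  obtain r where r: "\<And>x. x \<in> A \<Longrightarrow> norm x \<le> r" using A(2) by (auto simp: bounded_iff)
  let ?M = "\<Pi>\<^sub>M i\<in>{..<m}. (lborel :: real measure)"
  have "emeasure (leb m u) A = emeasure ?M ((\<lambda>c. \<Sum>i<m. c i *\<^sub>R u i) -` A \<inter> space ?M)"
    unfolding leb_def using A by (intro emeasure_distr) auto
  also have "\<dots> \<le> emeasure ?M (PiE {..<m} (\<lambda>_. {-r..r}))"
  proof (rule emeasure_mono)
    show "(\<lambda>c. \<Sum>i<m. c i *\<^sub>R u i) -` A \<inter> space ?M \<subseteq> PiE {..<m} (\<lambda>_. {-r..r})"
    proof
      fix c assume "c \<in> (\<lambda>c. \<Sum>i<m. c i *\<^sub>R u i) -` A \<inter> space ?M"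
      then have c: "norm (\<Sum>i<m. c i *\<^sub>R u i) \<le> r" "c \<in> extensional {..<m}"
        using r by (auto simp: space_PiM PiE_def)
      have "\<bar>c i\<bar> \<le> r" if "i < m" for i
        using Cauchy_Schwarz_ineq2[of "\<Sum>i<m. c i *\<^sub>R u i" "u i"] comb_inner[OF u that, of c]
          orthonormal_norm[OF u that] c by simp
      then show "c \<in> PiE {..<m} (\<lambda>_. {-r..r})" using c by (auto simp: PiE_iff abs_le_iff minus_le_iff)
    qed
  qed (auto intro!: sets_PiM_I_finite)
  also have "\<dots> = (\<Prod>i<m. emeasure lborel {-r..r})"
    by (subst lborels.emeasure_PiM) auto
  also have "\<dots> < \<infinity>" by (simp add: power_less_top_ennreal emeasure_lborel_Icc_eq)
  finally show ?thesis .
qed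

lemma sigma_finite_leb:
  assumes "orthonormal m u" shows "sigma_finite_measure (leb m u)"
proof
  show "\<exists>A. countable A \<and> A \<subseteq> sets (leb m u) \<and> \<Union>A = space (leb m u) \<and> (\<forall>a\<in>A. emeasure (leb m u) a \<noteq> \<infinity>)"
  proof (intro exI conjI ballI)
    show "countable (range (\<lambda>n. cball (0::'a) (real n)))" by simp
    show "\<Union>(range (\<lambda>n. cball (0::'a) (real n))) = space (leb m u)"
      using real_arch_simple by auto
    show "emeasure (leb m u) a \<noteq> \<infinity>" if "a \<in> range (\<lambda>n. cball 0 (real n))" for a
      using emeasure_leb_bounded[OF assms, of a] that by auto
  qed auto
qed

lemma emeasure_leb_ball:
  assumes u: "orthonormal m u"
  shows "emeasure (leb m u) (cball 0 1) = emeasure (\<Pi>\<^sub>M i\<in>{..<m}. lborel)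
    {c \<in> space (\<Pi>\<^sub>M i\<in>{..<m}. lborel :: real measure). (\<Sum>i<m. (c i)\<^sup>2) \<le> 1}"
proof -
  have "norm (\<Sum>i<m. c i *\<^sub>R u i) \<le> 1 \<longleftrightarrow> (\<Sum>i<m. (c i)\<^sup>2) \<le> 1" for c
    unfolding comb_norm[OF u, symmetric] by (simp add: power_le_one_iff abs_square_le_1)
  then show ?thesis
    unfolding leb_def by (subst emeasure_distr) (auto simp: vimage_def Int_def conj_commute)
qed

lemma emeasure_leb_ball_pos:
  assumes u: "orthonormal m u" and r: "r > 0"
  shows "emeasure (leb m u) (cball 0 r) > 0"
proof -
  let ?M = "\<Pi>\<^sub>M i\<in>{..<m}. (lborel :: real measure)"
  \<comment> \<open>The cube of half-side \<open>d\<close> lies in the ball by the triangle inequality.\<close>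
  define d where "d = r / (real m + 1)"
  have d: "d > 0" using r by (simp add: d_def)
  have "0 < (\<Prod>i<m. ennreal (2 * d))" using d by (simp add: ennreal_power)
  also have "\<dots> = (\<Prod>i<m. emeasure lborel {-d..d})" using d by simp
  also have "\<dots> = emeasure ?M (PiE {..<m} (\<lambda>_. {-d..d}))"
    by (subst lborels.emeasure_PiM) auto
  also have "\<dots> \<le> emeasure ?M ((\<lambda>c. \<Sum>i<m. c i *\<^sub>R u i) -` cball 0 r \<inter> space ?M)"
  proof (rule emeasure_mono)
    show "PiE {..<m} (\<lambda>_. {-d..d}) \<subseteq> (\<lambda>c. \<Sum>i<m. c i *\<^sub>R u i) -` cball 0 r \<inter> space ?M"
    proof
      fix c assume c: "c \<in> PiE {..<m} (\<lambda>_. {-d..d})"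
      have "norm (\<Sum>i<m. c i *\<^sub>R u i) \<le> (\<Sum>i<m. d)"
        using c by (intro sum_norm_le) (auto simp: PiE_iff orthonormal_norm[OF u] abs_le_iff minus_le_iff)
      also have "\<dots> \<le> r" using r by (simp add: d_def field_simps)
      finally show "c \<in> (\<lambda>c. \<Sum>i<m. c i *\<^sub>R u i) -` cball 0 r \<inter> space ?M"
        using c by (auto simp: space_PiM PiE_iff)
    qed
  qed auto
  also have "\<dots> = emeasure (leb m u) (cball 0 r)"
    unfolding leb_def by (rule emeasure_distr[symmetric]) auto
  finally show ?thesis .
qed

text \<open>Uniqueness of Haar measure in a concrete form: both measures are invariant under translations
  of the common span, so by Fubini their ratio on any set equals their ratio on the unit ball, which
  is symmetric and has the same coordinate description in every orthonormal basis.\<close>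

lemma leb_basis_independent:
  fixes u v :: "nat \<Rightarrow> 'a::{real_inner, second_countable_topology}"
  assumes u: "orthonormal m u" and v: "orthonormal m v"
    and sp: "span (u ` {..<m}) = span (v ` {..<m})"
  shows "leb m u = leb m v"
proof (rule measure_eqI)
  show "sets (leb m u) = sets (leb m v)" by simp
  fix B assume "B \<in> sets (leb m u)"
  then have [measurable]: "B \<in> sets borel" by simp
  interpret U: sigma_finite_measure "leb m u" by (rule sigma_finite_leb[OF u])
  interpret V: sigma_finite_measure "leb m v" by (rule sigma_finite_leb[OF v])
  interpret UV: pair_sigma_finite "leb m u" "leb m v" ..
  let ?A = "cball (0::'a) 1"
  have [measurable]: "?A \<in> sets borel" by auto
  have same: "emeasure (leb m u) ?A = emeasure (leb m v) ?A"
    using emeasure_leb_ball[OF u] emeasure_leb_ball[OF v] by simp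
  have "emeasure (leb m v) ?A * emeasure (leb m u) B
      = (\<integral>\<^sup>+x. indicator ?A x * (\<integral>\<^sup>+y. indicator B y \<partial>leb m u) \<partial>leb m v)"
    by (subst nn_integral_multc) (auto intro!: borel_measurable_indicator)
  also have "\<dots> = (\<integral>\<^sup>+x. indicator ?A x * (\<integral>\<^sup>+y. indicator B (y + x) \<partial>leb m u) \<partial>leb m v)"
  proof (rule nn_integral_leb_cong)
    show "(\<lambda>x. indicator ?A x * (\<integral>\<^sup>+y. indicator B y \<partial>leb m u)) \<in> borel_measurable borel"
      by (intro borel_measurable_times_ennreal borel_measurable_indicator measurable_const) auto
    show "(\<lambda>x. indicator ?A x * (\<integral>\<^sup>+y. indicator B (y + x) \<partial>leb m u)) \<in> borel_measurable borel"
      by (intro borel_measurable_times_ennreal borel_measurable_indicator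
          measurable_leb_section[where f = "indicator B"]) auto
    fix x assume "x \<in> span (v ` {..<m})"
    then show "indicator ?A x * (\<integral>\<^sup>+y. indicator B y \<partial>leb m u)
        = indicator ?A x * (\<integral>\<^sup>+y. indicator B (y + x) \<partial>leb m u)"
      by (subst nn_integral_leb_translate[where a = x]) (auto simp: sp)
  qed
  also have "\<dots> = (\<integral>\<^sup>+x. \<integral>\<^sup>+y. indicator ?A x * indicator B (y + x) \<partial>leb m u \<partial>leb m v)"
    by (simp add: nn_integral_cmult)
  also have "\<dots> = (\<integral>\<^sup>+y. \<integral>\<^sup>+x. indicator ?A x * indicator B (y + x) \<partial>leb m v \<partial>leb m u)"
    by (rule UV.Fubini') measurable
  also have "\<dots> = (\<integral>\<^sup>+y. \<integral>\<^sup>+x. indicator ?A (x - y) * indicator B x \<partial>leb m v \<partial>leb m u)"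
  proof (rule nn_integral_leb_cong)
    show "(\<lambda>y. \<integral>\<^sup>+x. indicator ?A x * indicator B (y + x) \<partial>leb m v) \<in> borel_measurable borel"
      by (rule measurable_nn_integral_leb) measurable
    show "(\<lambda>y. \<integral>\<^sup>+x. indicator ?A (x - y) * indicator B x \<partial>leb m v) \<in> borel_measurable borel"
      by (rule measurable_nn_integral_leb) measurable
    fix y assume "y \<in> span (u ` {..<m})"
    then show "(\<integral>\<^sup>+x. indicator ?A x * indicator B (y + x) \<partial>leb m v)
        = (\<integral>\<^sup>+x. indicator ?A (x - y) * indicator B x \<partial>leb m v :: ennreal)"
      using sp nn_integral_leb_translate[of "\<lambda>x. indicator ?A (x - y) * indicator B x" y v m]
      by (simp add: add.commute)
  qed
  also have "\<dots> = (\<integral>\<^sup>+x. \<integral>\<^sup>+y. indicator ?A (x - y) * indicator B x \<partial>leb m u \<partial>leb m v)"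
    by (rule UV.Fubini'[symmetric]) measurable
  also have "\<dots> = (\<integral>\<^sup>+x. (\<integral>\<^sup>+y. indicator ?A y \<partial>leb m u) * indicator B x \<partial>leb m v)"
  proof (rule nn_integral_leb_cong)
    show "(\<lambda>x. \<integral>\<^sup>+y. indicator ?A (x - y) * indicator B x \<partial>leb m u) \<in> borel_measurable borel"
      by (rule measurable_nn_integral_leb) measurable
    show "(\<lambda>x. (\<integral>\<^sup>+y. indicator ?A y \<partial>leb m u) * indicator B x) \<in> borel_measurable borel"
      by (intro borel_measurable_times_ennreal borel_measurable_indicator measurable_const) auto
    fix x assume x: "x \<in> span (v ` {..<m})"
    have "(\<integral>\<^sup>+y. indicator ?A (x - y) * indicator B x \<partial>leb m u)
        = (\<integral>\<^sup>+y. indicator ?A (x - y) \<partial>leb m u) * indicator B x"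
      by (rule nn_integral_multc) measurable
    also have "(\<integral>\<^sup>+y. indicator ?A (x - y) \<partial>leb m u) = (\<integral>\<^sup>+y. indicator ?A (y + (- x)) \<partial>leb m u :: ennreal)"
      by (intro nn_integral_cong) (auto simp: indicator_def norm_minus_commute)
    also have "\<dots> = (\<integral>\<^sup>+y. indicator ?A y \<partial>leb m u)"
      using x sp by (intro nn_integral_leb_translate) (auto intro: span_neg)
    finally show "(\<integral>\<^sup>+y. indicator ?A (x - y) * indicator B x \<partial>leb m u)
        = (\<integral>\<^sup>+y. indicator ?A y \<partial>leb m u) * (indicator B x :: ennreal)" .
  qed
  also have "\<dots> = emeasure (leb m v) ?A * emeasure (leb m v) B"
    by (simp add: nn_integral_cmult same)
  finally show "emeasure (leb m u) B = emeasure (leb m v) B"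
    using emeasure_leb_ball_pos[OF v, of 1] emeasure_leb_bounded[OF v, of ?A]
    by (subst (asm) ennreal_mult_cancel_left) auto
qed

lemma emeasure_leb_affine:
  assumes u: "r > 0" "a \<in> span (u ` {..<m})" and [measurable]: "A \<in> sets borel" "(\<lambda>x. r *\<^sub>R x + a) ` A \<in> sets borel"
  shows "emeasure (leb m u) ((\<lambda>x. r *\<^sub>R x + a) ` A) = ennreal (r ^ m) * emeasure (leb m u) A"
proof -
  let ?B = "(\<lambda>x. r *\<^sub>R x + a) ` A"
  have "emeasure (leb m u) ?B = (\<integral>\<^sup>+x. indicator ?B x \<partial>leb m u)" by simp
  also have "\<dots> = (\<integral>\<^sup>+x. indicator ?B (x + a) \<partial>leb m u)"
    using u by (subst nn_integral_leb_translate) auto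
  also have "\<dots> = ennreal (r ^ m) * (\<integral>\<^sup>+x. indicator ?B (x + a) \<partial>leb m (\<lambda>i. r *\<^sub>R u i))"
    using u by (subst nn_integral_leb_scale[where s = "\<lambda>_. r"]) auto
  also have "(\<integral>\<^sup>+x. indicator ?B (x + a) \<partial>leb m (\<lambda>i. r *\<^sub>R u i)) = (\<integral>\<^sup>+x. indicator ?B (r *\<^sub>R x + a) \<partial>leb m u)"
    by (rule nn_integral_leb_linear) (auto intro: bounded_linear_scaleR_right)
  also have "\<dots> = (\<integral>\<^sup>+x. indicator A x \<partial>leb m u)"
    using u by (intro nn_integral_cong) (auto simp: indicator_def)
  finally show ?thesis by simp
qed

section \<open>The Brunn-Minkowski inequality\<close>

text \<open>The one-dimensional Brunn-Minkowski inequality, for intervals.\<close>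

lemma emeasure_combination_intervals:
  fixes I J :: "real set"
  assumes I: "convex I" "bounded I" "I \<noteq> {}" and J: "convex J" "bounded J" "J \<noteq> {}"
    and l: "0 < l" "l < 1" and W: "W \<in> sets borel"
    and sub: "\<And>x y. x \<in> I \<Longrightarrow> y \<in> J \<Longrightarrow> (1 - l) * x + l * y \<in> W"
  shows "ennreal (1 - l) * emeasure lborel I + ennreal l * emeasure lborel J \<le> emeasure lborel W"
proof -
  have bnd: "bdd_above I" "bdd_below I" "bdd_above J" "bdd_below J"
    using I J by (auto simp: bounded_imp_bdd_above bounded_imp_bdd_below)
  define a where "a = (1 - l) * Inf I + l * Inf J"
  define b where "b = (1 - l) * Sup I + l * Sup J"
  have ISI: "Inf I \<le> Sup I" "Inf J \<le> Sup J"
    using I J bnd by (auto intro!: cInf_le_cSup)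
  have "{a<..<b} \<subseteq> W"
  proof
    fix z assume z: "z \<in> {a<..<b}"
    define e where "e = min (z - a) (b - z)"
    have e: "e > 0" using z by (auto simp: e_def)
    obtain i1 where i1: "i1 \<in> I" "i1 < Inf I + e" using I bnd e cInf_lessD[of I "Inf I + e"] by auto
    obtain j1 where j1: "j1 \<in> J" "j1 < Inf J + e" using J bnd e cInf_lessD[of J "Inf J + e"] by auto
    obtain i2 where i2: "i2 \<in> I" "i2 > Sup I - e" using I bnd e less_cSupD[of I "Sup I - e"] by auto
    obtain j2 where j2: "j2 \<in> J" "j2 > Sup J - e" using J bnd e less_cSupD[of J "Sup J - e"] by auto
    define p1 where "p1 = (1 - l) * i1 + l * j1"
    define p2 where "p2 = (1 - l) * i2 + l * j2"
    have "p1 < (1 - l) * (Inf I + e) + l * (Inf J + e)"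
      unfolding p1_def using l i1 j1 by (intro add_strict_mono mult_strict_left_mono) auto
    also have "\<dots> = a + e" by (simp add: a_def algebra_simps)
    finally have p1: "p1 < z" by (simp add: e_def)
    have "p2 > (1 - l) * (Sup I - e) + l * (Sup J - e)"
      unfolding p2_def using l i2 j2 by (intro add_strict_mono mult_strict_left_mono) auto
    moreover have "(1 - l) * (Sup I - e) + l * (Sup J - e) = b - e" by (simp add: b_def algebra_simps)
    ultimately have p2: "p2 > z" by (simp add: e_def)
    define t where "t = (z - p1) / (p2 - p1)"
    have t: "0 \<le> t" "t \<le> 1" using p1 p2 by (auto simp: t_def)
    have zt: "z = (1 - t) * p1 + t * p2"
    proof -
      have "t * (p2 - p1) = z - p1" using p1 p2 by (simp add: t_def)
      then show ?thesis by (simp add: algebra_simps)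
    qed
    have "(1 - t) * i1 + t * i2 \<in> I" "(1 - t) * j1 + t * j2 \<in> J"
      using I(1) J(1) i1 i2 j1 j2 t by (auto simp: convex_alt)
    from sub[OF this] show "z \<in> W"
      unfolding zt p1_def p2_def by (simp add: algebra_simps)
  qed
  then have "emeasure lborel {a<..<b} \<le> emeasure lborel W" using W by (intro emeasure_mono) auto
  moreover have ab: "a \<le> b" unfolding a_def b_def using l ISI by (intro add_mono mult_left_mono) auto
  moreover have "emeasure lborel I \<le> emeasure lborel {Inf I..Sup I}"
    using bnd by (intro emeasure_mono) (auto intro: cInf_lower cSup_upper)
  moreover have "emeasure lborel J \<le> emeasure lborel {Inf J..Sup J}"
    using bnd by (intro emeasure_mono) (auto intro: cInf_lower cSup_upper)
  ultimately have "ennreal (1 - l) * emeasure lborel I + ennreal l * emeasure lborel J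
      \<le> ennreal (1 - l) * ennreal (Sup I - Inf I) + ennreal l * ennreal (Sup J - Inf J)"
    using ISI by (intro add_mono mult_left_mono) auto
  also have "\<dots> = ennreal (b - a)"
  proof -
    have "b - a = (1 - l) * (Sup I - Inf I) + l * (Sup J - Inf J)"
      by (simp add: a_def b_def algebra_simps)
    then show ?thesis using l ISI by (simp add: ennreal_mult)
  qed
  also have "\<dots> \<le> emeasure lborel W" using \<open>emeasure lborel {a<..<b} \<le> _\<close> ab by simp
  finally show ?thesis .
qed

lemma nn_integral_layer_cake:
  fixes f :: "real \<Rightarrow> real"
  assumes [measurable]: "f \<in> borel_measurable borel"
  shows "(\<integral>\<^sup>+t. ennreal (f t) \<partial>lborel) = (\<integral>\<^sup>+s. indicator {0<..} s * emeasure lborel {t. s < f t} \<partial>lborel)"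
proof -
  have "(\<integral>\<^sup>+t. ennreal (f t) \<partial>lborel) = (\<integral>\<^sup>+t. (\<integral>\<^sup>+s. indicator {0<..<f t} s \<partial>lborel) \<partial>lborel)"
  proof (intro nn_integral_cong)
    show "ennreal (f t) = (\<integral>\<^sup>+s. indicator {0<..<f t} s \<partial>lborel)" for t
      by (cases "0 \<le> f t") (auto simp: ennreal_neg)
  qed
  also have "\<dots> = (\<integral>\<^sup>+t. (\<integral>\<^sup>+s. indicator {0<..} s * indicator {t. s < f t} t \<partial>lborel) \<partial>lborel)"
    by (intro nn_integral_cong) (auto simp: indicator_def)
  also have "\<dots> = (\<integral>\<^sup>+s. (\<integral>\<^sup>+t. indicator {0<..} s * indicator {t. s < f t} t \<partial>lborel) \<partial>lborel)"
    unfolding indicator_def by (rule lborel_pair.Fubini') measurable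
  also have "\<dots> = (\<integral>\<^sup>+s. indicator {0<..} s * emeasure lborel {t. s < f t} \<partial>lborel)"
    by (intro nn_integral_cong) (simp add: nn_integral_cmult)
  finally show ?thesis .
qed

text \<open>For quasi-concave functions of one variable with equal suprema the superlevel sets are
  intervals, whose lengths add up.\<close>

lemma quasiconcave_integral_combination:
  fixes f g h :: "real \<Rightarrow> real"
  assumes [measurable]: "f \<in> borel_measurable borel" "g \<in> borel_measurable borel" "h \<in> borel_measurable borel"
    and le1: "\<And>x. f x \<le> 1" "\<And>x. g x \<le> 1"
    and sup1: "\<And>s. s < 1 \<Longrightarrow> \<exists>t. s < f t" "\<And>s. s < 1 \<Longrightarrow> \<exists>t. s < g t"
    and cvx: "\<And>s. 0 < s \<Longrightarrow> convex {t. s < f t}" "\<And>s. 0 < s \<Longrightarrow> convex {t. s < g t}"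
    and bdd: "\<And>s. 0 < s \<Longrightarrow> bounded {t. s < f t}" "\<And>s. 0 < s \<Longrightarrow> bounded {t. s < g t}"
    and l: "0 < l" "l < 1"
    and h: "\<And>s x y. 0 < s \<Longrightarrow> s < f x \<Longrightarrow> s < g y \<Longrightarrow> s < h ((1 - l) * x + l * y)"
  shows "ennreal (1 - l) * (\<integral>\<^sup>+t. ennreal (f t) \<partial>lborel) + ennreal l * (\<integral>\<^sup>+t. ennreal (g t) \<partial>lborel)
    \<le> (\<integral>\<^sup>+t. ennreal (h t) \<partial>lborel)"
proof -
  have [measurable]: "(\<lambda>s. emeasure lborel {t. s < k t}) \<in> borel_measurable borel"
    if [measurable]: "k \<in> borel_measurable borel" for k :: "real \<Rightarrow> real"
  proof -
    have "(\<lambda>s. \<integral>\<^sup>+t. indicator {t. s < k t} t \<partial>lborel) \<in> borel_measurable borel"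
      unfolding indicator_def by measurable
    then show ?thesis by simp
  qed
  have "ennreal (1 - l) * (\<integral>\<^sup>+t. ennreal (f t) \<partial>lborel) + ennreal l * (\<integral>\<^sup>+t. ennreal (g t) \<partial>lborel)
    = (\<integral>\<^sup>+s. indicator {0<..} s * (ennreal (1 - l) * emeasure lborel {t. s < f t}
         + ennreal l * emeasure lborel {t. s < g t}) \<partial>lborel)"
    by (simp add: nn_integral_layer_cake nn_integral_cmult[symmetric] nn_integral_add[symmetric] distrib_left mult_ac)
  also have "\<dots> \<le> (\<integral>\<^sup>+s. indicator {0<..} s * emeasure lborel {t. s < h t} \<partial>lborel)"
  proof (rule nn_integral_mono)
    fix s :: real
    show "indicator {0<..} s * (ennreal (1 - l) * emeasure lborel {t. s < f t}
         + ennreal l * emeasure lborel {t. s < g t}) \<le> indicator {0<..} s * emeasure lborel {t. s < h t}"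
    proof (cases "0 < s")
      case True
      show ?thesis
      proof (cases "s < 1")
        case s1: True
        have "ennreal (1 - l) * emeasure lborel {t. s < f t} + ennreal l * emeasure lborel {t. s < g t}
          \<le> emeasure lborel {t. s < h t}"
          using True sup1[OF s1] h[OF True]
          by (intro emeasure_combination_intervals cvx bdd l) auto
        then show ?thesis using True by simp
      next
        case False
        then have "{t. s < f t} = {}" "{t. s < g t} = {}" using le1 
          by (auto simp: not_less intro: order_trans)
        then show ?thesis by simp
      qed
    qed simp
  qed
  also have "\<dots> = (\<integral>\<^sup>+t. ennreal (h t) \<partial>lborel)"
    by (simp add: nn_integral_layer_cake)
  finally show ?thesis .
qed

lemma ennreal_combination:
  assumes "0 \<le> p" "0 \<le> q" "0 \<le> x" "0 \<le> y"
  shows "ennreal p * ennreal x + ennreal q * ennreal y = ennreal (p * x + q * y)"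
  using assms by (simp add: ennreal_mult)

definition combine_sets :: "real \<Rightarrow> 'a::real_vector set \<Rightarrow> 'a set \<Rightarrow> 'a set" where
  "combine_sets l A B = {(1 - l) *\<^sub>R a + l *\<^sub>R b | a b. a \<in> A \<and> b \<in> B}"

lemma combine_sets_image: "combine_sets l A B = (\<lambda>(a, b). (1 - l) *\<^sub>R a + l *\<^sub>R b) ` (A \<times> B)"
  by (auto simp: combine_sets_def)

lemma compact_combine_sets:
  fixes A B :: "'a::real_normed_vector set"
  assumes "compact A" "compact B" shows "compact (combine_sets l A B)"
  unfolding combine_sets_image using assms
  by (intro compact_continuous_image compact_Times) (auto simp: case_prod_unfold intro!: continuous_intros)

lemma combine_sets_subset_convex:
  assumes "convex A" "0 \<le> l" "l \<le> 1" shows "combine_sets l A A \<subseteq> A"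
  using assms by (auto simp: combine_sets_def convex_alt)

lemma powr_combination_less:
  fixes s p q :: real
  assumes "0 < s" "s < p" "s < q" "0 < l" "l < 1"
  shows "s < p powr (1 - l) * q powr l"
proof -
  have "s = s powr (1 - l) * s powr l" using assms by (simp add: powr_add[symmetric])
  also have "\<dots> < p powr (1 - l) * q powr l"
    using assms by (intro mult_strict_mono powr_less_mono2) auto
  finally show ?thesis .
qed

definition slice :: "'a::ab_group_add set \<Rightarrow> 'a \<Rightarrow> 'a set" where
  "slice A y = {x. x + y \<in> A}"

lemma slice_image: "slice A y = (\<lambda>x. - y + x) ` A"
  by (auto simp: slice_def image_iff) (metis add.commute add_diff_cancel_right' diff_conv_add_uminus)

lemma compact_slice: "compact A \<Longrightarrow> compact (slice A y)" for A :: "'a::real_normed_vector set"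
  unfolding slice_image by (intro compact_continuous_image continuous_intros)

lemma convex_slice: "convex A \<Longrightarrow> convex (slice A y)" for A :: "'a::real_vector set"
  by (simp add: slice_image)

lemma combine_slices:
  assumes "combine_sets l A B \<subseteq> C"
  shows "combine_sets l (slice A x) (slice B y) \<subseteq> slice C ((1 - l) *\<^sub>R x + l *\<^sub>R y)"
proof
  fix z assume "z \<in> combine_sets l (slice A x) (slice B y)"
  then obtain a b where ab: "a + x \<in> A" "b + y \<in> B" "z = (1 - l) *\<^sub>R a + l *\<^sub>R b"
    by (auto simp: combine_sets_def slice_def)
  have "z + ((1 - l) *\<^sub>R x + l *\<^sub>R y) = (1 - l) *\<^sub>R (a + x) + l *\<^sub>R (b + y)"
    by (simp add: ab algebra_simps)
  then have "z + ((1 - l) *\<^sub>R x + l *\<^sub>R y) \<in> combine_sets l A B"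
    using ab by (auto simp: combine_sets_def)
  then show "z \<in> slice C ((1 - l) *\<^sub>R x + l *\<^sub>R y)" using assms by (auto simp: slice_def)
qed

lemma borel_of_compact: "compact A \<Longrightarrow> A \<in> sets borel" for A :: "'a::t2_space set"
  by (simp add: borel_closed compact_imp_closed)

lemma emeasure_leb_compact:
  assumes "orthonormal m u" "compact A"
  shows "emeasure (leb m u) A = ennreal (measure (leb m u) A)"
  using emeasure_leb_bounded[OF assms(1), of A] assms(2)
  by (intro emeasure_eq_ennreal_measure) (auto simp: compact_imp_bounded borel_of_compact)

lemma measure_leb_mono:
  assumes u: "orthonormal m u" and A: "A \<in> sets borel" and B: "compact B" and sub: "A \<inter> span (u ` {..<m}) \<subseteq> B"
  shows "measure (leb m u) A \<le> measure (leb m u) B"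
proof -
  have B': "B \<in> sets borel" using B by (rule borel_of_compact)
  have "emeasure (leb m u) A \<le> emeasure (leb m u) B" by (rule emeasure_leb_mono[OF A B' sub])
  then show ?thesis unfolding measure_def
    using emeasure_leb_bounded[OF u B'] B by (intro enn2real_mono) (auto simp: compact_imp_bounded)
qed

text \<open>Induction on the dimension: the volumes of parallel hyperplane sections are log-concave by
  the induction hypothesis, so the one-dimensional statement about quasi-concave functions applies
  to them after both have been divided by their maximal section.\<close>

lemma brunn_minkowski_multiplicative:
  fixes u :: "nat \<Rightarrow> 'a::{real_inner, second_countable_topology}"
  assumes "orthonormal m u" "compact A" "compact B" "convex A" "convex B" "0 < l" "l < 1"
    and "compact C" "combine_sets l A B \<subseteq> C"
  shows "measure (leb m u) A powr (1 - l) * measure (leb m u) B powr l \<le> measure (leb m u) C"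
  using assms
proof (induction m arbitrary: A B C l)
  case 0
  have pt: "measure (leb 0 u) X = indicator X 0" if "compact X" for X
  proof -
    have "emeasure (leb 0 u) X = (\<integral>\<^sup>+x. indicator X x \<partial>leb 0 u)" using borel_of_compact[OF that] by simp
    also have "\<dots> = indicator X 0" using that by (intro nn_integral_leb_0) (auto intro!: borel_of_compact borel_measurable_indicator)
    finally show ?thesis by (simp add: measure_def indicator_def)
  qed
  have "0 \<in> C" if "0 \<in> A" "0 \<in> B"
    using 0 that by (force simp: combine_sets_def)
  then show ?case using 0 by (auto simp: pt indicator_def)
next
  case (Suc m)
  have on: "orthonormal m u" using Suc.prems(1) by (rule orthonormal_mono) simp
  define F where "F A t = measure (leb m u) (slice A (t *\<^sub>R u m))" for A t
  have F0: "F X t \<ge> 0" for X t by (simp add: F_def)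
  have emF: "emeasure (leb m u) (slice X (t *\<^sub>R u m)) = ennreal (F X t)" if "compact X" for X t
    unfolding F_def using that by (intro emeasure_leb_compact on compact_slice)
  have emF': "(\<integral>\<^sup>+x. indicator X (x + t *\<^sub>R u m) \<partial>leb m u) = ennreal (F X t)" if "compact X" for X t
  proof -
    have "(\<integral>\<^sup>+x. indicator X (x + t *\<^sub>R u m) \<partial>leb m u) = (\<integral>\<^sup>+x. indicator (slice X (t *\<^sub>R u m)) x \<partial>leb m u)"
      by (intro nn_integral_cong) (auto simp: indicator_def slice_def)
    then show ?thesis using borel_of_compact[OF compact_slice[OF that]] emF[OF that] by simp
  qed
  have mF: "F X \<in> borel_measurable borel" if X: "compact X" for X
  proof -
    have [measurable]: "X \<in> sets borel" using X by (rule borel_of_compact)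
    have "(\<lambda>t. \<integral>\<^sup>+x. indicator X (x + t *\<^sub>R u m) \<partial>leb m u) \<in> borel_measurable borel"
      by measurable
    then have "(\<lambda>t. enn2real (ennreal (F X t))) \<in> borel_measurable borel"
      unfolding emF'[OF X] by measurable
    then show ?thesis using F0 by simp
  qed
  have intF: "ennreal (measure (leb (Suc m) u) X) = (\<integral>\<^sup>+t. ennreal (F X t) \<partial>lborel)" if X: "compact X" for X
  proof -
    have "emeasure (leb (Suc m) u) X = (\<integral>\<^sup>+x. indicator X x \<partial>leb (Suc m) u)" using borel_of_compact[OF X] by simp
    also have "\<dots> = (\<integral>\<^sup>+t. ennreal (F X t) \<partial>lborel)"
      using X emF' by (subst nn_integral_leb_Suc) (auto intro!: borel_of_compact borel_measurable_indicator)
    finally show ?thesis using emeasure_leb_compact[OF Suc.prems(1) X] by simp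
  qed
  have key: "F A x powr (1 - l) * F B y powr l \<le> F C ((1 - l) * x + l * y)"
    if "compact A" "compact B" "compact C" "convex A" "convex B" "0 < l" "l < 1" "combine_sets l A B \<subseteq> C"
    for A B C x y l
  proof -
    have "combine_sets l (slice A (x *\<^sub>R u m)) (slice B (y *\<^sub>R u m)) \<subseteq> slice C ((1 - l) *\<^sub>R x *\<^sub>R u m + l *\<^sub>R y *\<^sub>R u m)"
      by (rule combine_slices) fact
    also have "(1 - l) *\<^sub>R x *\<^sub>R u m + l *\<^sub>R y *\<^sub>R u m = ((1 - l) * x + l * y) *\<^sub>R u m"
      by (simp add: scaleR_add_left)
    finally show ?thesis unfolding F_def
      using that on by (intro Suc.IH compact_slice convex_slice)
  qed
  have orth: "x \<bullet> u m = 0" if "x \<in> span (u ` {..<m})" for x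
  proof -
    have "x \<bullet> u m = (\<Sum>i<m. (x \<bullet> u i) *\<^sub>R u i) \<bullet> u m" using span_expand[OF on that] by simp
    also have "\<dots> = 0" using Suc.prems(1) by (auto simp: inner_sum_left orthonormal_def)
    finally show ?thesis .
  qed
  \<comment> \<open>The quasi-concave lemma wants superlevel sets that are bounded and functions with a finite
    supremum: the sections of a set inside a ball are empty beyond its radius and fit in a smaller ball.\<close>
  have bounds: "\<exists>R M. (\<forall>t. F X t \<noteq> 0 \<longrightarrow> \<bar>t\<bar> \<le> R) \<and> (\<forall>t. F X t \<le> M)" if X: "compact X" for X
  proof -
    obtain R where R: "\<And>x. x \<in> X \<Longrightarrow> norm x \<le> R" using compact_imp_bounded[OF X] by (auto simp: bounded_iff)
    define Q where "Q = cball (0::'a) R \<inter> span (u ` {..<m})"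
    have cQ: "compact Q"
      unfolding Q_def by (rule compact_in_span[OF on]) (auto intro!: closed_span_orthonormal[OF on] bounded_Int)
    have pyth: "(norm x)\<^sup>2 + t\<^sup>2 \<le> R\<^sup>2" if "x \<in> span (u ` {..<m})" "x + t *\<^sub>R u m \<in> X" for x t
    proof -
      have "(norm x)\<^sup>2 + t\<^sup>2 = (norm (x + t *\<^sub>R u m))\<^sup>2"
        using orth[OF that(1)] orthonormal_inner[OF Suc.prems(1), of m m]
        unfolding power2_norm_eq_inner by (simp add: inner_add_left inner_add_right inner_commute power2_eq_square)
      also have "\<dots> \<le> R\<^sup>2" using R[OF that(2)] by (intro power_mono) auto
      finally show ?thesis .
    qed
    have "F X t \<le> measure (leb m u) Q" for t
      unfolding F_def
    proof (rule measure_leb_mono[OF on])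
      show "slice X (t *\<^sub>R u m) \<in> sets borel" using compact_slice[OF X] by (rule borel_of_compact)
      show "slice X (t *\<^sub>R u m) \<inter> span (u ` {..<m}) \<subseteq> Q"
      proof
        fix x assume x: "x \<in> slice X (t *\<^sub>R u m) \<inter> span (u ` {..<m})"
        then have "(norm x)\<^sup>2 + t\<^sup>2 \<le> R\<^sup>2" using pyth[of x t] by (auto simp: slice_def)
        then have "(norm x)\<^sup>2 \<le> R\<^sup>2" using zero_le_power2[of t] by linarith
        moreover have "x + t *\<^sub>R u m \<in> X" using x by (simp add: slice_def)
        then have "norm (x + t *\<^sub>R u m) \<le> R" by (rule R)
        then have "R \<ge> 0" using norm_ge_zero[of "x + t *\<^sub>R u m"] by linarith
        ultimately have "norm x \<le> R" by (rule power2_le_imp_le)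
        then show "x \<in> Q" using x by (auto simp: Q_def)
      qed
    qed (rule cQ)
    moreover have "\<bar>t\<bar> \<le> \<bar>R\<bar>" if "F X t \<noteq> 0" for t
    proof (rule ccontr)
      assume t: "\<not> \<bar>t\<bar> \<le> \<bar>R\<bar>"
      have "F X t \<le> measure (leb m u) {}"
        unfolding F_def
      proof (rule measure_leb_mono[OF on])
        show "slice X (t *\<^sub>R u m) \<in> sets borel" using compact_slice[OF X] by (rule borel_of_compact)
        show "slice X (t *\<^sub>R u m) \<inter> span (u ` {..<m}) \<subseteq> {}"
        proof
          fix x assume x: "x \<in> slice X (t *\<^sub>R u m) \<inter> span (u ` {..<m})"
          then have "(norm x)\<^sup>2 + t\<^sup>2 \<le> R\<^sup>2" using pyth[of x t] by (auto simp: slice_def)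
          then have "t\<^sup>2 \<le> R\<^sup>2" using zero_le_power2[of "norm x"] by linarith
          then show "x \<in> {}" using t by (simp add: abs_le_square_iff[symmetric])
        qed
      qed simp
      then show False using that F0[of X t] by simp
    qed
    ultimately show ?thesis by blast
  qed
  have norml: "\<exists>a>0. (\<forall>t. F X t \<le> a) \<and> (\<forall>s<1. \<exists>t. a * s < F X t)"
    if X: "compact X" "measure (leb (Suc m) u) X \<noteq> 0" for X
  proof -
    obtain M where M: "\<And>t. F X t \<le> M" using bounds[OF X(1)] by blast
    define a where "a = (SUP t. F X t)"
    have bd: "bdd_above (range (F X))" using M by (auto intro!: bdd_aboveI)
    have le: "F X t \<le> a" for t unfolding a_def by (rule cSUP_upper) (auto intro: bd)
    have "a > 0"
    proof (rule ccontr)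
      assume "\<not> a > 0"
      then have "F X t = 0" for t using le[of t] F0[of X t] by simp
      then show False using intF[OF X(1)] X(2) by (simp add: measure_le_0_iff)
    qed
    moreover have "\<exists>t. a * s < F X t" if "s < 1" for s
    proof -
      have "a * s < a" using \<open>a > 0\<close> that by simp
      then show ?thesis unfolding a_def using less_cSUP_iff[OF _ bd] by blast
    qed
    ultimately show ?thesis using le by blast
  qed
  have level: "convex {t. s < F X t / a}" "bounded {t. s < F X t / a}" if X: "compact X" "convex X" "a > 0" "s > 0" for X a s
  proof -
    have eq: "{t. s < F X t / a} = {t. a * s < F X t}" using X by (auto simp: field_simps)
    show "convex {t. s < F X t / a}"
      unfolding eq convex_alt
    proof (intro ballI allI impI)
      fix x y \<tau> :: real assume *: "x \<in> {t. a * s < F X t}" "y \<in> {t. a * s < F X t}" "0 \<le> \<tau> \<and> \<tau> \<le> 1"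
      consider "\<tau> = 0" | "\<tau> = 1" | "0 < \<tau>" "\<tau> < 1" using * by linarith
      then show "(1 - \<tau>) *\<^sub>R x + \<tau> *\<^sub>R y \<in> {t. a * s < F X t}"
      proof cases
        case 3
        have "a * s < F X x powr (1 - \<tau>) * F X y powr \<tau>"
          using * 3 X by (intro powr_combination_less) auto
        also have "\<dots> \<le> F X ((1 - \<tau>) * x + \<tau> * y)"
          using X 3 combine_sets_subset_convex[OF X(2), of \<tau>] by (intro key) auto
        finally show ?thesis by simp
      qed (use * in auto)
    qed
    obtain R where R: "\<And>t. F X t \<noteq> 0 \<Longrightarrow> \<bar>t\<bar> \<le> R" using bounds[OF X(1)] by blast
    have "0 < F X t" if "a * s < F X t" for t using that X by (smt (verit) mult_pos_pos)
    then show "bounded {t. s < F X t / a}"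
      unfolding eq bounded_iff using R by (intro exI[of _ R]) force
  qed
  show ?case
  proof (cases "measure (leb (Suc m) u) A = 0 \<or> measure (leb (Suc m) u) B = 0")
    case False
    obtain a where a: "a > 0" "\<And>t. F A t \<le> a" "\<And>s. s < 1 \<Longrightarrow> \<exists>t. a * s < F A t"
      using norml[OF Suc.prems(2)] False by blast
    obtain b where b: "b > 0" "\<And>t. F B t \<le> b" "\<And>s. s < 1 \<Longrightarrow> \<exists>t. b * s < F B t"
      using norml[OF Suc.prems(3)] False by blast
    \<comment> \<open>The normalising factor for which \<open>key\<close> survives division by the two maxima.\<close>
    define \<rho> where "\<rho> = a powr (1 - l) * b powr l"
    have \<rho>: "\<rho> > 0" using a b by (simp add: \<rho>_def)
    let ?V = "measure (leb (Suc m) u)"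
    have int: "(\<integral>\<^sup>+t. ennreal (F X t / c) \<partial>lborel) = ennreal (?V X / c)" if "compact X" "c > 0" for X c
    proof -
      have "(\<integral>\<^sup>+t. ennreal (F X t / c) \<partial>lborel) = (\<integral>\<^sup>+t. ennreal (F X t) * ennreal (1 / c) \<partial>lborel)"
        using that F0 by (intro nn_integral_cong) (simp add: ennreal_mult[symmetric])
      also have "\<dots> = ennreal (?V X) * ennreal (1 / c)"
        using mF[OF that(1)] intF[OF that(1)] by (subst nn_integral_multc) auto
      finally show ?thesis using that by (simp add: ennreal_mult[symmetric])
    qed
    have "ennreal (1 - l) * (\<integral>\<^sup>+t. ennreal (F A t / a) \<partial>lborel) + ennreal l * (\<integral>\<^sup>+t. ennreal (F B t / b) \<partial>lborel)
      \<le> (\<integral>\<^sup>+t. ennreal (F C t / \<rho>) \<partial>lborel)"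
    proof (rule quasiconcave_integral_combination)
      show "F A x / a \<le> 1" "F B x / b \<le> 1" for x using a b by auto
      show "\<exists>t. s < F A t / a" "\<exists>t. s < F B t / b" if "s < 1" for s
        using a(3)[OF that] b(3)[OF that] a(1) b(1)
        by (auto simp: pos_less_divide_eq mult.commute[of s])
      show "s < F C ((1 - l) * x + l * y) / \<rho>" if "0 < s" "s < F A x / a" "s < F B y / b" for s x y
      proof -
        have "s < (F A x / a) powr (1 - l) * (F B y / b) powr l"
          using that Suc.prems by (intro powr_combination_less) auto
        also have "\<dots> = (F A x powr (1 - l) * F B y powr l) / \<rho>"
          using a b F0 by (simp add: \<rho>_def powr_divide)
        also have "\<dots> \<le> F C ((1 - l) * x + l * y) / \<rho>"
          using Suc.prems \<rho> by (intro divide_right_mono key) auto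
        finally show ?thesis .
      qed
    qed (use Suc.prems a b mF level in auto)
    then have "ennreal ((1 - l) * (?V A / a) + l * (?V B / b)) \<le> ennreal (?V C / \<rho>)"
      using Suc.prems a b \<rho> ennreal_combination[of "1 - l" l "?V A / a" "?V B / b"] by (simp only: int) simp
    then have "(1 - l) * (?V A / a) + l * (?V B / b) \<le> ?V C / \<rho>"
      using \<rho> by (simp add: ennreal_le_iff)
    moreover have "(?V A / a) powr (1 - l) * (?V B / b) powr l \<le> (1 - l) * (?V A / a) + l * (?V B / b)"
      using False a b Suc.prems by (intro Youngs_inequality_0) (auto simp: zero_less_measure_iff)
    ultimately have "(?V A powr (1 - l) * ?V B powr l) / \<rho> \<le> ?V C / \<rho>"
      using a b by (simp add: \<rho>_def powr_divide)
    then show ?thesis using \<rho> by (simp add: divide_le_cancel)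
  qed (use Suc.prems in auto)
qed

lemma measure_leb_affine:
  assumes u: "orthonormal m u" "r > 0" "a \<in> span (u ` {..<m})" and A: "compact A"
  shows "measure (leb m u) ((\<lambda>x. r *\<^sub>R x + a) ` A) = r ^ m * measure (leb m u) A"
proof -
  have "compact ((\<lambda>x. r *\<^sub>R x + a) ` A)"
    using A by (intro compact_continuous_image continuous_intros)
  then have "emeasure (leb m u) ((\<lambda>x. r *\<^sub>R x + a) ` A) = ennreal (r ^ m) * emeasure (leb m u) A"
    using u A by (intro emeasure_leb_affine) (auto intro!: borel_of_compact borel_measurable_indicator)
  then show ?thesis using u(2) by (simp add: measure_def enn2real_mult)
qed

lemma measure_leb_scale:
  assumes u: "orthonormal m u" "r > 0" and A: "compact A"
  shows "measure (leb m u) ((*\<^sub>R) r ` A) = r ^ m * measure (leb m u) A"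
  using measure_leb_affine[OF u _ A, of 0] by (simp add: span_zero)

text \<open>Homogeneity turns the multiplicative inequality into the additive one: it is applied to
  the two bodies scaled to volume one.\<close>

lemma brunn_minkowski:
  fixes u :: "nat \<Rightarrow> 'a::{real_inner, second_countable_topology}"
  assumes u: "orthonormal m u" and m: "m \<ge> 1" and A: "compact A" "convex A" and B: "compact B" "convex B"
    and l: "0 < l" "l < 1" and pos: "measure (leb m u) A > 0" "measure (leb m u) B > 0"
  shows "(1 - l) * measure (leb m u) A powr (1 / real m) + l * measure (leb m u) B powr (1 / real m)
    \<le> measure (leb m u) (combine_sets l A B) powr (1 / real m)"
proof -
  let ?V = "measure (leb m u)"
  define \<alpha> where "\<alpha> = ?V A powr (1 / real m)"
  define \<beta> where "\<beta> = ?V B powr (1 / real m)"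
  define N where "N = (1 - l) * \<alpha> + l * \<beta>"
  have ab: "\<alpha> > 0" "\<beta> > 0" using pos by (auto simp: \<alpha>_def \<beta>_def)
  have N: "N > 0" using ab l by (auto simp: N_def intro!: add_pos_pos)
  define \<mu> where "\<mu> = l * \<beta> / N"
  have mu1: "1 - \<mu> = (1 - l) * \<alpha> / N" using N by (simp add: \<mu>_def N_def field_simps)
  have "0 < \<mu>" using l ab N by (simp add: \<mu>_def)
  moreover have "0 < 1 - \<mu>" unfolding mu1 using l ab N by simp
  ultimately have mu: "0 < \<mu>" "\<mu> < 1" by auto
  have pw: "\<alpha> ^ m = ?V A" "\<beta> ^ m = ?V B"
    using pos m by (auto simp: \<alpha>_def \<beta>_def powr_realpow[symmetric] powr_powr)
  have c1: "compact ((*\<^sub>R) (1 / c) ` X)" "convex ((*\<^sub>R) (1 / c) ` X)" if "compact X" "convex X" for X :: "'a set" and c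
    using that by (auto intro: compact_scaling convex_scaling)
  have step: "(1 - \<mu>) *\<^sub>R (1 / \<alpha>) *\<^sub>R a + \<mu> *\<^sub>R (1 / \<beta>) *\<^sub>R b = (1 / N) *\<^sub>R ((1 - l) *\<^sub>R a + l *\<^sub>R b)" for a b :: 'a
  proof -
    have "(1 - \<mu>) * (1 / \<alpha>) = (1 / N) * (1 - l)" unfolding mu1 using ab by simp
    moreover have "\<mu> * (1 / \<beta>) = (1 / N) * l" using ab by (simp add: \<mu>_def)
    ultimately show ?thesis by (simp only: scaleR_scaleR scaleR_add_right)
  qed
  have eq: "combine_sets \<mu> ((*\<^sub>R) (1 / \<alpha>) ` A) ((*\<^sub>R) (1 / \<beta>) ` B) \<subseteq> (*\<^sub>R) (1 / N) ` combine_sets l A B"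
  proof
    fix z assume "z \<in> combine_sets \<mu> ((*\<^sub>R) (1 / \<alpha>) ` A) ((*\<^sub>R) (1 / \<beta>) ` B)"
    then obtain a b where z: "a \<in> A" "b \<in> B" "z = (1 - \<mu>) *\<^sub>R (1 / \<alpha>) *\<^sub>R a + \<mu> *\<^sub>R (1 / \<beta>) *\<^sub>R b"
      unfolding combine_sets_def by blast
    then have "(1 - l) *\<^sub>R a + l *\<^sub>R b \<in> combine_sets l A B" unfolding combine_sets_def by blast
    then show "z \<in> (*\<^sub>R) (1 / N) ` combine_sets l A B" unfolding z(3) step by (rule imageI)
  qed
  have "?V ((*\<^sub>R) (1 / \<alpha>) ` A) powr (1 - \<mu>) * ?V ((*\<^sub>R) (1 / \<beta>) ` B) powr \<mu>
     \<le> ?V ((*\<^sub>R) (1 / N) ` combine_sets l A B)"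
    using A B by (intro brunn_minkowski_multiplicative u c1 compact_scaling compact_combine_sets mu eq)
  moreover have "?V ((*\<^sub>R) (1 / \<alpha>) ` A) = 1" "?V ((*\<^sub>R) (1 / \<beta>) ` B) = 1"
    using ab A B pos by (auto simp: measure_leb_scale[OF u] pw power_divide)
  moreover have "?V ((*\<^sub>R) (1 / N) ` combine_sets l A B) = (1 / N) ^ m * ?V (combine_sets l A B)"
    using N A B by (intro measure_leb_scale u compact_combine_sets) auto
  ultimately have "N ^ m \<le> ?V (combine_sets l A B)"
    using N by (simp add: field_simps)
  then have "(N ^ m) powr (1 / real m) \<le> ?V (combine_sets l A B) powr (1 / real m)"
    using N by (intro powr_mono2) auto
  also have "(N ^ m) powr (1 / real m) = N"
    using N m by (simp add: powr_realpow[symmetric] powr_powr)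
  finally show ?thesis by (simp add: N_def \<alpha>_def \<beta>_def)
qed

section \<open>Volume and surface area\<close>

lemma orthonormal_unit_vec: "orthonormal n unit_vec"
proof -
  have "unit_vec i \<bullet> unit_vec j = (if i = j then 1 else 0)" for i j
    using inner_fseq_superset[of "{i}" "unit_vec i" "unit_vec j"] by simp
  then show ?thesis by (simp add: orthonormal_def)
qed

lemma subspace_euc: "subspace (euc n)"
  by (auto simp: subspace_def euc_def)

lemma span_unit_vec: "span (unit_vec ` {..<n}) = euc n"
proof
  have "unit_vec ` {..<n} \<subseteq> euc n" by (auto simp: euc_def)
  then show "span (unit_vec ` {..<n}) \<subseteq> euc n" by (intro span_minimal subspace_euc)
  show "euc n \<subseteq> span (unit_vec ` {..<n})"
  proof
    fix x assume x: "x \<in> euc n"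
    have "x = (\<Sum>i<n. coord x i *\<^sub>R unit_vec i)"
      by (rule fseq_eqI) (use x in \<open>auto simp: coord_comb_unit_vec euc_def\<close>)
    then show "x \<in> span (unit_vec ` {..<n})" by (metis comb_in_span)
  qed
qed

lemma subspace_orthonormal_basis:
  assumes H: "subspace H" "H \<subseteq> euc n"
  obtains u where "orthonormal (dim H) u" "span (u ` {..<dim H}) = H"
proof -
  have "\<exists>u. orthonormal i u \<and> u ` {..<i} \<subseteq> H" if "i \<le> dim H" for i
    using that
  proof (induction i)
    case 0
    then show ?case by (auto simp: orthonormal_def)
  next
    case (Suc i)
    then obtain u where u: "orthonormal i u" "u ` {..<i} \<subseteq> H" by auto
    have "span (u ` {..<i}) \<noteq> H"
      using dim_span_orthonormal[OF u(1)] Suc.prems by (metis Suc_n_not_le_n)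
    from orthonormal_extend[OF u(1) this u(2) H(1)] obtain z where
      z: "z \<in> H" "norm z = 1" "\<And>b. b < i \<Longrightarrow> z \<bullet> u b = 0" by blast
    have "orthonormal (Suc i) (u(i := z))" by (rule orthonormal_upd[OF u(1) z(2,3)])
    moreover have "u(i := z) ` {..<Suc i} \<subseteq> H" using u z by (auto simp: less_Suc_eq)
    ultimately show ?case by blast
  qed
  then obtain u where u: "orthonormal (dim H) u" "u ` {..<dim H} \<subseteq> H" by blast
  obtain B where B: "B \<subseteq> H" "independent B" "H \<subseteq> span B" "card B = dim H" using basis_exists by blast
  have "B \<subseteq> span (unit_vec ` {..<n})" using B H by (auto simp: span_unit_vec)
  then have fB: "finite B" using independent_span_bound[of "unit_vec ` {..<n}" B] B by simp
  have "span (u ` {..<dim H}) = H"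
  proof (rule ccontr)
    assume "\<not> ?thesis"
    from orthonormal_extend[OF u(1) this u(2) H(1)] obtain z where
      z: "z \<in> H" "norm z = 1" "\<And>b. b < dim H \<Longrightarrow> z \<bullet> u b = 0" by blast
    have on: "orthonormal (Suc (dim H)) (u(dim H := z))" by (rule orthonormal_upd[OF u(1) z(2,3)])
    have "u(dim H := z) ` {..<Suc (dim H)} \<subseteq> H" using u z by (auto simp: less_Suc_eq)
    then have "u(dim H := z) ` {..<Suc (dim H)} \<subseteq> span B" using B(3) by (rule order_trans)
    then have "Suc (dim H) \<le> card B"
      using independent_span_bound[OF fB orthonormal_independent(1)[OF on]] orthonormal_independent(3)[OF on] by simp
    then show False using B by simp
  qed
  with u that show ?thesis by blast
qed

lemma orthonormal_basis_of_iff: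
  "orthonormal_basis_of E u \<longleftrightarrow> orthonormal (dim E) u \<and> span (u ` {..<dim E}) = E"
  by (simp add: orthonormal_basis_of_def orthonormal_def)

text \<open>\<open>lebesgue_sub\<close> is built from some orthonormal basis \<open>w\<close> of its own choice; by basis independence
  that basis yields the same \<open>leb\<close> as the given one.\<close>

lemma lebesgue_sub_eq_distr:
  assumes "orthonormal m u" "span (u ` {..<m}) = E"
  obtains w where "lebesgue_sub E = distr (\<Pi>\<^sub>M i\<in>{..<m}. lborel) (restrict_space borel E) (\<lambda>c. \<Sum>i<m. c i *\<^sub>R w i)"
    "leb m w = leb m u" "span (w ` {..<m}) = E"
proof -
  have d: "dim E = m" using dim_span_orthonormal[OF assms(1)] assms(2) by simp
  define w where "w = (SOME w. orthonormal_basis_of E w)"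
  have "orthonormal_basis_of E u" using assms d by (simp add: orthonormal_basis_of_iff)
  then have "orthonormal_basis_of E w" unfolding w_def by (rule someI[of "orthonormal_basis_of E"])
  then have w: "orthonormal m w" "span (w ` {..<m}) = E" by (simp_all add: orthonormal_basis_of_iff d)
  show ?thesis
  proof (rule that)
    show "lebesgue_sub E = distr (\<Pi>\<^sub>M i\<in>{..<m}. lborel) (restrict_space borel E) (\<lambda>c. \<Sum>i<m. c i *\<^sub>R w i)"
      by (simp add: lebesgue_sub_def Let_def w_def d)
    show "leb m w = leb m u" by (rule leb_basis_independent[OF w(1) assms(1)]) (simp add: w assms)
  qed (rule w)
qed

lemma comb_measurable_restrict:
  fixes w :: "nat \<Rightarrow> 'a::{real_inner, second_countable_topology}"
  assumes "span (w ` {..<m}) = E"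
  shows "(\<lambda>c. \<Sum>i<m. c i *\<^sub>R w i) \<in> measurable (\<Pi>\<^sub>M i\<in>{..<m}. (lborel :: real measure)) (restrict_space borel E)"
  using comb_in_span[of _ w m] assms by (intro measurable_restrict_space2 comb_measurable) auto

lemma vol_eq_leb:
  assumes "orthonormal m u" "span (u ` {..<m}) = E" "A \<in> sets borel" "A \<subseteq> E"
  shows "vol E A = measure (leb m u) A"
proof -
  obtain w where w: "lebesgue_sub E = distr (\<Pi>\<^sub>M i\<in>{..<m}. lborel) (restrict_space borel E) (\<lambda>c. \<Sum>i<m. c i *\<^sub>R w i)"
    "leb m w = leb m u" "span (w ` {..<m}) = E"
    using lebesgue_sub_eq_distr[OF assms(1,2)] .
  have A: "A \<in> sets (restrict_space borel E)"
    using assms by (auto simp: sets_restrict_space)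
  have "vol E A = measure (leb m w) A"
    unfolding vol_def w(1) leb_def using A assms(3)
    by (simp add: measure_distr comb_measurable_restrict[OF w(3)] comb_measurable)
  then show ?thesis by (simp add: w)
qed

lemma set_integral_lebesgue_sub:
  fixes h :: "fseq \<Rightarrow> real"
  assumes "orthonormal m u" "span (u ` {..<m}) = E" and [measurable]: "A \<in> sets borel" "h \<in> borel_measurable borel"
  shows "(LINT x:A|lebesgue_sub E. h x) = (LINT x:A|leb m u. h x)"
proof -
  obtain w where w: "lebesgue_sub E = distr (\<Pi>\<^sub>M i\<in>{..<m}. lborel) (restrict_space borel E) (\<lambda>c. \<Sum>i<m. c i *\<^sub>R w i)"
    "leb m w = leb m u" "span (w ` {..<m}) = E"
    using lebesgue_sub_eq_distr[OF assms(1,2)] .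
  have f: "(\<lambda>x. indicator A x *\<^sub>R h x) \<in> borel_measurable borel" by measurable
  have "(LINT x:A|lebesgue_sub E. h x) = (LINT x:A|leb m w. h x)"
    unfolding w(1) leb_def set_lebesgue_integral_def
    by (subst integral_distr[OF comb_measurable_restrict[OF w(3)] measurable_restrict_space1[OF f]],
        subst integral_distr[OF comb_measurable f]) simp
  then show ?thesis by (simp add: w)
qed

lemma unit_ball_eq: "unit_ball E = {x \<in> E. norm x \<le> 1}"
  by (auto simp: unit_ball_def)

lemma compact_unit_ball:
  assumes "orthonormal m u" "span (u ` {..<m}) = E" shows "compact (unit_ball E)"
  unfolding unit_ball_def
  by (rule compact_in_span[OF assms(1)]) (auto simp: assms(2)[symmetric] closed_span_orthonormal[OF assms(1)])

lemma measure_unit_ball: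
  assumes "orthonormal m u" "span (u ` {..<m}) = E"
  shows "measure (leb m u) (unit_ball E) = omega m"
proof -
  have eq: "measure (leb m v) (unit_ball F) = measure (leb m v) (cball 0 1)"
    if "orthonormal m v" "span (v ` {..<m}) = F" for v F
  proof -
    have "unit_ball F \<in> sets borel" using compact_unit_ball[OF that] by (rule borel_of_compact)
    then show ?thesis unfolding measure_def
      by (intro arg_cong[where f = enn2real] antisym emeasure_leb_mono) (auto simp: unit_ball_def that)
  qed
  have "omega m = measure (leb m unit_vec) (unit_ball (euc m))"
    unfolding omega_def
    by (rule vol_eq_leb[OF orthonormal_unit_vec span_unit_vec])
      (auto simp: unit_ball_def intro: borel_of_compact compact_unit_ball[OF orthonormal_unit_vec span_unit_vec, unfolded unit_ball_def])
  then show ?thesis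
    using eq[OF assms] eq[OF orthonormal_unit_vec span_unit_vec]
      emeasure_leb_ball[OF assms(1)] emeasure_leb_ball[OF orthonormal_unit_vec, of m]
    by (simp add: measure_def)
qed

lemma omega_pos: "omega m > 0"
proof -
  have c: "compact (unit_ball (euc m))" by (rule compact_unit_ball[OF orthonormal_unit_vec span_unit_vec])
  have "0 < emeasure (leb m unit_vec) (cball 0 1)" by (rule emeasure_leb_ball_pos[OF orthonormal_unit_vec]) simp
  also have "\<dots> \<le> emeasure (leb m unit_vec) (unit_ball (euc m))"
    by (rule emeasure_leb_mono) (use borel_of_compact[OF c] in \<open>auto simp: unit_ball_def span_unit_vec\<close>)
  also have "\<dots> = ennreal (omega m)"
    using emeasure_leb_compact[OF orthonormal_unit_vec c] measure_unit_ball[OF orthonormal_unit_vec span_unit_vec] by simp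
  finally show ?thesis by simp
qed

lemma antitone_tendsto_at_right:
  fixes q :: "real \<Rightarrow> real"
  assumes anti: "\<And>s t. 0 < s \<Longrightarrow> s < t \<Longrightarrow> q t \<le> q s" and bd: "\<And>t. 0 < t \<Longrightarrow> q t \<le> M"
  shows "(q \<longlongrightarrow> (SUP t\<in>{0<..}. q t)) (at_right 0)"
proof (rule order_tendstoI)
  have bdd: "bdd_above (q ` {0<..})" using bd by (auto intro!: bdd_aboveI)
  fix a
  show "\<forall>\<^sub>F t in at_right 0. a < q t" if a: "a < (SUP t\<in>{0<..}. q t)"
  proof -
    obtain t0 where t0: "t0 > 0" "a < q t0" using a less_cSUP_iff[OF _ bdd] by auto
    have "a < q t" if "0 < t" "t < t0" for t using anti[OF that] t0 by simp
    then show ?thesis using t0 unfolding eventually_at_right_field by blast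
  qed
  show "\<forall>\<^sub>F t in at_right 0. q t < a" if a: "a > (SUP t\<in>{0<..}. q t)"
  proof -
    have "q t < a" if "t > 0" for t
      using cSUP_upper[OF _ bdd, of t] that a by simp
    then show ?thesis unfolding eventually_at_right_field by (intro exI[of _ 1]) auto
  qed
qed

text \<open>By Brunn-Minkowski, \<open>t \<mapsto> |A + tB|\<^sup>1\<^sup>/\<^sup>m\<close> is concave, so its difference quotients at the origin
  increase to a limit. Brunn-Minkowski bounds them below, which is the isoperimetric inequality;
  an inscribed ball of radius \<open>r\<close> makes \<open>A + tB\<close> lie in a translate of \<open>(1 + t/r) A\<close> and bounds
  them above.\<close>

lemma surface_area_bounds:
  assumes u: "orthonormal m u" "span (u ` {..<m}) = E" and m: "m \<ge> 1"
    and A: "compact A" "convex A" "A \<subseteq> E"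
    and r: "r > 0" "x0 \<in> E" "\<And>b. b \<in> unit_ball E \<Longrightarrow> x0 + r *\<^sub>R b \<in> A"
  shows "vol E A > 0"
    and "d_const m * vol E A powr (real (m - 1) / real m) \<le> surface_area E A"
    and "surface_area E A \<le> real m * vol E A / r"
proof -
  let ?V = "measure (leb m u)"
  let ?B = "unit_ball E"
  have E: "subspace E" using u by auto
  define W where "W t = {a + t *\<^sub>R b | a b. a \<in> A \<and> b \<in> ?B}" for t
  define g where "g t = ?V (W t)" for t
  define f where "f t = g t powr (1 / real m)" for t
  have cB: "compact ?B" by (rule compact_unit_ball[OF u])
  have vB: "convex ?B" unfolding unit_ball_def using E by (intro convex_Int convex_cball subspace_imp_convex)
  have B0: "0 \<in> ?B" using E by (simp add: unit_ball_def subspace_0)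
  have W_image: "W t = (\<lambda>(a, b). a + t *\<^sub>R b) ` (A \<times> ?B)" for t by (auto simp: W_def)
  have cW: "compact (W t)" for t
    unfolding W_image using A cB
    by (intro compact_continuous_image compact_Times) (auto simp: case_prod_unfold intro!: continuous_intros)
  have vW: "convex (W t)" for t
  proof (rule convexI)
    fix x y and p q :: real assume *: "x \<in> W t" "y \<in> W t" "0 \<le> p" "0 \<le> q" "p + q = 1"
    then obtain a b a' b' where ab: "a \<in> A" "b \<in> ?B" "a' \<in> A" "b' \<in> ?B" "x = a + t *\<^sub>R b" "y = a' + t *\<^sub>R b'"
      by (auto simp: W_def)
    have "p *\<^sub>R x + q *\<^sub>R y = (p *\<^sub>R a + q *\<^sub>R a') + t *\<^sub>R (p *\<^sub>R b + q *\<^sub>R b')"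
      by (simp add: ab algebra_simps)
    moreover have "p *\<^sub>R a + q *\<^sub>R a' \<in> A" "p *\<^sub>R b + q *\<^sub>R b' \<in> ?B"
      using ab * A(2) vB by (auto simp: convex_def)
    ultimately show "p *\<^sub>R x + q *\<^sub>R y \<in> W t" unfolding W_def by blast
  qed
  have WE: "W t \<subseteq> E" for t
    unfolding W_def using A E by (auto simp: unit_ball_def subspace_add subspace_scale)
  have W0: "W 0 = A" using B0 by (auto simp: W_def)
  have AW: "A \<subseteq> W t" for t
  proof
    fix a assume "a \<in> A"
    then have "a = a + t *\<^sub>R 0 \<and> a \<in> A \<and> 0 \<in> ?B" using B0 by simp
    then show "a \<in> W t" unfolding W_def by blast
  qed
  have volW: "vol E (W t) = g t" for t
    unfolding g_def using cW WE by (intro vol_eq_leb[OF u] borel_of_compact)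
  have volA: "vol E A = g 0" using volW[of 0] by (simp add: W0)
  have VB: "?V ?B = omega m" by (rule measure_unit_ball[OF u])
  have mono: "?V X \<le> ?V Y" if "compact X" "compact Y" "X \<subseteq> Y" for X Y
    using that by (intro measure_leb_mono[OF u(1)] borel_of_compact) auto
  have "r ^ m * omega m = ?V ((\<lambda>x. r *\<^sub>R x + x0) ` ?B)"
    using r u cB by (subst measure_leb_affine[OF u(1)]) (auto simp: VB)
  also have "\<dots> \<le> ?V A"
    using r cB by (intro mono A compact_continuous_image continuous_intros) (auto simp: add.commute)
  finally have "r ^ m * omega m \<le> ?V A" .
  then have posA: "?V A > 0" using r(1) omega_pos[of m] by (smt (verit) mult_pos_pos zero_less_power)
  then have g0: "g 0 > 0" by (simp add: g_def W0)
  then show "vol E A > 0" by (simp add: volA)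
  have gpos: "g t > 0" for t
    using g0 mono[OF A(1) cW AW, of t] by (simp add: g_def W0)
  have fpos: "f t > 0" for t using gpos[of t] by (simp add: f_def)
  have fm: "f t ^ m = g t" for t
    using gpos[of t] m by (simp add: f_def powr_realpow[symmetric] powr_powr)
  \<comment> \<open>Concavity between the points \<open>0\<close> and \<open>t\<close> is all that monotone difference quotients need.\<close>
  have conc: "(1 - s) * f 0 + s * f t \<le> f (s * t)" if s: "0 < s" "s < 1" and t: "t > 0" for s t
  proof -
    have "(1 - s) * ?V A powr (1 / real m) + s * ?V (W t) powr (1 / real m)
        \<le> ?V (combine_sets s A (W t)) powr (1 / real m)"
      using posA gpos[of t] by (intro brunn_minkowski u m A cW vW s) (auto simp: g_def)
    also have "\<dots> \<le> ?V (W (s * t)) powr (1 / real m)"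
    proof (intro powr_mono2 mono compact_combine_sets A cW)
      show "combine_sets s A (W t) \<subseteq> W (s * t)"
      proof
        fix x assume "x \<in> combine_sets s A (W t)"
        then obtain a a' b where ab: "a \<in> A" "a' \<in> A" "b \<in> ?B" "x = (1 - s) *\<^sub>R a + s *\<^sub>R (a' + t *\<^sub>R b)"
          by (auto simp: combine_sets_def W_def)
        have "x = ((1 - s) *\<^sub>R a + s *\<^sub>R a') + (s * t) *\<^sub>R b" by (simp add: ab algebra_simps)
        moreover have "(1 - s) *\<^sub>R a + s *\<^sub>R a' \<in> A" using ab s A(2) by (simp add: convex_alt)
        ultimately show "x \<in> W (s * t)" using ab unfolding W_def by blast
      qed
    qed auto
    finally show ?thesis by (simp add: f_def g_def W0)
  qed
  have upper: "f t \<le> (1 + t / r) * f 0" if t: "t > 0" for t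
  proof -
    let ?c = "1 + t / r"
    have c: "?c > 0" using t r by (simp add: add_pos_pos)
    have sub: "W t \<subseteq> (\<lambda>x. ?c *\<^sub>R x + (- (t / r)) *\<^sub>R x0) ` A"
    proof
      fix x assume "x \<in> W t"
      then obtain a b where ab: "a \<in> A" "b \<in> ?B" "x = a + t *\<^sub>R b" by (auto simp: W_def)
      define y where "y = (1 / ?c) *\<^sub>R a + (t / r / ?c) *\<^sub>R (x0 + r *\<^sub>R b)"
      have "1 / ?c + t / r / ?c = 1" using c by (subst add_divide_distrib[symmetric]) simp
      then have "y \<in> A" unfolding y_def using ab r A(2) t c by (intro convexD) auto
      moreover have "?c *\<^sub>R y = a + (t / r) *\<^sub>R (x0 + r *\<^sub>R b)"
        unfolding y_def scaleR_add_right scaleR_scaleR using c by simp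
      then have "x = ?c *\<^sub>R y + (- (t / r)) *\<^sub>R x0" using r by (simp add: ab algebra_simps)
      ultimately show "x \<in> (\<lambda>x. ?c *\<^sub>R x + (- (t / r)) *\<^sub>R x0) ` A" by blast
    qed
    have "g t \<le> ?V ((\<lambda>x. ?c *\<^sub>R x + (- (t / r)) *\<^sub>R x0) ` A)"
      unfolding g_def using A by (intro mono cW sub compact_continuous_image continuous_intros)
    also have "\<dots> = ?c ^ m * g 0"
      unfolding g_def W0 using c r u A E by (intro measure_leb_affine) (auto simp: subspace_scale subspace_neg)
    also have "\<dots> = (?c * f 0) ^ m" by (simp add: power_mult_distrib fm)
    finally have "f t ^ m \<le> (?c * f 0) ^ m" by (simp add: fm)
    moreover have "0 \<le> ?c * f 0" "0 \<le> f t" using c fpos[of 0] fpos[of t] by simp_all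
    ultimately show ?thesis using power_mono_iff[of "f t" "?c * f 0" m] m by (simp only:)
  qed
  have lower: "f 0 + t * omega m powr (1 / real m) \<le> f t" if t: "t > 0" for t
  proof -
    let ?tB = "(*\<^sub>R) t ` ?B"
    have ctB: "compact ?tB" "convex ?tB" using cB vB by (auto intro: compact_scaling convex_scaling)
    have VtB: "?V ?tB = t ^ m * omega m" using measure_leb_scale[OF u(1) t cB] by (simp add: VB)
    have "(1 - 1/2) * ?V A powr (1 / real m) + 1/2 * ?V ?tB powr (1 / real m)
        \<le> ?V (combine_sets (1/2) A ?tB) powr (1 / real m)"
      using posA t omega_pos by (intro brunn_minkowski u m A ctB) (auto simp: VtB)
    moreover have "W t = (*\<^sub>R) 2 ` combine_sets (1/2) A ?tB"
      unfolding W_image combine_sets_image by (force simp: image_iff scaleR_add_right)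
    then have "g t = 2 ^ m * ?V (combine_sets (1/2) A ?tB)"
      unfolding g_def using measure_leb_scale[OF u(1) _ compact_combine_sets[OF A(1) ctB(1)], of 2] by simp
    then have "f t = 2 * ?V (combine_sets (1/2) A ?tB) powr (1 / real m)"
      using m by (simp add: f_def powr_mult powr_realpow[symmetric] powr_powr)
    moreover have "?V ?tB powr (1 / real m) = t * omega m powr (1 / real m)"
      using t m omega_pos[of m] by (simp add: VtB powr_mult powr_realpow[symmetric] powr_powr)
    ultimately show ?thesis by (simp add: f_def g_def W0)
  qed
  define q where "q t = (f t - f 0) / t" for t
  define D where "D = (SUP t\<in>{0<..}. q t)"
  have q_le: "q t \<le> f 0 / r" if "t > 0" for t
    using upper[OF that] that r by (simp add: q_def field_simps)
  have q_ge: "omega m powr (1 / real m) \<le> q t" if "t > 0" for t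
    using lower[OF that] that by (simp add: q_def field_simps)
  have q_anti: "q t \<le> q s" if "0 < s" "s < t" for s t
  proof -
    have "(1 - s / t) * f 0 + (s / t) * f t \<le> f (s / t * t)" using that by (intro conc) auto
    then show ?thesis using that by (simp add: q_def field_simps)
  qed
  have qD: "(q \<longlongrightarrow> D) (at_right 0)" unfolding D_def by (rule antitone_tendsto_at_right[OF q_anti q_le])
  have D_le: "D \<le> f 0 / r"
    by (rule tendsto_upperbound[OF qD]) (auto simp: eventually_at_right_field intro!: exI[of _ 1] q_le)
  have D_ge: "omega m powr (1 / real m) \<le> D"
    by (rule tendsto_lowerbound[OF qD]) (auto simp: eventually_at_right_field intro!: exI[of _ 1] q_ge)
  have "(f has_field_derivative D) (at_right 0)"
    using qD by (simp add: has_field_derivative_iff q_def[abs_def])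
  then have "((\<lambda>t. f t ^ m) has_field_derivative real m * (D * f 0 ^ (m - Suc 0))) (at_right 0)"
    by (rule DERIV_power)
  then have "((\<lambda>t. (g t - g 0) / t) \<longlongrightarrow> real m * (D * f 0 ^ (m - Suc 0))) (at_right 0)"
    by (simp add: has_field_derivative_iff fm)
  then have "Lim (at_right 0) (\<lambda>t. (g t - g 0) / t) = real m * (D * f 0 ^ (m - Suc 0))"
    by (intro tendsto_Lim) auto
  then have S: "surface_area E A = real m * (D * f 0 ^ (m - Suc 0))"
    by (simp add: surface_area_def volW[unfolded W_def] volA)
  have "f 0 / r * f 0 ^ (m - Suc 0) = g 0 / r"
    using m by (simp add: fm[symmetric] power_eq_if)
  moreover have "D * f 0 ^ (m - Suc 0) \<le> f 0 / r * f 0 ^ (m - Suc 0)"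
    using D_le fpos[of 0] by (intro mult_right_mono) auto
  ultimately have "D * f 0 ^ (m - Suc 0) \<le> g 0 / r" by (simp only:)
  then have "real m * (D * f 0 ^ (m - Suc 0)) \<le> real m * (g 0 / r)"
    by (rule mult_left_mono) simp
  then show "surface_area E A \<le> real m * vol E A / r" by (simp add: S volA)
  have "f 0 ^ (m - 1) = vol E A powr (real (m - 1) / real m)"
    using fpos[of 0] gpos[of 0] by (simp add: powr_realpow[symmetric] volA f_def powr_powr)
  moreover have "omega m powr (1 / real m) * f 0 ^ (m - 1) \<le> D * f 0 ^ (m - 1)"
    using D_ge fpos[of 0] by (intro mult_right_mono) auto
  ultimately have "real m * (omega m powr (1 / real m) * vol E A powr (real (m - 1) / real m))
      \<le> real m * (D * f 0 ^ (m - 1))"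
    by (intro mult_left_mono) auto
  then show "d_const m * vol E A powr (real (m - 1) / real m) \<le> surface_area E A"
    by (simp add: S d_const_def mult.assoc)
qed

section \<open>Integration over convex bodies\<close>

lemma set_integrable_leb:
  fixes h :: "'a::{real_inner, second_countable_topology} \<Rightarrow> real"
  assumes u: "orthonormal m u" and K: "compact K" and h: "continuous_on UNIV h"
  shows "set_integrable (leb m u) K h"
proof -
  have "compact (h ` K)"
    using K by (intro compact_continuous_image continuous_on_subset[OF h]) auto
  then obtain B where B: "\<And>x. x \<in> K \<Longrightarrow> norm (h x) \<le> B"
    using compact_imp_bounded by (force simp: bounded_iff)
  show ?thesis
    unfolding set_integrable_def
  proof (rule integrableI_bounded_set_indicator)
    show "K \<in> sets (leb m u)" using borel_of_compact[OF K] by simp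
    show "h \<in> borel_measurable (leb m u)"
      using borel_measurable_continuous_onI[OF h] by simp
    show "emeasure (leb m u) K < \<infinity>"
      using emeasure_leb_bounded[OF u borel_of_compact[OF K] compact_imp_bounded[OF K]] .
    show "AE x in leb m u. x \<in> K \<longrightarrow> norm (h x) \<le> B" using B by simp
  qed
qed

lemma set_integral_leb_sum:
  fixes h :: "'i \<Rightarrow> 'a::{real_inner, second_countable_topology} \<Rightarrow> real"
  assumes u: "orthonormal m u" and K: "compact K" and h: "\<And>i. i \<in> I \<Longrightarrow> continuous_on UNIV (h i)"
  shows "(LINT x:K|leb m u. (\<Sum>i\<in>I. h i x)) = (\<Sum>i\<in>I. LINT x:K|leb m u. h i x)"
  using set_integrable_leb[OF u K h] unfolding set_lebesgue_integral_def set_integrable_def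
  by (simp add: sum_distrib_left)

lemma set_integral_leb_const:
  assumes u: "orthonormal m u" and K: "compact K"
  shows "(LINT x:K|leb m u. c) = c * measure (leb m u) K"
  using borel_of_compact[OF K] emeasure_leb_compact[OF u K]
  by (simp add: set_lebesgue_integral_def mult.commute)

lemma set_integral_leb_pos:
  fixes h :: "'a::{real_inner, second_countable_topology} \<Rightarrow> real"
  assumes u: "orthonormal m u" and K: "compact K" and h: "continuous_on UNIV h"
    and Q: "compact Q" "Q \<subseteq> K" "measure (leb m u) Q > 0"
    and nn: "\<And>x. x \<in> K \<Longrightarrow> 0 \<le> h x" and d: "d > 0" "\<And>x. x \<in> Q \<Longrightarrow> d \<le> h x"
  shows "(LINT x:K|leb m u. h x) > 0"
proof -
  have "0 < d * measure (leb m u) Q" using d Q by simp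
  also have "\<dots> = (LINT x:Q|leb m u. d)" using set_integral_leb_const[OF u Q(1)] by simp
  also have "\<dots> \<le> (LINT x:K|leb m u. h x)"
    unfolding set_lebesgue_integral_def
  proof (rule integral_mono)
    show "integrable (leb m u) (\<lambda>x. indicator Q x *\<^sub>R d)"
      using set_integrable_leb[OF u Q(1), of "\<lambda>_. d"] by (simp add: set_integrable_def)
    show "integrable (leb m u) (\<lambda>x. indicator K x *\<^sub>R h x)"
      using set_integrable_leb[OF u K h] by (simp add: set_integrable_def)
    show "indicator Q x *\<^sub>R d \<le> indicator K x *\<^sub>R h x" for x
      using Q d nn by (auto simp: indicator_def)
  qed
  finally show ?thesis .
qed

lemma AE_leb_span:
  assumes u: "orthonormal m u" shows "AE x in leb m u. x \<in> span (u ` {..<m})"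
proof -
  let ?N = "- span (u ` {..<m})"
  have N: "?N \<in> sets borel" using closed_span_orthonormal[OF u] by (simp add: borel_open open_Compl)
  have "emeasure (leb m u) ?N \<le> emeasure (leb m u) {}"
    using N by (intro emeasure_leb_mono) auto
  then have "?N \<in> null_sets (leb m u)" using N by (simp add: null_sets_def)
  then show ?thesis by (rule AE_I') auto
qed

lemma coord_eq_inner: "coord x i = x \<bullet> unit_vec i"
  using inner_fseq_superset[of "{i}" x "unit_vec i"] by simp

lemma barycenter_zero_imp:
  assumes K: "compact K" "K \<subseteq> euc n" "vol (euc n) K > 0" and u: "orthonormal n u" "span (u ` {..<n}) = euc n"
    and b: "barycenter n K = 0"
  shows "(LINT x:K|leb n u. x \<bullet> \<xi>) = 0"
proof -
  have cont: "continuous_on UNIV (\<lambda>x. coord x i)" for i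
    unfolding coord_eq_inner by (intro continuous_intros)
  have "(LINT x:K|leb n u. coord x j) = 0" if "j < n" for j
  proof -
    have "coord (barycenter n K) j = (LINT x:K|lebesgue_sub (euc n). coord x j) / vol (euc n) K"
      unfolding barycenter_def coord_comb_unit_vec using that by simp
    then have "(LINT x:K|lebesgue_sub (euc n). coord x j) = 0" using b K by simp
    then show ?thesis
      using set_integral_lebesgue_sub[OF u borel_of_compact[OF K(1)] borel_measurable_continuous_onI[OF cont]] by simp
  qed
  moreover have "x \<bullet> \<xi> = (\<Sum>j<n. coord \<xi> j * coord x j)" if "x \<in> K" for x
    using inner_fseq_superset[of "{..<n}" x \<xi>] that K by (auto simp: euc_def mult.commute)
  then have "(LINT x:K|leb n u. x \<bullet> \<xi>) = (LINT x:K|leb n u. (\<Sum>j<n. coord \<xi> j * coord x j))"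
    by (intro set_lebesgue_integral_cong) (use borel_of_compact[OF K(1)] in auto)
  then have "(LINT x:K|leb n u. x \<bullet> \<xi>) = (\<Sum>j<n. LINT x:K|leb n u. coord \<xi> j * coord x j)"
    using set_integral_leb_sum[OF u(1) K(1), of "{..<n}" "\<lambda>j x. coord \<xi> j * coord x j"]
      continuous_on_mult_left[OF cont] by simp
  ultimately show ?thesis by simp
qed

lemma convex_body_imp_ball:
  assumes "convex_body n K"
  obtains x0 r where "r > 0" "x0 \<in> euc n" "\<And>b. b \<in> unit_ball (euc n) \<Longrightarrow> x0 + r *\<^sub>R b \<in> K"
proof -
  obtain T x0 where T: "openin (top_of_set (euc n)) T" "x0 \<in> T" "T \<subseteq> K"
    using assms by (auto simp: convex_body_def interior_of_def)
  then obtain r where r: "r > 0" "cball x0 r \<inter> euc n \<subseteq> T" "x0 \<in> euc n"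
    by (meson openin_contains_cball subsetD)
  show ?thesis
  proof (rule that[OF r(1,3)])
    fix b assume "b \<in> unit_ball (euc n)"
    then have "x0 + r *\<^sub>R b \<in> cball x0 r \<inter> euc n"
      using r subspace_euc[of n] by (auto simp: unit_ball_eq dist_norm subspace_add subspace_scale mult_left_le)
    then show "x0 + r *\<^sub>R b \<in> K" using r T by auto
  qed
qed

lemma convex_body_of_ball:
  assumes K: "compact K" "convex K" "K \<subseteq> euc n" and r: "r > 0" "\<And>x. x \<in> euc n \<Longrightarrow> norm x \<le> r \<Longrightarrow> x \<in> K"
  shows "convex_body n K"
proof -
  have "openin (top_of_set (euc n)) (euc n \<inter> ball 0 r)" by (intro openin_open_Int) auto
  moreover have "0 \<in> euc n \<inter> ball 0 r" using r subspace_0[OF subspace_euc] by auto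
  moreover have "euc n \<inter> ball 0 r \<subseteq> K" using r by auto
  ultimately have "0 \<in> (top_of_set (euc n)) interior_of K" unfolding interior_of_def by blast
  then show ?thesis using K by (auto simp: convex_body_def)
qed

lemma measure_leb_small_ball:
  assumes u: "orthonormal n u" "span (u ` {..<n}) = E" and r: "r > 0" "c \<in> E"
  shows "compact ((\<lambda>b. r *\<^sub>R b + c) ` unit_ball E)" "measure (leb n u) ((\<lambda>b. r *\<^sub>R b + c) ` unit_ball E) > 0"
proof -
  have cB: "compact (unit_ball E)" by (rule compact_unit_ball[OF u])
  then show "compact ((\<lambda>b. r *\<^sub>R b + c) ` unit_ball E)"
    by (intro compact_continuous_image continuous_intros)
  show "measure (leb n u) ((\<lambda>b. r *\<^sub>R b + c) ` unit_ball E) > 0"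
    using measure_leb_affine[OF u(1) r(1) _ cB, of c] r u measure_unit_ball[OF u] omega_pos[of n] by simp
qed

text \<open>If the origin were not interior, a linear functional would be nonnegative on the body and
  positive on a small ball inside it, so it could not have mean zero.\<close>

lemma barycenter_interior:
  assumes cb: "convex_body n K" and b: "barycenter n K = 0" and n: "n \<ge> 1"
  obtains r where "r > 0" "\<And>b. b \<in> unit_ball (euc n) \<Longrightarrow> r *\<^sub>R b \<in> K"
proof -
  let ?B = "unit_ball (euc n)"
  have K: "compact K" "convex K" "K \<subseteq> euc n" using cb by (auto simp: convex_body_def)
  note u = orthonormal_unit_vec[of n] span_unit_vec[of n]
  obtain x0 r0 where r0: "r0 > 0" "x0 \<in> euc n" "\<And>b. b \<in> ?B \<Longrightarrow> x0 + r0 *\<^sub>R b \<in> K"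
    using convex_body_imp_ball[OF cb] by blast
  have vpos: "vol (euc n) K > 0" by (rule surface_area_bounds(1)[OF u n K r0])
  have B0: "0 \<in> ?B" using subspace_0[OF subspace_euc] by (simp add: unit_ball_eq)
  define C where "C = {x \<in> K. \<exists>e>0. \<forall>b\<in>?B. x + e *\<^sub>R b \<in> K}"
  have segC: "(1 - t) *\<^sub>R x + t *\<^sub>R c \<in> C" if "x \<in> K" "c \<in> C" "0 < t" "t \<le> 1" for x c t
  proof -
    obtain e where e: "e > 0" "\<And>b. b \<in> ?B \<Longrightarrow> c + e *\<^sub>R b \<in> K"
      using \<open>c \<in> C\<close> by (auto simp: C_def)
    have "(1 - t) *\<^sub>R x + t *\<^sub>R c + (t * e) *\<^sub>R b \<in> K" if b: "b \<in> ?B" for b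
    proof -
      have "(1 - t) *\<^sub>R x + t *\<^sub>R (c + e *\<^sub>R b) \<in> K"
        using e(2)[OF b] that K(2) \<open>x \<in> K\<close> \<open>0 < t\<close> \<open>t \<le> 1\<close> by (simp add: convex_alt)
      then show ?thesis by (simp add: algebra_simps)
    qed
    moreover have "(1 - t) *\<^sub>R x + t *\<^sub>R c \<in> K"
      using that K(2) by (simp add: convex_alt C_def)
    moreover have "t * e > 0" using that e by simp
    ultimately show ?thesis unfolding C_def by blast
  qed
  have "convex C"
    unfolding convex_alt
  proof (intro ballI allI impI)
    fix x y t assume *: "x \<in> C" "y \<in> C" "0 \<le> t \<and> t \<le> (1::real)"
    then show "(1 - t) *\<^sub>R x + t *\<^sub>R y \<in> C"
      using segC[of x y t] by (cases "t = 0") (auto simp: C_def)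
  qed
  have x0C: "x0 \<in> C" unfolding C_def using r0(3)[OF B0] r0 by auto
  have "0 \<in> C"
  proof (rule ccontr)
    assume "0 \<notin> C"
    moreover have "C \<subseteq> span (unit_vec ` {..<n})" using K by (auto simp: C_def span_unit_vec)
    ultimately obtain v where v: "v \<in> euc n" "norm v = 1" "\<And>x. x \<in> C \<Longrightarrow> 0 \<le> v \<bullet> x"
      using separate_from_origin[OF u(1) _ \<open>convex C\<close>] x0C unfolding u(2) by blast
    have vK: "0 \<le> v \<bullet> x" if x: "x \<in> K" for x
    proof (rule ccontr)
      assume neg: "\<not> 0 \<le> v \<bullet> x"
      define D where "D = v \<bullet> x0 - v \<bullet> x"
      have D: "D > 0" "D \<ge> - (v \<bullet> x)" using neg v(3)[OF x0C] by (auto simp: D_def)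
      \<comment> \<open>At this point of the segment from \<open>x\<close> to \<open>x0\<close> the functional has value \<open>v \<bullet> x / 2\<close>.\<close>
      define t where "t = - (v \<bullet> x) / (2 * D)"
      have t: "0 < t" "t \<le> 1" using D neg by (auto simp: t_def field_simps)
      have "0 \<le> v \<bullet> ((1 - t) *\<^sub>R x + t *\<^sub>R x0)" by (rule v(3)[OF segC[OF x x0C t]])
      also have "\<dots> = v \<bullet> x + t * D" by (simp add: D_def inner_add_right algebra_simps)
      also have "\<dots> = v \<bullet> x / 2" using D by (simp add: t_def field_simps)
      finally show False using neg by simp
    qed
    \<comment> \<open>A ball inside the ball of radius \<open>r0\<close> about \<open>x0\<close>, moved off the hyperplane through \<open>x0\<close>.\<close>
    let ?Q = "(\<lambda>b. (r0 / 4) *\<^sub>R b + (x0 + (r0 / 2) *\<^sub>R v)) ` ?B"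
    have c: "x0 + (r0 / 2) *\<^sub>R v \<in> euc n" using r0 v subspace_euc by (simp add: subspace_add subspace_scale)
    have QK: "?Q \<subseteq> K"
    proof clarify
      fix b assume b: "b \<in> ?B"
      have "norm ((1/4) *\<^sub>R b + (1/2) *\<^sub>R v) \<le> norm ((1/4) *\<^sub>R b) + norm ((1/2) *\<^sub>R v)"
        by (rule norm_triangle_ineq)
      then have "(1/4) *\<^sub>R b + (1/2) *\<^sub>R v \<in> ?B"
        using b v subspace_euc[of n] by (simp add: unit_ball_eq subspace_add subspace_scale)
      from r0(3)[OF this] show "(r0 / 4) *\<^sub>R b + (x0 + (r0 / 2) *\<^sub>R v) \<in> K"
        by (simp add: algebra_simps)
    qed
    have Qge: "r0 / 4 \<le> x \<bullet> v" if "x \<in> ?Q" for x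
    proof -
      obtain b where b: "b \<in> ?B" "x = (r0 / 4) *\<^sub>R b + (x0 + (r0 / 2) *\<^sub>R v)" using \<open>x \<in> ?Q\<close> by auto
      have "\<bar>b \<bullet> v\<bar> \<le> 1" using Cauchy_Schwarz_ineq2[of b v] b v by (simp add: unit_ball_eq)
      then have "(r0 / 4) * (b \<bullet> v) \<ge> (r0 / 4) * (- 1)" using r0 by (intro mult_left_mono) auto
      moreover have "v \<bullet> v = 1" using v by (simp add: norm_eq_1)
      moreover have "x \<bullet> v = (r0 / 4) * (b \<bullet> v) + (v \<bullet> x0 + (r0 / 2) * (v \<bullet> v))"
        by (simp add: b(2) inner_add_left inner_commute[of x0])
      ultimately show ?thesis using v(3)[OF x0C] by simp
    qed
    have "(LINT x:K|leb n unit_vec. x \<bullet> v) > 0"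
      using measure_leb_small_ball[OF u _ c, of "r0 / 4"] r0 vK Qge QK K
      by (intro set_integral_leb_pos[where Q = ?Q and d = "r0 / 4"] u)
        (auto simp: inner_commute intro!: continuous_intros)
    then show False using barycenter_zero_imp[OF K(1,3) vpos u b, of v] by simp
  qed
  then show ?thesis using that by (auto simp: C_def)
qed

section \<open>Central sections of isotropic bodies\<close>

text \<open>The tangent to the concave function \<open>ln g\<close> at the origin, obtained by separating \<open>(0, 0)\<close> from
  the strict hypograph of \<open>ln g - ln (g 0)\<close>. The separating hyperplane is not vertical because \<open>g\<close>
  is positive on a whole neighbourhood of the origin.\<close>

lemma log_concave_exponential_bound:
  fixes g :: "'a::real_inner \<Rightarrow> real"
  assumes w: "orthonormal k w" and g0: "\<And>y. 0 \<le> g y"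
    and lc: "\<And>x y l. 0 < l \<Longrightarrow> l < 1 \<Longrightarrow> g x powr (1 - l) * g y powr l \<le> g ((1 - l) *\<^sub>R x + l *\<^sub>R y)"
    and r: "r > 0" "\<And>y. y \<in> span (w ` {..<k}) \<Longrightarrow> norm y \<le> r \<Longrightarrow> g y > 0"
  obtains v where "v \<in> span (w ` {..<k})" "\<And>y. y \<in> span (w ` {..<k}) \<Longrightarrow> g y \<le> g 0 * exp (v \<bullet> y)"
proof -
  let ?E = "span (w ` {..<k})"
  have g00: "g 0 > 0" using r by (auto simp: span_zero)
  define C where "C = {(y, s). y \<in> ?E \<and> g y > 0 \<and> s < ln (g y) - ln (g 0)}"
  define e where "e i = (if i < k then (w i, 0) else (0, 1::real))" for i
  have e: "orthonormal (Suc k) e"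
    using w by (auto simp: orthonormal_def e_def less_Suc_eq)
  have comb: "(\<Sum>i<Suc k. d i *\<^sub>R e i) = ((\<Sum>i<k. d i *\<^sub>R w i), d k)" for d
    by (rule prod_eqI) (simp_all add: fst_sum snd_sum e_def)
  have "C \<subseteq> span (e ` {..<Suc k})"
  proof
    fix p assume "p \<in> C"
    then obtain y s where p: "p = (y, s)" "y \<in> ?E" by (auto simp: C_def)
    have "p = (\<Sum>i<Suc k. (if i < k then y \<bullet> w i else s) *\<^sub>R e i)"
      unfolding comb using span_expand[OF w p(2)] by (simp add: p)
    then show "p \<in> span (e ` {..<Suc k})" using comb_in_span by metis
  qed
  moreover have "convex C"
    unfolding convex_alt
  proof (intro ballI allI impI)
    fix p q and l :: real assume *: "p \<in> C" "q \<in> C" "0 \<le> l \<and> l \<le> 1"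
    show "(1 - l) *\<^sub>R p + l *\<^sub>R q \<in> C"
    proof (cases "l = 0 \<or> l = 1")
      case False
      then have l: "0 < l" "l < 1" using * by auto
      obtain x s y t where xy: "p = (x, s)" "q = (y, t)" "x \<in> ?E" "y \<in> ?E" "g x > 0" "g y > 0"
        "s < ln (g x) - ln (g 0)" "t < ln (g y) - ln (g 0)"
        using * by (auto simp: C_def)
      let ?z = "(1 - l) *\<^sub>R x + l *\<^sub>R y"
      have lcz: "g x powr (1 - l) * g y powr l \<le> g ?z" by (rule lc[OF l])
      moreover have pos: "0 < g x powr (1 - l) * g y powr l" using xy by simp
      ultimately have "g ?z > 0" by linarith
      have "(1 - l) * ln (g x) + l * ln (g y) = ln (g x powr (1 - l) * g y powr l)"
        using xy by (simp add: ln_mult ln_powr)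
      also have "\<dots> \<le> ln (g ?z)" using lcz pos \<open>g ?z > 0\<close> by simp
      finally have "(1 - l) * ln (g x) + l * ln (g y) \<le> ln (g ?z)" .
      moreover have "(1 - l) * s + l * t < (1 - l) * (ln (g x) - ln (g 0)) + l * (ln (g y) - ln (g 0))"
        using xy l by (intro add_strict_mono mult_strict_left_mono) auto
      ultimately have "(1 - l) * s + l * t < ln (g ?z) - ln (g 0)" by (simp add: algebra_simps)
      moreover have "?z \<in> ?E" using xy by (intro span_add span_scale)
      ultimately show ?thesis using \<open>g ?z > 0\<close> by (simp add: xy C_def)
    qed (use * in auto)
  qed
  moreover have "0 \<notin> C" by (simp add: C_def zero_prod_def)
  moreover have "(0, -1) \<in> C" using g00 by (simp add: C_def span_zero)
  ultimately obtain p where p: "p \<in> span (e ` {..<Suc k})" "norm p = 1" "\<And>x. x \<in> C \<Longrightarrow> 0 \<le> p \<bullet> x"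
    using separate_from_origin[OF e, of C] by blast
  define v where "v = fst p"
  define \<alpha> where "\<alpha> = snd p"
  have vE: "v \<in> ?E"
    unfolding v_def using span_expand[OF e p(1)] comb_in_span[of _ w k] unfolding comb by (metis fst_conv)
  have sep: "0 \<le> v \<bullet> y + \<alpha> * s" if "y \<in> ?E" "g y > 0" "s < ln (g y) - ln (g 0)" for y s
    using p(3)[of "(y, s)"] that by (simp add: C_def v_def \<alpha>_def inner_prod_def)
  have "\<alpha> \<le> 0" using sep[of 0 "-1"] g00 by (simp add: span_zero)
  moreover have "\<alpha> \<noteq> 0"
  proof
    assume a0: "\<alpha> = 0"
    have "(norm v)\<^sup>2 = 1" using p(2) a0 by (simp add: v_def \<alpha>_def norm_prod_def)
    then have "norm v = 1" by (intro power2_eq_imp_eq[of "norm v" 1]) auto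
    have "- r *\<^sub>R v \<in> ?E" using vE by (intro span_scale)
    moreover have "g (- r *\<^sub>R v) > 0" using vE \<open>norm v = 1\<close> r by (intro r(2) span_scale) auto
    ultimately have "0 \<le> v \<bullet> (- r *\<^sub>R v)"
      using sep[of "- r *\<^sub>R v" "ln (g (- r *\<^sub>R v)) - ln (g 0) - 1"] a0 by simp
    then show False using r \<open>norm v = 1\<close> by (simp add: norm_eq_1)
  qed
  ultimately have a: "- \<alpha> > 0" by simp
  show ?thesis
  proof
    show "(1 / - \<alpha>) *\<^sub>R v \<in> ?E" using vE by (intro span_scale)
    fix y assume y: "y \<in> ?E"
    show "g y \<le> g 0 * exp ((1 / - \<alpha>) *\<^sub>R v \<bullet> y)"
    proof (cases "g y > 0")
      case True
      have "ln (g y) - ln (g 0) \<le> (v \<bullet> y) / - \<alpha>"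
      proof (rule dense_le)
        fix s assume "s < ln (g y) - ln (g 0)"
        from sep[OF y True this] show "s \<le> (v \<bullet> y) / - \<alpha>" using a by (simp add: field_simps)
      qed
      then have "ln (g y) \<le> ln (g 0) + (1 / - \<alpha>) *\<^sub>R v \<bullet> y" by simp
      then have "exp (ln (g y)) \<le> exp (ln (g 0) + (1 / - \<alpha>) *\<^sub>R v \<bullet> y)" by (simp only: exp_le_cancel_iff)
      then show ?thesis by (simp only: exp_add exp_ln[OF True] exp_ln[OF g00])
    next
      case False
      then show ?thesis using g0[of y] g0[of 0] by simp
    qed
  qed
qed

lemma nn_integral_gaussian:
  assumes w: "orthonormal k w" and L: "L > 0"
  shows "(\<integral>\<^sup>+y. ennreal (\<Prod>i<k. normal_density 0 L (y \<bullet> w i)) \<partial>leb k w) = 1"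
proof -
  have [measurable]: "(\<lambda>y. y \<bullet> w i) \<in> borel_measurable borel" for i
    by (intro borel_measurable_continuous_onI continuous_intros)
  have "(\<integral>\<^sup>+y. ennreal (\<Prod>i<k. normal_density 0 L (y \<bullet> w i)) \<partial>leb k w)
      = (\<integral>\<^sup>+c. ennreal (\<Prod>i<k. normal_density 0 L ((\<Sum>j<k. c j *\<^sub>R w j) \<bullet> w i)) \<partial>(\<Pi>\<^sub>M i\<in>{..<k}. lborel))"
    by (rule nn_integral_leb) measurable
  also have "\<dots> = (\<integral>\<^sup>+c. (\<Prod>i<k. ennreal (normal_density 0 L (c i))) \<partial>(\<Pi>\<^sub>M i\<in>{..<k}. lborel))"
    using comb_inner[OF w] by (simp add: prod_ennreal)
  also have "\<dots> = (\<Prod>i<k. (\<integral>\<^sup>+t. ennreal (normal_density 0 L t) \<partial>lborel))"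
    by (rule lborels.product_nn_integral_prod) auto
  also have "(\<integral>\<^sup>+t. ennreal (normal_density 0 L t) \<partial>lborel) = 1"
    using integral_normal_density[OF L] integrable_normal_density[OF L]
    by (subst nn_integral_eq_integral) auto
  finally show ?thesis by simp
qed

text \<open>Let \<open>g\<close> be the volume of the sections parallel to \<open>F\<close>, a log-concave density with mean zero
  and covariance \<open>L\<^sup>2\<close> on the complement of \<open>F\<close>. Log-concavity gives \<open>g(y) \<le> g(0) exp(v \<bullet> y)\<close> for
  some \<open>v\<close>. Comparing with the Gaussian density \<open>\<gamma>\<close> of the same covariance, the inequality
  \<open>ln t \<le> t - 1\<close> for \<open>t = \<gamma>(y) / (g(0) exp(v \<bullet> y))\<close> integrates against \<open>g\<close> to a nonpositive
  quantity; on the left the linear term vanishes and what remains is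
  \<open>- ln g(0) - k ln (sqrt (2 \<pi> e) L)\<close>.\<close>

lemma isotropic_central_section:
  fixes u :: "nat \<Rightarrow> 'a::{real_inner, second_countable_topology}"
  assumes u: "orthonormal (m + k) u" and K: "compact K" "convex K"
    and ball: "r > 0" "\<And>x. x \<in> span (u ` {..<m + k}) \<Longrightarrow> norm x \<le> r \<Longrightarrow> x \<in> K"
    and vol1: "measure (leb (m + k) u) K = 1"
    and mean: "\<And>\<xi>. (LINT x:K|leb (m + k) u. x \<bullet> \<xi>) = 0"
    and cov: "\<And>i. i < m + k \<Longrightarrow> (LINT x:K|leb (m + k) u. (x \<bullet> u i)\<^sup>2) = L\<^sup>2" and L: "L > 0"
  shows "(1 / (sqrt (2 * pi * exp 1) * L)) ^ k \<le> measure (leb m u) K"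
proof -
  define w where "w i = u (m + i)" for i
  let ?F = "span (u ` {..<m})"
  let ?E = "span (w ` {..<k})"
  have uF: "orthonormal m u" by (rule orthonormal_mono[OF u]) simp
  have w: "orthonormal k w" using u by (simp add: orthonormal_def w_def)
  have FE: "?F \<subseteq> span (u ` {..<m + k})" "?E \<subseteq> span (u ` {..<m + k})"
    by (auto simp: w_def intro!: span_mono)
  have orthF: "x \<bullet> w i = 0" if "x \<in> ?F" "i < k" for x i
  proof -
    have "x \<bullet> w i = (\<Sum>j<m. (x \<bullet> u j) *\<^sub>R u j) \<bullet> w i" using span_expand[OF uF that(1)] by simp
    also have "\<dots> = 0" using u that by (auto simp: inner_sum_left orthonormal_def w_def)
    finally show ?thesis .
  qed
  have orthE: "v \<bullet> x = 0" if "v \<in> ?E" "x \<in> ?F" for v x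
  proof -
    have "x \<bullet> v = x \<bullet> (\<Sum>j<k. (v \<bullet> w j) *\<^sub>R w j)" using span_expand[OF w that(1)] by simp
    also have "\<dots> = 0" using orthF[OF that(2)] by (simp add: inner_sum_right)
    finally show ?thesis by (simp add: inner_commute)
  qed
  define g where "g y = measure (leb m u) (slice K y)" for y
  have emg: "emeasure (leb m u) (slice K y) = ennreal (g y)" for y
    unfolding g_def by (rule emeasure_leb_compact[OF uF compact_slice[OF K(1)]])
  have gpos: "g y > 0" if y: "y \<in> ?E" "norm y \<le> r / 2" for y
  proof -
    have sub: "cball 0 (r / 2) \<inter> ?F \<subseteq> slice K y"
    proof
      fix x assume x: "x \<in> cball 0 (r / 2) \<inter> ?F"
      then have "norm (x + y) \<le> r" using y norm_triangle_ineq[of x y] by simp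
      moreover have "x + y \<in> span (u ` {..<m + k})"
        using x y FE by (auto intro!: span_add)
      ultimately show "x \<in> slice K y" using ball by (simp add: slice_def)
    qed
    have "0 < emeasure (leb m u) (cball 0 (r / 2))"
      using ball by (intro emeasure_leb_ball_pos[OF uF]) simp
    also have "\<dots> \<le> emeasure (leb m u) (slice K y)"
      using sub borel_of_compact[OF compact_slice[OF K(1)]] by (intro emeasure_leb_mono) auto
    finally show ?thesis by (simp add: emg)
  qed
  obtain v where v: "v \<in> ?E" "\<And>y. y \<in> ?E \<Longrightarrow> g y \<le> g 0 * exp (v \<bullet> y)"
  proof (rule log_concave_exponential_bound[OF w, of g "r / 2"])
    show "g x powr (1 - l) * g y powr l \<le> g ((1 - l) *\<^sub>R x + l *\<^sub>R y)" if "0 < l" "l < 1" for x y l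
      unfolding g_def using that K
      by (intro brunn_minkowski_multiplicative[OF uF] compact_slice convex_slice combine_slices
          combine_sets_subset_convex) auto
  qed (use gpos ball in \<open>auto simp: g_def\<close>)
  have g0: "g 0 > 0" using ball by (intro gpos) (auto simp: span_zero)
  define c where "c = ln (sqrt (2 * pi * L\<^sup>2))"
  \<comment> \<open>\<open>\<Phi>\<close> is \<open>ln t\<close>, as a function on the whole space that is constant along \<open>F\<close>.\<close>
  define \<Phi> where "\<Phi> x = (\<Sum>i<k. - (1 / (2 * L\<^sup>2)) * (x \<bullet> w i)\<^sup>2 - c) - ln (g 0) - v \<bullet> x" for x
  have cont: "continuous_on UNIV \<Phi>" unfolding \<Phi>_def by (intro continuous_intros)
  have [measurable]: "\<Phi> \<in> borel_measurable borel" by (rule borel_measurable_continuous_onI[OF cont])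
  have [measurable]: "K \<in> sets borel" by (rule borel_of_compact[OF K(1)])
  have gauss: "exp (\<Phi> y) * (g 0 * exp (v \<bullet> y)) = (\<Prod>i<k. normal_density 0 L (y \<bullet> w i))" for y
  proof -
    have "exp (\<Phi> y) * (g 0 * exp (v \<bullet> y)) = exp (\<Phi> y) * (exp (ln (g 0)) * exp (v \<bullet> y))" using g0 by simp
    also have "\<dots> = exp (\<Sum>i<k. - (1 / (2 * L\<^sup>2)) * (y \<bullet> w i)\<^sup>2 - c)"
      unfolding exp_add[symmetric] by (simp add: \<Phi>_def)
    also have "\<dots> = (\<Prod>i<k. exp (- (1 / (2 * L\<^sup>2)) * (y \<bullet> w i)\<^sup>2 - c))" by (simp add: exp_sum)
    also have "\<dots> = (\<Prod>i<k. normal_density 0 L (y \<bullet> w i))"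
      using L by (intro prod.cong) (auto simp: normal_density_def exp_diff c_def)
    finally show ?thesis .
  qed
  have \<Phi>add: "\<Phi> (x + y) = \<Phi> y" if "x \<in> ?F" for x y
    using orthF[OF that] orthE[OF v(1) that] by (simp add: \<Phi>_def inner_add_left inner_add_right)
  have "(\<integral>\<^sup>+x. indicator K x * ennreal (exp (\<Phi> x)) \<partial>leb (m + k) u)
      = (\<integral>\<^sup>+y. \<integral>\<^sup>+x. indicator K (x + y) * ennreal (exp (\<Phi> (x + y))) \<partial>leb m u \<partial>leb k w)"
    unfolding w_def by (rule nn_integral_leb_add) measurable
  also have "\<dots> \<le> (\<integral>\<^sup>+y. ennreal (\<Prod>i<k. normal_density 0 L (y \<bullet> w i)) \<partial>leb k w)"
  proof (rule nn_integral_leb_mono)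
    show "(\<lambda>y. \<integral>\<^sup>+x. indicator K (x + y) * ennreal (exp (\<Phi> (x + y))) \<partial>leb m u) \<in> borel_measurable borel"
      by (rule measurable_nn_integral_leb) measurable
    have [measurable]: "(\<lambda>y. y \<bullet> w i) \<in> borel_measurable borel" for i
      by (intro borel_measurable_continuous_onI continuous_intros)
    show "(\<lambda>y. ennreal (\<Prod>i<k. normal_density 0 L (y \<bullet> w i))) \<in> borel_measurable borel"
      by measurable
    fix y assume y: "y \<in> ?E"
    have "(\<integral>\<^sup>+x. indicator K (x + y) * ennreal (exp (\<Phi> (x + y))) \<partial>leb m u)
        = (\<integral>\<^sup>+x. indicator (slice K y) x * ennreal (exp (\<Phi> y)) \<partial>leb m u)"
    proof (rule nn_integral_leb_cong)
      show "(\<lambda>x. indicator (slice K y) x * ennreal (exp (\<Phi> y))) \<in> borel_measurable borel"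
        using borel_of_compact[OF compact_slice[OF K(1)]] by measurable
    qed (measurable, auto simp: \<Phi>add indicator_def slice_def)
    also have "\<dots> = ennreal (g y) * ennreal (exp (\<Phi> y))"
      using borel_of_compact[OF compact_slice[OF K(1)], of y] by (simp add: nn_integral_multc emg)
    also have "\<dots> \<le> ennreal (g 0 * exp (v \<bullet> y)) * ennreal (exp (\<Phi> y))"
      using v(2)[OF y] by (intro mult_right_mono ennreal_leI) auto
    also have "\<dots> = ennreal (\<Prod>i<k. normal_density 0 L (y \<bullet> w i))"
      using g0 unfolding gauss[symmetric] by (simp add: ennreal_mult[symmetric] mult_ac)
    finally show "(\<integral>\<^sup>+x. indicator K (x + y) * ennreal (exp (\<Phi> (x + y))) \<partial>leb m u)
        \<le> ennreal (\<Prod>i<k. normal_density 0 L (y \<bullet> w i))" .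
  qed
  also have "\<dots> = 1" by (rule nn_integral_gaussian[OF w L])
  finally have le1: "(\<integral>\<^sup>+x. indicator K x * ennreal (exp (\<Phi> x)) \<partial>leb (m + k) u) \<le> 1" .
  have cexp: "continuous_on UNIV (\<lambda>x. exp (\<Phi> x))" using cont by (intro continuous_intros)
  have "ennreal (LINT x:K|leb (m + k) u. exp (\<Phi> x)) = (\<integral>\<^sup>+x. indicator K x * ennreal (exp (\<Phi> x)) \<partial>leb (m + k) u)"
    using set_integrable_leb[OF u K(1) cexp] unfolding set_lebesgue_integral_def set_integrable_def
    by (subst nn_integral_eq_integral[symmetric]) (auto simp: indicator_def intro!: nn_integral_cong)
  then have "ennreal (LINT x:K|leb (m + k) u. exp (\<Phi> x)) \<le> 1"
    using le1 by (simp only:)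
  then have "(LINT x:K|leb (m + k) u. exp (\<Phi> x)) \<le> 1"
    by (simp only: ennreal_le_1)
  moreover have "(LINT x:K|leb (m + k) u. exp (\<Phi> x) - 1) = (LINT x:K|leb (m + k) u. exp (\<Phi> x)) - 1"
    using set_integral_diff(2)[OF set_integrable_leb[OF u K(1) cexp] set_integrable_leb[OF u K(1), of "\<lambda>_. 1"]]
      set_integral_leb_const[OF u K(1), of 1] vol1 by simp
  moreover have "(LINT x:K|leb (m + k) u. \<Phi> x) \<le> (LINT x:K|leb (m + k) u. exp (\<Phi> x) - 1)"
  proof (rule set_integral_mono)
    show "\<Phi> x \<le> exp (\<Phi> x) - 1" for x using exp_ge_add_one_self[of "\<Phi> x"] by linarith
  qed (intro set_integrable_leb u K cont continuous_intros)+
  ultimately have neg: "(LINT x:K|leb (m + k) u. \<Phi> x) \<le> 0" by linarith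
  have ints: "set_integrable (leb (m + k) u) K (\<lambda>x. \<Sum>i<k. - (1 / (2 * L\<^sup>2)) * (x \<bullet> w i)\<^sup>2 - c)"
    "set_integrable (leb (m + k) u) K (\<lambda>x. (\<Sum>i<k. - (1 / (2 * L\<^sup>2)) * (x \<bullet> w i)\<^sup>2 - c) - ln (g 0))"
    "set_integrable (leb (m + k) u) K (\<lambda>x. v \<bullet> x)" "set_integrable (leb (m + k) u) K (\<lambda>x. ln (g 0))"
    by (intro set_integrable_leb u K continuous_intros)+
  have quad: "(LINT x:K|leb (m + k) u. - (1 / (2 * L\<^sup>2)) * (x \<bullet> w i)\<^sup>2 - c) = - 1 / 2 - c" if "i < k" for i
  proof -
    have "(LINT x:K|leb (m + k) u. - (1 / (2 * L\<^sup>2)) * (x \<bullet> w i)\<^sup>2 - c)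
      = (LINT x:K|leb (m + k) u. - (1 / (2 * L\<^sup>2)) * (x \<bullet> w i)\<^sup>2) - (LINT x:K|leb (m + k) u. c)"
      by (intro set_integral_diff set_integrable_leb u K continuous_intros)
    also have "(LINT x:K|leb (m + k) u. - (1 / (2 * L\<^sup>2)) * (x \<bullet> w i)\<^sup>2)
        = - (1 / (2 * L\<^sup>2)) * (LINT x:K|leb (m + k) u. (x \<bullet> w i)\<^sup>2)"
      by (rule set_integral_mult_right)
    finally show ?thesis using cov[of "m + i"] that L set_integral_leb_const[OF u K(1), of c] vol1
      by (simp add: w_def)
  qed
  have "(LINT x:K|leb (m + k) u. \<Phi> x)
     = (LINT x:K|leb (m + k) u. (\<Sum>i<k. - (1 / (2 * L\<^sup>2)) * (x \<bullet> w i)\<^sup>2 - c))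
        - (LINT x:K|leb (m + k) u. ln (g 0)) - (LINT x:K|leb (m + k) u. v \<bullet> x)"
    unfolding \<Phi>_def using ints by simp
  also have "(LINT x:K|leb (m + k) u. (\<Sum>i<k. - (1 / (2 * L\<^sup>2)) * (x \<bullet> w i)\<^sup>2 - c))
      = (\<Sum>i<k. LINT x:K|leb (m + k) u. - (1 / (2 * L\<^sup>2)) * (x \<bullet> w i)\<^sup>2 - c)"
    by (intro set_integral_leb_sum u K continuous_intros)
  also have "\<dots> = real k * (- 1 / 2 - c)" using quad by simp
  finally have "real k * (- 1 / 2 - c) - ln (g 0) \<le> 0"
    using neg mean[of v] set_integral_leb_const[OF u K(1), of "ln (g 0)"] vol1 by (simp add: inner_commute)
  then have "exp (real k * (- 1 / 2 - c)) \<le> g 0" using g0 by (simp add: ln_ge_iff[symmetric])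
  moreover have "exp (real k * (- 1 / 2 - c)) = (1 / (sqrt (2 * pi * exp 1) * L)) ^ k"
  proof -
    have "exp c = sqrt (2 * pi) * L" using L by (simp add: c_def real_sqrt_mult)
    moreover have "exp (1 / 2 :: real) = sqrt (exp 1)"
      by (rule real_sqrt_unique[symmetric]) (auto simp: power2_eq_square exp_add[symmetric])
    moreover have "exp (- 1 / 2 - c) * (exp (1 / 2) * exp c) = 1"
      unfolding exp_add[symmetric] by simp
    then have "exp (- 1 / 2 - c) = 1 / (exp (1 / 2) * exp c)" by (simp add: eq_divide_eq)
    ultimately have "exp (- 1 / 2 - c) = 1 / (sqrt (2 * pi * exp 1) * L)"
      by (simp add: real_sqrt_mult mult_ac)
    then show ?thesis by (simp add: exp_of_nat_mult)
  qed
  moreover have "g 0 = measure (leb m u) K" by (simp add: g_def slice_def)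
  ultimately show ?thesis by simp
qed

section \<open>Linear images\<close>

lemma leb_cong: "(\<And>i. i < m \<Longrightarrow> u i = v i) \<Longrightarrow> leb m u = leb m v"
  unfolding leb_def by (intro arg_cong[where f = "distr _ _"] ext sum.cong) auto

lemma leb_affine_image:
  fixes u v :: "nat \<Rightarrow> 'a::{real_inner, second_countable_topology}"
  assumes T: "bounded_linear T" and Tu: "\<And>i. i < m \<Longrightarrow> T (u i) = s i *\<^sub>R v i" "\<And>i. i < m \<Longrightarrow> s i > 0"
    and a: "a \<in> span (v ` {..<m})"
  shows "leb m v = density (distr (leb m u) borel (\<lambda>x. T x + a)) (\<lambda>_. ennreal (\<Prod>i<m. s i))"
proof (rule measure_eqI)
  have [measurable]: "(\<lambda>x. T x + a) \<in> borel_measurable borel"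
    using T by (intro borel_measurable_continuous_onI continuous_intros linear_continuous_on)
  fix B assume "B \<in> sets (leb m v)"
  then have [measurable]: "B \<in> sets borel" by simp
  have s0: "s i \<noteq> 0" if "i < m" for i using Tu(2)[OF that] by simp
  have "emeasure (leb m v) B = (\<integral>\<^sup>+x. indicator B (x + a) \<partial>leb m v)"
    using a by (subst nn_integral_leb_translate) auto
  also have "\<dots> = ennreal (\<Prod>i<m. \<bar>s i\<bar>) * (\<integral>\<^sup>+x. indicator B (x + a) \<partial>leb m (\<lambda>i. s i *\<^sub>R v i))"
    by (rule nn_integral_leb_scale) (measurable, rule s0)
  also have "leb m (\<lambda>i. s i *\<^sub>R v i) = leb m (\<lambda>i. T (u i))" using Tu(1) by (intro leb_cong) simp
  also have "(\<integral>\<^sup>+x. indicator B (x + a) \<partial>leb m (\<lambda>i. T (u i))) = (\<integral>\<^sup>+x. indicator B (T x + a) \<partial>leb m u)"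
    by (rule nn_integral_leb_linear[OF T]) measurable
  also have "\<dots> = (\<integral>\<^sup>+x. indicator ((\<lambda>x. T x + a) -` B) x \<partial>leb m u)"
    by (intro nn_integral_cong) (auto simp: indicator_def)
  also have "\<dots> = emeasure (distr (leb m u) borel (\<lambda>x. T x + a)) B"
    using measurable_sets_borel[OF \<open>(\<lambda>x. T x + a) \<in> _\<close> \<open>B \<in> sets borel\<close>] by (subst emeasure_distr) auto
  also have "(\<Prod>i<m. \<bar>s i\<bar>) = (\<Prod>i<m. s i)" using Tu(2) by (intro prod.cong) (auto simp: less_imp_le)
  finally show "emeasure (leb m v) B
    = emeasure (density (distr (leb m u) borel (\<lambda>x. T x + a)) (\<lambda>_. ennreal (\<Prod>i<m. s i))) B"
    by (simp add: emeasure_density_const)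
qed simp

lemma set_integral_affine_image:
  fixes u v :: "nat \<Rightarrow> 'a::{real_inner, second_countable_topology}" and h :: "'a \<Rightarrow> real"
  assumes u: "orthonormal m u" and T: "bounded_linear T"
    and Tu: "\<And>i. i < m \<Longrightarrow> T (u i) = s i *\<^sub>R v i" "\<And>i. i < m \<Longrightarrow> s i > 0"
    and a: "a \<in> span (v ` {..<m})" and inj: "inj_on T W" "span (u ` {..<m}) \<subseteq> W"
    and K: "compact K" "K \<subseteq> W" and h: "continuous_on UNIV h"
  shows "(LINT y:(\<lambda>x. T x + a) ` K|leb m v. h y) = (\<Prod>i<m. s i) * (LINT x:K|leb m u. h (T x + a))"
proof -
  let ?A = "\<lambda>x. T x + a"
  let ?P = "\<Prod>i<m. s i"
  have contA: "continuous_on UNIV ?A" using T by (intro continuous_intros linear_continuous_on)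
  have [measurable]: "?A \<in> borel_measurable borel" by (rule borel_measurable_continuous_onI[OF contA])
  have "compact (?A ` K)" using K by (intro compact_continuous_image continuous_on_subset[OF contA]) auto
  then have [measurable]: "?A ` K \<in> sets borel" by (rule borel_of_compact)
  have [measurable]: "h \<in> borel_measurable borel" by (rule borel_measurable_continuous_onI[OF h])
  have [measurable]: "K \<in> sets borel" by (rule borel_of_compact[OF K(1)])
  have P: "?P \<ge> 0" using Tu(2) by (intro prod_nonneg) (auto simp: less_imp_le)
  have injA: "inj_on ?A W" using inj(1) by (simp add: inj_on_def)
  have eq: "leb m v = density (distr (leb m u) borel ?A) (\<lambda>_. ennreal ?P)"
    by (rule leb_affine_image[OF T _ _ a]) (fact Tu)+
  have "(LINT y:?A ` K|leb m v. h y)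
      = (\<integral>y. indicator (?A ` K) y *\<^sub>R h y \<partial>density (distr (leb m u) borel ?A) (\<lambda>_. ennreal ?P))"
    unfolding set_lebesgue_integral_def eq ..
  also have "\<dots> = (\<integral>y. ?P *\<^sub>R (indicator (?A ` K) y *\<^sub>R h y) \<partial>distr (leb m u) borel ?A)"
    using P by (intro integral_density) auto
  also have "\<dots> = (\<integral>x. ?P *\<^sub>R (indicator (?A ` K) (?A x) *\<^sub>R h (?A x)) \<partial>leb m u)"
    by (rule integral_distr) measurable
  also have "\<dots> = ?P * (\<integral>x. indicator (?A ` K) (?A x) *\<^sub>R h (?A x) \<partial>leb m u)"
    by simp
  also have "(\<integral>x. indicator (?A ` K) (?A x) *\<^sub>R h (?A x) \<partial>leb m u) = (\<integral>x. indicator K x *\<^sub>R h (?A x) \<partial>leb m u)"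
  proof (rule integral_cong_AE)
    show "AE x in leb m u. indicator (?A ` K) (?A x) *\<^sub>R h (?A x) = indicator K x *\<^sub>R h (?A x)"
      using AE_leb_span[OF u]
    proof eventually_elim
      case (elim x)
      have "?A x \<in> ?A ` K \<longleftrightarrow> x \<in> K" using injA elim inj(2) K(2) by (intro inj_on_image_mem_iff) auto
      then show ?case by (simp add: indicator_def)
    qed
  qed measurable
  finally show ?thesis by (simp add: set_lebesgue_integral_def)
qed

lemma measure_affine_image:
  fixes u v :: "nat \<Rightarrow> 'a::{real_inner, second_countable_topology}"
  assumes u: "orthonormal m u" and v: "orthonormal m v" and T: "bounded_linear T"
    and Tu: "\<And>i. i < m \<Longrightarrow> T (u i) = s i *\<^sub>R v i" "\<And>i. i < m \<Longrightarrow> s i > 0"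
    and a: "a \<in> span (v ` {..<m})" and inj: "inj_on T W" "span (u ` {..<m}) \<subseteq> W"
    and K: "compact K" "K \<subseteq> W"
  shows "measure (leb m v) ((\<lambda>x. T x + a) ` K) = (\<Prod>i<m. s i) * measure (leb m u) K"
proof -
  have "compact ((\<lambda>x. T x + a) ` K)"
    using K T by (intro compact_continuous_image continuous_intros linear_continuous_on)
  then show ?thesis
    using set_integral_affine_image[OF u T Tu a inj K, of "\<lambda>_. 1"] set_integral_leb_const[OF v, of _ 1]
      set_integral_leb_const[OF u K(1), of 1] by simp
qed

lemma bounded_linear_coordinates:
  "bounded_linear (\<lambda>x. \<Sum>i<n. (x \<bullet> u i) *\<^sub>R w i)" for u w :: "nat \<Rightarrow> 'a::real_inner"
  by (intro bounded_linear_sum bounded_linear_compose[OF bounded_linear_scaleR_left bounded_linear_inner_left])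

lemma adjoint_coordinates:
  "(\<Sum>i<n. (x \<bullet> u i) *\<^sub>R w i) \<bullet> \<xi> = x \<bullet> (\<Sum>i<n. (w i \<bullet> \<xi>) *\<^sub>R u i)" for u w :: "nat \<Rightarrow> 'a::real_inner"
  by (simp add: inner_sum_left inner_sum_right mult.commute)

lemma prod_increasing_power:
  fixes s :: "nat \<Rightarrow> real"
  assumes "m \<le> n" "\<And>i. i < n \<Longrightarrow> s i > 0" "\<And>i j. i \<le> j \<Longrightarrow> j < n \<Longrightarrow> s i \<le> s j"
  shows "(\<Prod>i<m. s i) ^ n \<le> (\<Prod>i<n. s i) ^ m"
  using assms
proof (induction n rule: dec_induct)
  case base
  then show ?case by simp
next
  case (step n)
  have pos: "0 \<le> (\<Prod>i<m. s i)" "0 \<le> (\<Prod>i<n. s i)"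
    using step by (auto intro!: prod_nonneg simp: less_imp_le)
  have "(\<Prod>i<m. s i) \<le> (\<Prod>i<m. s n)"
    using step by (intro prod_mono) (auto simp: less_imp_le)
  then have "(\<Prod>i<m. s i) ^ n * (\<Prod>i<m. s i) \<le> (\<Prod>i<n. s i) ^ m * s n ^ m"
    using step pos by (intro mult_mono) auto
  then show ?case by (simp add: power_mult_distrib mult.commute)
qed

text \<open>In a singular value decomposition of \<open>T\<close>, \<open>H\<close> is spanned by the \<open>m\<close> directions that \<open>T\<close>
  stretches least, so the volume factor of \<open>T\<close> on \<open>H\<close> is at most the power \<open>m / n\<close> of its
  determinant, while the section of the isotropic image by the image of \<open>H\<close> is large.\<close>

lemma large_central_section:
  assumes cb: "convex_body n K" and bK: "barycenter n K = 0" and n: "n = m + k" and m: "m \<ge> 1"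
    and T: "linear T" "bij_betw T (euc n) (euc n)" and b: "b \<in> euc n"
    and iso: "isotropic n ((\<lambda>x. T x + b) ` K) L"
  shows "\<exists>H\<in>grassmannian n m.
    vol (euc n) K powr (real m / real n) \<le> (sqrt (2 * pi * exp 1) * L) ^ k * vol H (K \<inter> H)"
proof -
  have K: "compact K" "convex K" "K \<subseteq> euc n" using cb by (auto simp: convex_body_def)
  have n1: "n \<ge> 1" using n m by simp
  \<comment> \<open>The sign orders the axes by increasing stretch.\<close>
  define q where "q x y = - (T x \<bullet> T y)" for x y
  have "bilinear q"
    unfolding bilinear_def q_def
    by (intro conjI allI linearI) (auto simp: linear_add[OF T(1)] linear_scale[OF T(1)] inner_add_left inner_add_right)
  moreover have "q x y = q y x" for x y by (simp add: q_def inner_commute)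
  ultimately obtain u where u: "orthonormal n u" "span (u ` {..<n}) = euc n"
    and qo: "\<And>i j. i < n \<Longrightarrow> j < n \<Longrightarrow> i \<noteq> j \<Longrightarrow> q (u i) (u j) = 0"
    and qd: "\<And>i j. i \<le> j \<Longrightarrow> j < n \<Longrightarrow> q (u j) (u j) \<le> q (u i) (u i)"
    using orthonormal_diagonalization[OF _ _ orthonormal_unit_vec, of q n] unfolding span_unit_vec by blast
  have uE: "u i \<in> euc n" if "i < n" for i using that u(2) span_base[of "u i" "u ` {..<n}"] by auto
  have injT: "inj_on T (euc n)" using T(2) by (simp add: bij_betw_def)
  have TE: "T x \<in> euc n" if "x \<in> euc n" for x using T(2) that by (auto simp: bij_betw_def)
  define s where "s i = norm (T (u i))" for i
  have s: "s i > 0" if i: "i < n" for i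
  proof -
    have "T (u i) \<noteq> T 0"
      using injT uE[OF i] subspace_0[OF subspace_euc, of n] orthonormal_norm[OF u(1) i] by (auto dest: inj_onD)
    then show ?thesis by (simp add: s_def linear_0[OF T(1)])
  qed
  have s_mono: "s i \<le> s j" if "i \<le> j" "j < n" for i j
    using qd[OF that] by (simp add: q_def s_def norm_le)
  define v where "v i = T (u i) /\<^sub>R s i" for i
  have Tv: "T (u i) = s i *\<^sub>R v i" if "i < n" for i using s[OF that] by (simp add: v_def)
  have v: "orthonormal n v"
    unfolding orthonormal_def
  proof (intro allI impI)
    fix i j assume ij: "i < n" "j < n"
    show "v i \<bullet> v j = (if i = j then 1 else 0)"
    proof (cases "i = j")
      case True
      have "T (u i) \<bullet> T (u i) = s i * s i" by (simp add: s_def power2_norm_eq_inner[symmetric] power2_eq_square)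
      then show ?thesis using True s[OF ij(1)] by (simp add: v_def field_simps)
    next
      case False
      then show ?thesis using qo[OF ij False] by (simp add: v_def q_def)
    qed
  qed
  have vE: "v i \<in> euc n" if "i < n" for i
    using TE[OF uE[OF that]] subspace_scale[OF subspace_euc] by (simp add: v_def)
  have vs: "span (v ` {..<n}) = euc n"
    using orthonormal_span_eq[OF v orthonormal_unit_vec] vE unfolding span_unit_vec by blast
  \<comment> \<open>\<open>T\<close> is arbitrary off \<open>euc n\<close>, so it is replaced by a bounded map with the same restriction.\<close>
  define T' where "T' x = (\<Sum>i<n. (x \<bullet> u i) *\<^sub>R T (u i))" for x
  have T': "bounded_linear T'" unfolding T'_def by (rule bounded_linear_coordinates)
  have T'T: "T' x = T x" if "x \<in> euc n" for x
  proof -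
    have "T x = T (\<Sum>i<n. (x \<bullet> u i) *\<^sub>R u i)" using span_expand[OF u(1)] that u(2) by simp
    then show ?thesis by (simp add: T'_def linear_sum[OF T(1)] linear_scale[OF T(1)])
  qed
  have injT': "inj_on T' (euc n)" using injT T'T by (simp add: inj_on_def)
  have T'u: "T' (u i) = s i *\<^sub>R v i" if "i < n" for i using Tv[OF that] T'T[OF uE[OF that]] by simp
  define K' where "K' = (\<lambda>x. T' x + b) ` K"
  have "(\<lambda>x. T x + b) ` K = K'" unfolding K'_def using K T'T by (intro image_cong) auto
  with iso have iso: "isotropic n K' L" by simp
  then have cb': "convex_body n K'" and vol1: "vol (euc n) K' = 1" and b0: "barycenter n K' = 0" and L: "L > 0"
    by (auto simp: isotropic_def)
  then have K': "compact K'" "convex K'" "K' \<subseteq> euc n" by (auto simp: convex_body_def)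
  have b': "b \<in> span (v ` {..<n})" using b vs by simp
  have volK: "vol (euc n) K = measure (leb n u) K" by (rule vol_eq_leb[OF u borel_of_compact[OF K(1)] K(3)])
  have volK': "measure (leb n v) K' = 1"
    using vol_eq_leb[OF v vs borel_of_compact[OF K'(1)] K'(3)] vol1 by simp
  have det: "(\<Prod>i<n. s i) * vol (euc n) K = 1"
    using measure_affine_image[OF u(1) v T' T'u s b' injT' _ K(1,3)] u(2) volK' volK by (simp add: K'_def)
  have Ppos: "(\<Prod>i<n. s i) > 0" using s by (intro prod_pos) auto
  have Vpos: "vol (euc n) K > 0" using det Ppos by (smt (verit) zero_less_mult_pos)
  have mean': "(LINT x:K'|leb n v. x \<bullet> \<xi>) = 0" for \<xi>
    using barycenter_zero_imp[OF K'(1,3) _ v vs b0] vol1 by simp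
  \<comment> \<open>Both barycenters are at the origin, so an affine isotropic position is already linear.\<close>
  have "b = 0"
  proof -
    have "0 = (\<Prod>i<n. s i) * (LINT x:K|leb n u. (T' x + b) \<bullet> b)"
    proof -
      have "continuous_on UNIV (\<lambda>x. x \<bullet> b)" by (intro continuous_intros)
      from set_integral_affine_image[OF u(1) T' T'u s b' injT' _ K(1,3) this] show ?thesis
        using mean'[of b] u(2) by (simp add: K'_def)
    qed
    then have "0 = (LINT x:K|leb n u. (T' x + b) \<bullet> b)" using Ppos by (metis less_irrefl mult_eq_0_iff)
    also have "\<dots> = (LINT x:K|leb n u. x \<bullet> (\<Sum>i<n. (T (u i) \<bullet> b) *\<^sub>R u i) + b \<bullet> b)"
      unfolding T'_def inner_add_left adjoint_coordinates ..
    also have "\<dots> = (LINT x:K|leb n u. x \<bullet> (\<Sum>i<n. (T (u i) \<bullet> b) *\<^sub>R u i)) + (LINT x:K|leb n u. b \<bullet> b)"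
      by (intro set_integral_add set_integrable_leb u K continuous_intros)
    also have "\<dots> = (b \<bullet> b) * measure (leb n u) K"
      using barycenter_zero_imp[OF K(1,3) Vpos u bK] set_integral_leb_const[OF u(1) K(1)] by simp
    finally show ?thesis using Vpos volK by simp
  qed
  obtain r where r: "r > 0" "\<And>x. x \<in> unit_ball (euc n) \<Longrightarrow> r *\<^sub>R x \<in> K'"
    using barycenter_interior[OF cb' b0 n1] by blast
  have "(1 / (sqrt (2 * pi * exp 1) * L)) ^ k \<le> measure (leb m v) K'"
  proof (rule isotropic_central_section[of m k v K' r L])
    show "orthonormal (m + k) v" "measure (leb (m + k) v) K' = 1" "L > 0" "r > 0" "compact K'" "convex K'"
      using v volK' L r K' by (simp_all add: n)
    show "x \<in> K'" if "x \<in> span (v ` {..<m + k})" "norm x \<le> r" for x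
    proof -
      have "(1 / r) *\<^sub>R x \<in> unit_ball (euc n)"
        using that r vs n subspace_scale[OF subspace_euc] by (simp add: unit_ball_eq)
      from r(2)[OF this] show ?thesis using r by simp
    qed
    show "(LINT x:K'|leb (m + k) v. x \<bullet> \<xi>) = 0" for \<xi> using mean' n by simp
    show "(LINT x:K'|leb (m + k) v. (x \<bullet> v i)\<^sup>2) = L\<^sup>2" if i: "i < m + k" for i
    proof -
      have "(LINT x:K'|lebesgue_sub (euc n). (x \<bullet> v i)\<^sup>2) = L\<^sup>2"
        using iso vE[of i] orthonormal_norm[OF v, of i] i n by (simp add: isotropic_def)
      moreover have "(\<lambda>x. (x \<bullet> v i)\<^sup>2) \<in> borel_measurable borel"
        by (intro borel_measurable_continuous_onI continuous_intros)
      ultimately show ?thesis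
        using set_integral_lebesgue_sub[OF v vs borel_of_compact[OF K'(1)]] n by simp
    qed
  qed
  also define H where "H = span (u ` {..<m})"
  have um: "orthonormal m u" and vm: "orthonormal m v"
    using orthonormal_mono[OF u(1), of m] orthonormal_mono[OF v, of m] n by auto
  have "u ` {..<m} \<subseteq> u ` {..<n}" using n by auto
  then have HE: "H \<subseteq> euc n" unfolding H_def u(2)[symmetric] by (rule span_mono)
  have cKH: "compact (K \<inter> H)"
    using compact_Int_closed[OF K(1) closed_span_orthonormal[OF um]] by (simp add: H_def)
  have sub: "K' \<inter> span (v ` {..<m}) \<subseteq> (\<lambda>x. T' x + 0) ` (K \<inter> H)"
  proof
    fix y assume y: "y \<in> K' \<inter> span (v ` {..<m})"
    then obtain x where x: "x \<in> K" "y = T' x" by (auto simp: K'_def \<open>b = 0\<close>)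
    define z where "z = (\<Sum>i<m. ((y \<bullet> v i) / s i) *\<^sub>R u i)"
    have zH: "z \<in> H" unfolding z_def H_def by (rule comb_in_span)
    have "T' z = (\<Sum>i<m. ((y \<bullet> v i) / s i) *\<^sub>R T' (u i))"
      using T' by (simp add: z_def linear_sum linear_scale bounded_linear.linear)
    also have "\<dots> = (\<Sum>i<m. (y \<bullet> v i) *\<^sub>R v i)"
      using n by (intro sum.cong) (auto simp: T'u less_imp_neq[OF s, symmetric])
    also have "\<dots> = T' x" using span_expand[OF vm] y x by simp
    finally have "z = x" using injT' zH HE x K by (auto dest: inj_onD)
    then show "y \<in> (\<lambda>x. T' x + 0) ` (K \<inter> H)" using x zH by auto
  qed
  have "measure (leb m v) K' \<le> measure (leb m v) ((\<lambda>x. T' x + 0) ` (K \<inter> H))"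
    using cKH T'
    by (intro measure_leb_mono[OF vm] sub borel_of_compact K' compact_continuous_image continuous_intros linear_continuous_on)
  also have "\<dots> = (\<Prod>i<m. s i) * measure (leb m u) (K \<inter> H)"
    using n K HE by (intro measure_affine_image[OF um vm T' _ _ _ injT' _ cKH] T'u s) (auto simp: span_zero H_def)
  also have "measure (leb m u) (K \<inter> H) = vol H (K \<inter> H)"
    by (rule vol_eq_leb[OF um H_def[symmetric] borel_of_compact[OF cKH], symmetric]) simp
  finally have main: "(1 / (sqrt (2 * pi * exp 1) * L)) ^ k \<le> (\<Prod>i<m. s i) * vol H (K \<inter> H)" .
  have Pm: "(\<Prod>i<m. s i) * vol (euc n) K powr (real m / real n) \<le> 1"
  proof -
    have P0: "(\<Prod>i<m. s i) > 0" using s n by (intro prod_pos) auto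
    have "(\<Prod>i<m. s i) ^ n \<le> (\<Prod>i<n. s i) ^ m"
      using n s s_mono by (intro prod_increasing_power) auto
    then have "((\<Prod>i<m. s i) ^ n) powr (1 / real n) \<le> ((\<Prod>i<n. s i) ^ m) powr (1 / real n)"
      using P0 by (intro powr_mono2) auto
    then have "(\<Prod>i<m. s i) \<le> (\<Prod>i<n. s i) powr (real m / real n)"
      using P0 Ppos n1 by (simp add: powr_realpow[symmetric] powr_powr)
    then have "(\<Prod>i<m. s i) * vol (euc n) K powr (real m / real n)
        \<le> (\<Prod>i<n. s i) powr (real m / real n) * vol (euc n) K powr (real m / real n)"
      by (rule mult_right_mono) simp
    also have "\<dots> = 1" using det Ppos Vpos by (simp add: powr_mult[symmetric])
    finally show ?thesis .
  qed
  define c where "c = sqrt (2 * pi * exp 1) * L"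
  have c: "c > 0" using L by (simp add: c_def)
  have "vol (euc n) K powr (real m / real n) = c ^ k * (1 / c) ^ k * vol (euc n) K powr (real m / real n)"
    using c unfolding power_mult_distrib[symmetric] by simp
  also have "\<dots> \<le> c ^ k * ((\<Prod>i<m. s i) * vol H (K \<inter> H)) * vol (euc n) K powr (real m / real n)"
    using main c unfolding c_def[symmetric] by (intro mult_right_mono mult_left_mono) auto
  also have "\<dots> = c ^ k * vol H (K \<inter> H) * ((\<Prod>i<m. s i) * vol (euc n) K powr (real m / real n))"
    by (simp only: mult_ac)
  also have "\<dots> \<le> c ^ k * vol H (K \<inter> H) * 1"
    using c by (intro mult_left_mono Pm) (simp add: vol_def)
  finally have "vol (euc n) K powr (real m / real n) \<le> (sqrt (2 * pi * exp 1) * L) ^ k * vol H (K \<inter> H)"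
    unfolding c_def by simp
  moreover have "H \<in> grassmannian n m"
    using HE dim_span_orthonormal[OF um] by (auto simp: grassmannian_def H_def)
  ultimately show ?thesis by blast
qed

section \<open>Isotropic position\<close>

text \<open>The covariance form of the body is diagonalised, and each axis is rescaled by the inverse of
  its standard deviation.\<close>

lemma isotropic_position_exists:
  assumes cb: "convex_body n K" and bK: "barycenter n K = 0" and n: "n \<ge> 1"
  shows "\<exists>L T b. linear T \<and> bij_betw T (euc n) (euc n) \<and> b \<in> euc n \<and> isotropic n ((\<lambda>x. T x + b) ` K) L"
proof -
  have K: "compact K" "convex K" "K \<subseteq> euc n" using cb by (auto simp: convex_body_def)
  define q where "q \<xi> \<eta> = (LINT x:K|leb n unit_vec. (x \<bullet> \<xi>) * (x \<bullet> \<eta>))" for \<xi> \<eta>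
  have int: "set_integrable (leb n unit_vec) K (\<lambda>x. (x \<bullet> \<xi>) * (x \<bullet> \<eta>))" for \<xi> \<eta>
    by (intro set_integrable_leb orthonormal_unit_vec K continuous_intros)
  have qsym: "q x y = q y x" for x y by (simp add: q_def mult.commute)
  have lin: "linear (q \<xi>)" for \<xi>
  proof (rule linearI)
    show "q \<xi> (a + b) = q \<xi> a + q \<xi> b" for a b
      using set_integral_add(2)[OF int[of \<xi> a] int[of \<xi> b]] by (simp add: q_def inner_add_right distrib_left)
    show "q \<xi> (c *\<^sub>R a) = c *\<^sub>R q \<xi> a" for c a
      by (simp add: q_def mult.left_commute)
  qed
  have bil: "bilinear q"
  proof -
    have "(\<lambda>x. q x y) = q y" for y using qsym by auto
    then show ?thesis using lin by (simp add: bilinear_def)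
  qed
  obtain u where u: "orthonormal n u" "span (u ` {..<n}) = euc n"
    and qo: "\<And>i j. i < n \<Longrightarrow> j < n \<Longrightarrow> i \<noteq> j \<Longrightarrow> q (u i) (u j) = 0"
  proof (rule orthonormal_diagonalization[OF bil qsym orthonormal_unit_vec[of n]])
    fix w assume "orthonormal n w" "span (w ` {..<n}) = span (unit_vec ` {..<n})"
      and "\<And>i j. i < n \<Longrightarrow> j < n \<Longrightarrow> i \<noteq> j \<Longrightarrow> q (w i) (w j) = 0"
    then show thesis by (intro that) (simp_all only: span_unit_vec)
  qed
  have leb_u: "leb n unit_vec = leb n u"
    by (rule leb_basis_independent[OF orthonormal_unit_vec u(1)]) (simp add: u span_unit_vec)
  have uE: "u i \<in> euc n" if "i < n" for i using that u(2) span_base[of "u i" "u ` {..<n}"] by auto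
  obtain r where r: "r > 0" "\<And>x. x \<in> unit_ball (euc n) \<Longrightarrow> r *\<^sub>R x \<in> K"
    using barycenter_interior[OF cb bK n] by blast
  have rK: "x \<in> K" if "x \<in> euc n" "norm x \<le> r" for x
  proof -
    have "(1 / r) *\<^sub>R x \<in> unit_ball (euc n)"
      using that r subspace_scale[OF subspace_euc] by (simp add: unit_ball_eq)
    from r(2)[OF this] show ?thesis using r by simp
  qed
  define V where "V = vol (euc n) K"
  have V: "V > 0"
    unfolding V_def using r subspace_0[OF subspace_euc]
    by (intro surface_area_bounds(1)[OF orthonormal_unit_vec span_unit_vec n K r(1), of 0]) auto
  have volK: "V = measure (leb n u) K" unfolding V_def by (rule vol_eq_leb[OF u borel_of_compact[OF K(1)] K(3)])
  define \<alpha> where "\<alpha> i = q (u i) (u i)" for i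
  have \<alpha>: "\<alpha> i > 0" if i: "i < n" for i
  proof -
    \<comment> \<open>A ball in \<open>K\<close> on which the \<open>i\<close>-th coordinate is at least \<open>r / 4\<close>.\<close>
    let ?Q = "(\<lambda>b. (r / 4) *\<^sub>R b + (r / 2) *\<^sub>R u i) ` unit_ball (euc n)"
    have c: "(r / 2) *\<^sub>R u i \<in> euc n" using uE[OF i] subspace_scale[OF subspace_euc] by blast
    have QK: "?Q \<subseteq> K"
    proof clarify
      fix b assume b: "b \<in> unit_ball (euc n)"
      have "norm ((r / 4) *\<^sub>R b + (r / 2) *\<^sub>R u i) \<le> norm ((r / 4) *\<^sub>R b) + norm ((r / 2) *\<^sub>R u i)"
        by (rule norm_triangle_ineq)
      also have "\<dots> = (r / 4) * norm b + r / 2" using r orthonormal_norm[OF u(1) i] by simp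
      also have "\<dots> \<le> (r / 4) * 1 + r / 2"
        using b r by (intro add_right_mono mult_left_mono) (auto simp: unit_ball_eq)
      also have "\<dots> \<le> r" using r by simp
      finally show "(r / 4) *\<^sub>R b + (r / 2) *\<^sub>R u i \<in> K"
        using b c by (intro rK) (auto simp: unit_ball_eq intro!: subspace_add subspace_euc subspace_scale)
    qed
    have Qge: "(r / 4)\<^sup>2 \<le> (x \<bullet> u i) * (x \<bullet> u i)" if "x \<in> ?Q" for x
    proof -
      obtain b where b: "b \<in> unit_ball (euc n)" "x = (r / 4) *\<^sub>R b + (r / 2) *\<^sub>R u i"
        using \<open>x \<in> ?Q\<close> by auto
      have "\<bar>b \<bullet> u i\<bar> \<le> 1"
        using Cauchy_Schwarz_ineq2[of b "u i"] b orthonormal_norm[OF u(1) i] by (simp add: unit_ball_eq)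
      then have "(r / 4) * (b \<bullet> u i) \<ge> (r / 4) * (- 1)" using r by (intro mult_left_mono) auto
      moreover have "x \<bullet> u i = (r / 4) * (b \<bullet> u i) + r / 2"
        using orthonormal_inner[OF u(1) i i] by (simp add: b(2) inner_add_left)
      ultimately have "r / 4 \<le> x \<bullet> u i" by simp
      then have "(r / 4)\<^sup>2 \<le> (x \<bullet> u i)\<^sup>2" using r by (intro power_mono) auto
      then show ?thesis by (simp add: power2_eq_square)
    qed
    show ?thesis
      unfolding \<alpha>_def q_def leb_u
      using measure_leb_small_ball[OF u _ c, of "r / 4"] r Qge QK K
      by (intro set_integral_leb_pos[where Q = ?Q and d = "(r / 4)\<^sup>2"] u) (auto intro!: continuous_intros)
  qed
  define D where "D = (\<Prod>i<n. sqrt (\<alpha> i))"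
  have D: "D > 0" unfolding D_def using \<alpha> by (intro prod_pos) auto
  \<comment> \<open>The common scale that makes the image have volume one.\<close>
  define \<sigma> where "\<sigma> = (D / V) powr (1 / real n)"
  have \<sigma>: "\<sigma> > 0" using D V by (simp add: \<sigma>_def)
  have \<sigma>n: "\<sigma> ^ n = D / V" using D V n by (simp add: \<sigma>_def powr_realpow[symmetric] powr_powr)
  define s where "s i = \<sigma> / sqrt (\<alpha> i)" for i
  have s: "s i > 0" if "i < n" for i using \<sigma> \<alpha>[OF that] by (simp add: s_def)
  have prod_s: "(\<Prod>i<n. s i) = 1 / V"
  proof -
    have "(\<Prod>i<n. s i) = \<sigma> ^ n / D" by (simp add: s_def D_def prod_dividef)
    then show ?thesis using D by (simp add: \<sigma>n)
  qed
  define T where "T x = (\<Sum>i<n. (x \<bullet> u i) *\<^sub>R s i *\<^sub>R u i)" for x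
  define R where "R x = (\<Sum>i<n. (x \<bullet> u i) *\<^sub>R (1 / s i) *\<^sub>R u i)" for x
  have bT: "bounded_linear T" and bR: "bounded_linear R"
    unfolding T_def R_def by (rule bounded_linear_coordinates)+
  have TE: "T x \<in> euc n" and RE: "R x \<in> euc n" for x
    unfolding T_def R_def u(2)[symmetric] scaleR_scaleR by (rule comb_in_span)+
  have RT: "R (T x) = x" and TR: "T (R x) = x" if "x \<in> euc n" for x
  proof -
    have e: "(\<Sum>i<n. (x \<bullet> u i) *\<^sub>R u i) = x" using that u by (intro span_expand) auto
    have "R (T x) = (\<Sum>i<n. (x \<bullet> u i) *\<^sub>R u i)"
      unfolding R_def
    proof (rule sum.cong)
      fix i assume "i \<in> {..<n}"
      then show "(T x \<bullet> u i) *\<^sub>R (1 / s i) *\<^sub>R u i = (x \<bullet> u i) *\<^sub>R u i"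
        using comb_inner[OF u(1), of i "\<lambda>i. (x \<bullet> u i) * s i"] s[of i] by (simp add: T_def)
    qed simp
    then show "R (T x) = x" by (simp add: e)
    have "T (R x) = (\<Sum>i<n. (x \<bullet> u i) *\<^sub>R u i)"
      unfolding T_def
    proof (rule sum.cong)
      fix i assume "i \<in> {..<n}"
      then show "(R x \<bullet> u i) *\<^sub>R s i *\<^sub>R u i = (x \<bullet> u i) *\<^sub>R u i"
        using comb_inner[OF u(1), of i "\<lambda>i. (x \<bullet> u i) / s i"] s[of i] by (simp add: R_def)
    qed simp
    then show "T (R x) = x" by (simp add: e)
  qed
  have bij: "bij_betw T (euc n) (euc n)"
    by (rule bij_betw_byWitness[where f' = R]) (auto simp: RT TR TE RE)
  then have inj: "inj_on T (euc n)" by (simp add: bij_betw_def)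
  have Tu: "T (u i) = s i *\<^sub>R u i" if "i < n" for i
  proof -
    have "T (u i) = (\<Sum>j<n. if j = i then s i *\<^sub>R u i else 0)"
      unfolding T_def using u(1) that by (intro sum.cong) (auto simp: orthonormal_def)
    then show ?thesis using that by simp
  qed
  define K' where "K' = (\<lambda>x. T x + 0) ` K"
  have K': "compact K'" "convex K'" "K' \<subseteq> euc n"
    unfolding K'_def using K bT TE
    by (auto intro!: compact_continuous_image linear_continuous_on convex_linear_image bounded_linear.linear)
  have cb': "convex_body n K'"
  proof -
    obtain B where B: "B > 0" "\<And>x. norm (R x) \<le> norm x * B" using bounded_linear.pos_bounded[OF bR] by blast
    show ?thesis
    proof (rule convex_body_of_ball[OF K'])
      show "r / B > 0" using r B by simp
      fix x assume x: "x \<in> euc n" "norm x \<le> r / B"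
      have "norm (R x) \<le> r" using B(2)[of x] x(2) B(1) by (simp add: field_simps)
      then have "R x \<in> K" by (intro rK RE)
      then show "x \<in> K'" unfolding K'_def using TR[OF x(1)] by force
    qed
  qed
  have vol1: "vol (euc n) K' = 1"
    using vol_eq_leb[OF u borel_of_compact[OF K'(1)] K'(3)]
      measure_affine_image[OF u(1) u(1) bT Tu s span_zero inj _ K(1,3)] u(2) prod_s V volK
    by (simp add: K'_def)
  have change: "(LINT y:K'|lebesgue_sub (euc n). h y) = (1 / V) * (LINT x:K|leb n u. h (T x))"
    if h: "continuous_on UNIV h" for h
    using set_integral_lebesgue_sub[OF u borel_of_compact[OF K'(1)] borel_measurable_continuous_onI[OF h]]
      set_integral_affine_image[OF u(1) bT Tu s span_zero inj _ K(1,3) h] u(2) prod_s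
    by (simp add: K'_def)
  have adj: "T x \<bullet> \<xi> = x \<bullet> (\<Sum>i<n. (s i * (u i \<bullet> \<xi>)) *\<^sub>R u i)" for x \<xi>
    unfolding T_def adjoint_coordinates by simp
  have mean: "(LINT y:K'|lebesgue_sub (euc n). coord y i) = 0" for i
  proof -
    have "continuous_on UNIV (\<lambda>y. y \<bullet> unit_vec i)" by (intro continuous_intros)
    from change[OF this] show ?thesis
      unfolding coord_eq_inner adj barycenter_zero_imp[OF K(1,3) V[unfolded V_def] u bK] by simp
  qed
  have moment: "(LINT y:K'|lebesgue_sub (euc n). (y \<bullet> \<xi>)\<^sup>2) = (\<sigma> / sqrt V)\<^sup>2" if \<xi>: "\<xi> \<in> euc n" "norm \<xi> = 1" for \<xi>
  proof -
    define \<eta> where "\<eta> = (\<Sum>i<n. (s i * (u i \<bullet> \<xi>)) *\<^sub>R u i)"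
    have \<eta>: "\<eta> \<in> span (u ` {..<n})" "\<And>i. i < n \<Longrightarrow> \<eta> \<bullet> u i = s i * (u i \<bullet> \<xi>)"
      unfolding \<eta>_def by (rule comb_in_span) (rule comb_inner[OF u(1)])
    have "(LINT y:K'|lebesgue_sub (euc n). (y \<bullet> \<xi>)\<^sup>2) = (1 / V) * q \<eta> \<eta>"
    proof -
      have "continuous_on UNIV (\<lambda>y. (y \<bullet> \<xi>)\<^sup>2)" by (intro continuous_intros)
      from change[OF this] show ?thesis
        unfolding adj \<eta>_def[symmetric] q_def leb_u power2_eq_square .
    qed
    also have "q \<eta> \<eta> = (\<Sum>i<n. \<Sum>j<n. (\<eta> \<bullet> u i) * (\<eta> \<bullet> u j) * q (u i) (u j))"
      unfolding quadratic_form_expand[OF bil u(1) \<eta>(1)] by (simp add: sum.cartesian_product)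
    also have "\<dots> = (\<Sum>i<n. \<Sum>j<n. if j = i then (\<eta> \<bullet> u i) * (\<eta> \<bullet> u i) * \<alpha> i else 0)"
      by (intro sum.cong refl) (auto simp: qo \<alpha>_def)
    also have "\<dots> = (\<Sum>i<n. \<sigma>\<^sup>2 * (\<xi> \<bullet> u i)\<^sup>2)"
    proof (intro sum.cong refl)
      fix i assume i: "i \<in> {..<n}"
      have "s i * s i * \<alpha> i = \<sigma>\<^sup>2"
        using \<alpha>[of i] i by (simp add: s_def power2_eq_square)
      then have "(s i * (u i \<bullet> \<xi>)) * (s i * (u i \<bullet> \<xi>)) * \<alpha> i = \<sigma>\<^sup>2 * (\<xi> \<bullet> u i)\<^sup>2"
        by (simp add: power2_eq_square inner_commute mult_ac)
      then show "(\<Sum>j<n. if j = i then (\<eta> \<bullet> u i) * (\<eta> \<bullet> u i) * \<alpha> i else 0) = \<sigma>\<^sup>2 * (\<xi> \<bullet> u i)\<^sup>2"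
        using i \<eta>(2) by simp
    qed
    also have "\<dots> = \<sigma>\<^sup>2 * (\<Sum>i<n. (\<xi> \<bullet> u i)\<^sup>2)" by (simp add: sum_distrib_left)
    also have "(\<Sum>i<n. (\<xi> \<bullet> u i)\<^sup>2) = 1"
      using comb_norm[OF u(1), of "\<lambda>i. \<xi> \<bullet> u i"] span_expand[OF u(1), of \<xi>] \<xi> u(2) by simp
    finally show ?thesis using V by (simp add: power_divide)
  qed
  have "isotropic n K' (\<sigma> / sqrt V)"
    unfolding isotropic_def using cb' vol1 mean moment \<sigma> V by (simp add: barycenter_def)
  then show ?thesis
    using bij bounded_linear.linear[OF bT] subspace_0[OF subspace_euc]
    unfolding K'_def by blast
qed

section \<open>The inradius\<close>

text \<open>The pairs of a centre and a radius form a compact set, on which the radius attains its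
  maximum; so the greatest radius exists.\<close>

lemma inradius_attained:
  assumes cb: "convex_body n K" and n: "n \<ge> 1"
  obtains x0 where "inradius n K > 0" "x0 \<in> K" "\<And>b. b \<in> unit_ball (euc n) \<Longrightarrow> x0 + inradius n K *\<^sub>R b \<in> K"
proof -
  have K: "compact K" "convex K" "K \<subseteq> euc n" using cb by (auto simp: convex_body_def)
  let ?B = "unit_ball (euc n)"
  have B0: "0 \<in> ?B" using subspace_0[OF subspace_euc] by (simp add: unit_ball_eq)
  define e where "e = unit_vec 0"
  have e: "e \<in> ?B" "norm e = 1"
    using orthonormal_norm[OF orthonormal_unit_vec, of 0 n] n by (auto simp: e_def unit_ball_eq euc_def)
  obtain M where M: "\<And>x. x \<in> K \<Longrightarrow> norm x \<le> M" using compact_imp_bounded[OF K(1)] by (auto simp: bounded_iff)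
  have bound: "r \<le> 2 * M" if "r > 0" "x0 \<in> K" "\<And>b. b \<in> ?B \<Longrightarrow> x0 + r *\<^sub>R b \<in> K" for x0 r
  proof -
    have "r = norm ((x0 + r *\<^sub>R e) - x0)" using that e by simp
    also have "\<dots> \<le> norm (x0 + r *\<^sub>R e) + norm x0" by (rule norm_triangle_ineq4)
    also have "\<dots> \<le> M + M" using that e by (intro add_mono M) auto
    finally show ?thesis by simp
  qed
  define Z where "Z = (K \<times> {0..2 * M}) \<inter> (\<Inter>b\<in>?B. {p. fst p + snd p *\<^sub>R b \<in> K})"
  have cZ: "compact Z"
    unfolding Z_def
  proof (intro compact_Int_closed compact_Times K compact_Icc closed_INT ballI)
    fix b
    have "closed ((\<lambda>p. fst p + snd p *\<^sub>R b) -` K)"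
      using K(1) by (intro closed_vimage continuous_intros compact_imp_closed)
    then show "closed {p. fst p + snd p *\<^sub>R b \<in> K}" by (simp add: vimage_def)
  qed
  obtain x1 r1 where r1: "r1 > 0" "x1 \<in> euc n" "\<And>b. b \<in> ?B \<Longrightarrow> x1 + r1 *\<^sub>R b \<in> K"
    using convex_body_imp_ball[OF cb] by blast
  have x1K: "x1 \<in> K" using r1(3)[OF B0] by simp
  have "(x1, r1) \<in> Z" using r1 x1K bound[OF r1(1) x1K r1(3)] by (auto simp: Z_def)
  then obtain p where p: "p \<in> Z" "\<And>z. z \<in> Z \<Longrightarrow> snd z \<le> snd p"
    using continuous_attains_sup[OF cZ _ continuous_on_snd[OF continuous_on_id]] by blast
  have pos: "snd p > 0" using p(2)[OF \<open>(x1, r1) \<in> Z\<close>] r1 by simp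
  have pK: "fst p \<in> K" "\<And>b. b \<in> ?B \<Longrightarrow> fst p + snd p *\<^sub>R b \<in> K" using p(1) by (auto simp: Z_def)
  have "inradius n K = snd p"
    unfolding inradius_def
  proof (rule Greatest_equality)
    show "0 < snd p \<and> (\<exists>x0\<in>K. {x0 + snd p *\<^sub>R b |b. b \<in> ?B} \<subseteq> K)" using pos pK by blast
    fix r assume "0 < r \<and> (\<exists>x0\<in>K. {x0 + r *\<^sub>R b |b. b \<in> ?B} \<subseteq> K)"
    then obtain x0 where x0: "r > 0" "x0 \<in> K" "\<And>b. b \<in> ?B \<Longrightarrow> x0 + r *\<^sub>R b \<in> K" by blast
    then have "(x0, r) \<in> Z" using bound[OF x0] by (auto simp: Z_def)
    from p(2)[OF this] show "r \<le> snd p" by simp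
  qed
  then show ?thesis using that pos pK by simp
qed

section \<open>Surface area of the body and of its sections\<close>

lemma surface_area_le_t_ratio:
  assumes cb: "convex_body n K" and n: "n \<ge> 1"
  shows "surface_area (euc n) K \<le> d_const n * t_ratio n K * vol (euc n) K powr (real (n - 1) / real n)"
    and "vol (euc n) K > 0"
proof -
  have K: "compact K" "convex K" "K \<subseteq> euc n" using cb by (auto simp: convex_body_def)
  note u = orthonormal_unit_vec[of n] span_unit_vec[of n]
  define \<rho> where "\<rho> = inradius n K"
  obtain x0 where x0: "\<rho> > 0" "x0 \<in> K" "\<And>b. b \<in> unit_ball (euc n) \<Longrightarrow> x0 + \<rho> *\<^sub>R b \<in> K"
    using inradius_attained[OF cb n] unfolding \<rho>_def by blast
  have x0E: "x0 \<in> euc n" using x0 K by auto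
  let ?V = "vol (euc n) K"
  show V: "?V > 0" by (rule surface_area_bounds(1)[OF u n K x0(1) x0E x0(3)])
  have cB: "compact (unit_ball (euc n))" by (rule compact_unit_ball[OF u])
  have sub: "(*\<^sub>R) \<rho> ` unit_ball (euc n) \<subseteq> euc n"
    using subspace_scale[OF subspace_euc] by (auto simp: unit_ball_eq)
  have "vol (euc n) ((*\<^sub>R) \<rho> ` unit_ball (euc n)) = \<rho> ^ n * omega n"
    using vol_eq_leb[OF u borel_of_compact[OF compact_scaling[OF cB]] sub]
      measure_leb_scale[OF u(1) x0(1) cB] measure_unit_ball[OF u] by simp
  then have t: "t_ratio n K = ?V powr (1 / real n) / (\<rho> * omega n powr (1 / real n))"
    using x0(1) V omega_pos[of n] n
    by (simp add: t_ratio_def \<rho>_def[symmetric] powr_divide powr_mult powr_realpow[symmetric] powr_powr)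
  have "?V powr (1 / real n) * ?V powr (real (n - 1) / real n) = ?V"
  proof -
    have "1 / real n + real (n - 1) / real n = 1" using n by (simp add: add_divide_distrib[symmetric])
    then show ?thesis using V by (simp add: powr_add[symmetric])
  qed
  then have "d_const n * t_ratio n K * ?V powr (real (n - 1) / real n) = real n * ?V / \<rho>"
    using omega_pos[of n] by (simp add: t d_const_def)
  then show "surface_area (euc n) K \<le> d_const n * t_ratio n K * ?V powr (real (n - 1) / real n)"
    using surface_area_bounds(3)[OF u n K x0(1) x0E x0(3)] by simp
qed

text \<open>The upper bound is uniform in \<open>H\<close>; it makes the supremum over the Grassmannian a genuine one.\<close>

lemma central_section_surface_area:
  assumes K: "compact K" "convex K" and r: "r > 0" "\<And>b. b \<in> unit_ball (euc n) \<Longrightarrow> r *\<^sub>R b \<in> K"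
    and R: "\<And>x. x \<in> K \<Longrightarrow> norm x \<le> R" and H: "H \<in> grassmannian n m" and m: "m \<ge> 1"
  shows "vol H (K \<inter> H) > 0"
    and "d_const m * vol H (K \<inter> H) powr (real (m - 1) / real m) \<le> surface_area H (K \<inter> H)"
    and "surface_area H (K \<inter> H) \<le> real m * (R ^ m * omega m) / r"
proof -
  have H': "subspace H" "H \<subseteq> euc n" "dim H = m" using H by (auto simp: grassmannian_def)
  obtain u where u: "orthonormal m u" "span (u ` {..<m}) = H"
    using subspace_orthonormal_basis[OF H'(1,2)] H'(3) by blast
  have cKH: "compact (K \<inter> H)" using compact_Int_closed[OF K(1) closed_span_orthonormal[OF u(1)]] u by simp
  have vKH: "convex (K \<inter> H)" using K(2) subspace_imp_convex[OF H'(1)] by (rule convex_Int)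
  have b: "0 + r *\<^sub>R b \<in> K \<inter> H" if "b \<in> unit_ball H" for b
    using that r H' by (auto simp: unit_ball_eq subspace_scale)
  note bounds = surface_area_bounds[OF u m cKH vKH Int_lower2 r(1) subspace_0[OF H'(1)] b]
  show "vol H (K \<inter> H) > 0" by (rule bounds)
  show "d_const m * vol H (K \<inter> H) powr (real (m - 1) / real m) \<le> surface_area H (K \<inter> H)" by (rule bounds)
  have "R > 0"
  proof -
    define z where "z = u 0"
    have z: "norm z = 1" "z \<in> H" using orthonormal_norm[OF u(1), of 0] u(2) span_base[of "u 0" "u ` {..<m}"] m
      by (auto simp: z_def)
    then have "r *\<^sub>R z \<in> K" using b[of z] by (auto simp: unit_ball_eq)
    from R[OF this] z r show ?thesis by simp
  qed
  have cB: "compact (unit_ball H)" by (rule compact_unit_ball[OF u])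
  have "vol H (K \<inter> H) = measure (leb m u) (K \<inter> H)" by (rule vol_eq_leb[OF u borel_of_compact[OF cKH]]) simp
  also have "\<dots> \<le> measure (leb m u) ((*\<^sub>R) R ` unit_ball H)"
  proof (intro measure_leb_mono[OF u(1)] borel_of_compact cKH compact_scaling cB)
    show "K \<inter> H \<inter> span (u ` {..<m}) \<subseteq> (*\<^sub>R) R ` unit_ball H"
    proof
      fix x assume x: "x \<in> K \<inter> H \<inter> span (u ` {..<m})"
      then have "(1 / R) *\<^sub>R x \<in> unit_ball H" "x = R *\<^sub>R (1 / R) *\<^sub>R x"
        using R[of x] \<open>R > 0\<close> H' by (auto simp: unit_ball_eq subspace_scale)
      then show "x \<in> (*\<^sub>R) R ` unit_ball H" by (rule rev_image_eqI)
    qed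
  qed
  also have "\<dots> = R ^ m * omega m"
    using measure_leb_scale[OF u(1) \<open>R > 0\<close> cB] measure_unit_ball[OF u] by simp
  finally have "real m * vol H (K \<inter> H) / r \<le> real m * (R ^ m * omega m) / r"
    using r by (intro divide_right_mono mult_left_mono) auto
  then show "surface_area H (K \<inter> H) \<le> real m * (R ^ m * omega m) / r" using bounds(3) by linarith
qed

theorem theorem1p3:
  shows "\<exists>c\<^sub>1::real. c\<^sub>1 > 0 \<and>
    (\<forall>(n::nat) (K::fseq set) (k::nat).
       convex_body n K \<longrightarrow> barycenter n K = 0 \<longrightarrow> 1 \<le> k \<longrightarrow> k \<le> n - 1 \<longrightarrow>
       surface_area (euc n) K
         \<le> d_const n / d_const (n - k)
            * (c\<^sub>1 * isotropic_constant n K) powr (real (k * (n - k - 1)) / real (n - k))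
            * t_ratio n K
            * vol (euc n) K powr (real k / real n)
            * (SUP H\<in>grassmannian n (n - k). surface_area H (K \<inter> H)))"
proof (intro exI[of _ "sqrt (2 * pi * exp 1)"] conjI allI impI)
  show "sqrt (2 * pi * exp 1) > 0" by simp
  fix n K k
  assume cb: "convex_body n K" and bK: "barycenter n K = 0" and k: "1 \<le> k" "k \<le> n - 1"
  define m where "m = n - k"
  have n: "n = m + k" and m: "m \<ge> 1" and n1: "n \<ge> 1" using k by (auto simp: m_def)
  have K: "compact K" "convex K" "K \<subseteq> euc n" using cb by (auto simp: convex_body_def)
  define L where "L = isotropic_constant n K"
  have "\<exists>T b. linear T \<and> bij_betw T (euc n) (euc n) \<and> b \<in> euc n \<and> isotropic n ((\<lambda>x. T x + b) ` K) L"
    unfolding L_def isotropic_constant_def by (rule someI_ex) (rule isotropic_position_exists[OF cb bK n1])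
  then obtain T b where T: "linear T" "bij_betw T (euc n) (euc n)" "b \<in> euc n"
    "isotropic n ((\<lambda>x. T x + b) ` K) L" by blast
  have L: "L > 0" using T(4) by (simp add: isotropic_def)
  define X where "X = sqrt (2 * pi * exp 1) * L"
  have X: "X > 0" using L by (simp add: X_def)
  obtain H where H: "H \<in> grassmannian n m"
    and big: "vol (euc n) K powr (real m / real n) \<le> X ^ k * vol H (K \<inter> H)"
    using large_central_section[OF cb bK n m T] unfolding X_def by blast
  obtain r where r: "r > 0" "\<And>b. b \<in> unit_ball (euc n) \<Longrightarrow> r *\<^sub>R b \<in> K"
    using barycenter_interior[OF cb bK n1] by blast
  obtain R where R: "\<And>x. x \<in> K \<Longrightarrow> norm x \<le> R" using compact_imp_bounded[OF K(1)] by (auto simp: bounded_iff)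
  have sec: "vol H (K \<inter> H) > 0"
    "d_const m * vol H (K \<inter> H) powr (real (m - 1) / real m) \<le> surface_area H (K \<inter> H)"
    "surface_area H (K \<inter> H) \<le> real m * (R ^ m * omega m) / r" if "H \<in> grassmannian n m" for H
    using central_section_surface_area[where n = n and m = m and K = K and r = r and R = R and H = H]
      K(1,2) r R that m by blast+
  define M where "M = (SUP H\<in>grassmannian n m. surface_area H (K \<inter> H))"
  have "surface_area H (K \<inter> H) \<le> M"
    unfolding M_def using sec(3) H by (intro cSUP_upper bdd_aboveI2) auto
  then have SM: "d_const m * vol H (K \<inter> H) powr (real (m - 1) / real m) \<le> M"
    using sec(2)[OF H] by linarith
  let ?V = "vol (euc n) K"
  let ?v = "vol H (K \<inter> H)"
  have V: "?V > 0" by (rule surface_area_le_t_ratio(2)[OF cb n1])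
  have v: "?v > 0" by (rule sec(1)[OF H])
  have dpos: "d_const j > 0" if "j \<ge> 1" for j using omega_pos[of j] that by (simp add: d_const_def)
  have "?V powr (real (n - 1) / real n) = ?V powr (real k / real n) * (?V powr (real m / real n)) powr (real (m - 1) / real m)"
  proof -
    have "real (n - 1) / real n = real k / real n + real m / real n * (real (m - 1) / real m)"
      using m by (simp add: n of_nat_diff add_divide_distrib[symmetric] diff_divide_distrib[symmetric])
    then show ?thesis by (simp add: powr_powr powr_add)
  qed
  \<comment> \<open>Only the second factor is compared with the section; the first one stays in the statement.\<close>
  also have "\<dots> \<le> ?V powr (real k / real n) * (X ^ k * ?v) powr (real (m - 1) / real m)"
    using big by (intro mult_left_mono powr_mono2) auto
  also have "(X ^ k * ?v) powr (real (m - 1) / real m)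
      = X powr (real (k * (m - 1)) / real m) * ?v powr (real (m - 1) / real m)"
    using X v by (simp add: powr_mult powr_realpow[symmetric] powr_powr)
  also have "?v powr (real (m - 1) / real m) \<le> M / d_const m"
    using SM dpos[OF m] by (simp add: field_simps)
  finally have key: "?V powr (real (n - 1) / real n)
      \<le> ?V powr (real k / real n) * (X powr (real (k * (m - 1)) / real m) * (M / d_const m))"
    by (simp add: mult_left_mono)
  have t: "0 \<le> d_const n * t_ratio n K"
    using dpos[OF n1] by (simp add: t_ratio_def)
  have "surface_area (euc n) K \<le> d_const n * t_ratio n K * ?V powr (real (n - 1) / real n)"
    by (rule surface_area_le_t_ratio(1)[OF cb n1])
  also have "\<dots> \<le> d_const n * t_ratio n K *
      (?V powr (real k / real n) * (X powr (real (k * (m - 1)) / real m) * (M / d_const m)))"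
    using key t by (rule mult_left_mono)
  finally show "surface_area (euc n) K
         \<le> d_const n / d_const (n - k)
            * (sqrt (2 * pi * exp 1) * isotropic_constant n K) powr (real (k * (n - k - 1)) / real (n - k))
            * t_ratio n K
            * vol (euc n) K powr (real k / real n)
            * (SUP H\<in>grassmannian n (n - k). surface_area H (K \<inter> H))"
    unfolding m_def[symmetric] L_def[symmetric] X_def[symmetric] M_def[symmetric] by (simp add: mult_ac)
qed

end
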